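(* Let $N\ge 3$, $\alpha>-2$, $\sigma>-1$, $m\le 0$ and $1<p<\frac{N-2m+\alpha}{N-2m-2}$. Let $\zeta(t)=t^\sigma$ for $0<t<1$ and $\zeta(t)=t^m$ for $t\ge 1$, and let $\mathbf{w}\in C_0(\mathbb{R}^N)\cap L^1(\mathbb{R}^N)$ satisfy $\int_{\mathbb{R}^N}\mathbf{w}(x)\,dx>0$. Then the Cauchy problem $$u_t-\Delta u=|x|^\alpha|u|^p+\zeta(t)\,\mathbf{w}(x)\ \text{ in }(0,\infty)\times\mathbb{R}^N,\qquad u(0,x)=u_0(x)\ \text{ in }\mathbb{R}^N,$$ has no global solutions (whatever the initial datum $u_0$).
   Context: $C_0(\mathbb{R}^N)$ is the space of continuous real-valued functions on $\mathbb{R}^N$ vanishing at infinity; $C_B(\mathbb{R}^N)=C(\mathbb{R}^N)\cap L^\infty(\mathbb{R}^N)$, and $C_B([0,T]\times\mathbb{R}^N)$ is defined similarly; $e^{t\Delta}$ is the heat semigroup, i.e. convolution with $G_t(x)=(4\pi t)^{-N/2}e^{-|x|^2/(4t)}$. Solutions may change sign. A global solution is a function $u$ on $[0,\infty)\times\mathbb{R}^N$ as follows. (a) If $\alpha\le 0$: $u_0\in C_B(\mathbb{R}^N)$, $u\in C_B([0,T]\times\mathbb{R}^N)$ for every $T>0$, and $u$ is a mild solution, i.e. for all $t\ge0$ $$u(t)=e^{t\Delta}u_0+\int_0^t e^{(t-\tau)\Delta}\left(|\cdot|^\alpha|u(\tau)|^p\right)d\tau+\int_0^t e^{(t-\tau)\Delta}\left(\zeta(\tau)\mathbf{w}\right)d\tau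 .$$ (b) If $\alpha>0$: let $\nu(x)=(1+|x|)^{\frac{\alpha}{p-1}}$ and $C_\nu(\mathbb{R}^N)=\{\varphi\in C(\mathbb{R}^N):\|\nu\varphi\|_{L^\infty}<\infty\}$ with norm $\|\nu\varphi\|_{L^\infty}$; then $u_0\in C_\nu(\mathbb{R}^N)$, $u\in L^\infty([0,T];C_\nu(\mathbb{R}^N))$ for every $T>0$, and $u$ is a classical solution, i.e. $u$ is continuous on $[0,\infty)\times\mathbb{R}^N$, $u_t$ and $\partial_{x_i}\partial_{x_j}u$ are continuous on $(0,\infty)\times\mathbb{R}^N$, the equation holds pointwise there, and $u(0,\cdot)=u_0$. *)

theory Defs
  imports "HOL-Analysis.Analysis"
begin

definition zeta :: "real \<Rightarrow> real \<Rightarrow> real \<Rightarrow> real" where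
  "zeta \<sigma> m t = (if t < 1 then t powr \<sigma> else t powr m)"

definition heat_kernel :: "real \<Rightarrow> real ^ 'n \<Rightarrow> real" where
  "heat_kernel t x =
     (4 * pi * t) powr (- (real CARD('n) / 2)) * exp (- (norm x)\<^sup>2 / (4 * t))"

definition heat_semigroup :: "real \<Rightarrow> (real ^ 'n \<Rightarrow> real) \<Rightarrow> real ^ 'n \<Rightarrow> real" where
  "heat_semigroup t \<phi> x =
     (if t = 0 then \<phi> x else (LINT y|lborel. heat_kernel t (x - y) * \<phi> y))"

definition C0 :: "(real ^ 'n \<Rightarrow> real) set" where
  "C0 = {\<phi>. continuous_on UNIV \<phi> \<and> (\<phi> \<longlongrightarrow> 0) at_infinity}"

definition CB_strip :: "real \<Rightarrow> (real \<Rightarrow> real ^ 'n \<Rightarrow> real) set" where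
  "CB_strip T = {u. continuous_on ({0..T} \<times> UNIV) (\<lambda>(t, x). u t x) \<and>
                    bounded ((\<lambda>(t, x). u t x) ` ({0..T} \<times> UNIV))}"

text \<open>Since \<open>0 powr a = 0\<close> for every \<open>a\<close>, for \<open>\<alpha> \<le> 0\<close> the weight \<open>norm y powr \<alpha>\<close> has the
  conventional value 0 at the origin. This is a null set, so the integral is not affected.\<close>

definition mild_solution ::
  "real \<Rightarrow> real \<Rightarrow> real \<Rightarrow> real \<Rightarrow> (real ^ 'n \<Rightarrow> real) \<Rightarrow> (real ^ 'n \<Rightarrow> real) \<Rightarrow>
   (real \<Rightarrow> real ^ 'n \<Rightarrow> real) \<Rightarrow> bool" where
  "mild_solution \<alpha> p \<sigma> m w u\<^sub>0 u \<longleftrightarrow>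
     (\<forall>t\<ge>0. \<forall>x. u t x =
        heat_semigroup t u\<^sub>0 x
        + (LINT \<tau>:{0..t}|lborel.
             heat_semigroup (t - \<tau>) (\<lambda>y. norm y powr \<alpha> * \<bar>u \<tau> y\<bar> powr p) x)
        + (LINT \<tau>:{0..t}|lborel.
             heat_semigroup (t - \<tau>) (\<lambda>y. zeta \<sigma> m \<tau> * w y) x))"

definition nu :: "real \<Rightarrow> real \<Rightarrow> real ^ 'n \<Rightarrow> real" where
  "nu \<alpha> p x = (1 + norm x) powr (\<alpha> / (p - 1))"

definition C_nu :: "real \<Rightarrow> real \<Rightarrow> (real ^ 'n \<Rightarrow> real) set" where
  "C_nu \<alpha> p = {\<phi>. continuous_on UNIV \<phi> \<and> bounded (range (\<lambda>x. nu \<alpha> p x * \<phi> x))}"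

text \<open>For continuous functions the essential supremum is the supremum.\<close>

definition C_nu_norm :: "real \<Rightarrow> real \<Rightarrow> (real ^ 'n \<Rightarrow> real) \<Rightarrow> real" where
  "C_nu_norm \<alpha> p \<phi> = (SUP x. \<bar>nu \<alpha> p x * \<phi> x\<bar>)"

text \<open>Essentially bounded functions from \<open>[0, T]\<close> to the space \<open>C_nu\<close>. No measurability
  condition is included; the definition is only applied to jointly continuous \<open>u\<close>.\<close>

definition Linf_C_nu :: "real \<Rightarrow> real \<Rightarrow> real \<Rightarrow> (real \<Rightarrow> real ^ 'n \<Rightarrow> real) set" where
  "Linf_C_nu \<alpha> p T =
     {u. \<exists>M. AE t in lborel. t \<in> {0..T} \<longrightarrow> u t \<in> C_nu \<alpha> p \<and> C_nu_norm \<alpha> p (u t) \<le> M}"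

text \<open>\<open>ut\<close> is the time derivative, \<open>Du j\<close> the partial derivative in \<open>x\<^sub>j\<close>, and
  \<open>DDu i j\<close> the partial derivative in \<open>x\<^sub>i\<close> of \<open>Du j\<close>; all are determined by \<open>u\<close> for
  positive times.\<close>

definition classical_solution ::
  "real \<Rightarrow> real \<Rightarrow> real \<Rightarrow> real \<Rightarrow> (real ^ 'n \<Rightarrow> real) \<Rightarrow> (real ^ 'n \<Rightarrow> real) \<Rightarrow>
   (real \<Rightarrow> real ^ 'n \<Rightarrow> real) \<Rightarrow> bool" where
  "classical_solution \<alpha> p \<sigma> m w u\<^sub>0 u \<longleftrightarrow>
     continuous_on ({0..} \<times> UNIV) (\<lambda>(t, x). u t x) \<and>
     (\<exists>ut Du DDu.
        (\<forall>t>0. \<forall>x. ((\<lambda>s. u s x) has_real_derivative ut t x) (at t)) \<and>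
        (\<forall>j. \<forall>t>0. \<forall>x.
           ((\<lambda>h. u t (x + h *\<^sub>R axis j 1)) has_real_derivative Du j t x) (at 0)) \<and>
        (\<forall>i j. \<forall>t>0. \<forall>x.
           ((\<lambda>h. Du j t (x + h *\<^sub>R axis i 1)) has_real_derivative DDu i j t x) (at 0)) \<and>
        continuous_on ({0<..} \<times> UNIV) (\<lambda>(t, x). ut t x) \<and>
        (\<forall>i j. continuous_on ({0<..} \<times> UNIV) (\<lambda>(t, x). DDu i j t x)) \<and>
        (\<forall>t>0. \<forall>x. ut t x - (\<Sum>i\<in>UNIV. DDu i i t x)
                     = norm x powr \<alpha> * \<bar>u t x\<bar> powr p + zeta \<sigma> m t * w x)) \<and>
     (\<forall>x. u 0 x = u\<^sub>0 x)"

definition global_solution ::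
  "real \<Rightarrow> real \<Rightarrow> real \<Rightarrow> real \<Rightarrow> (real ^ 'n \<Rightarrow> real) \<Rightarrow> (real ^ 'n \<Rightarrow> real) \<Rightarrow>
   (real \<Rightarrow> real ^ 'n \<Rightarrow> real) \<Rightarrow> bool" where
  "global_solution \<alpha> p \<sigma> m w u\<^sub>0 u \<longleftrightarrow>
     (if \<alpha> \<le> 0
      then u\<^sub>0 \<in> bcontfun \<and> (\<forall>T>0. u \<in> CB_strip T) \<and> mild_solution \<alpha> p \<sigma> m w u\<^sub>0 u
      else u\<^sub>0 \<in> C_nu \<alpha> p \<and> (\<forall>T>0. u \<in> Linf_C_nu \<alpha> p T) \<and>
           classical_solution \<alpha> p \<sigma> m w u\<^sub>0 u)"

end

theory Submission
  imports Defs "HOL-Probability.Distributions"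
begin

text \<open>Test a solution with \<open>\<phi> ((t - T) / T) (x / sqrt T)\<close>, where \<open>\<phi>\<close> is nonnegative and compactly
  supported in \<open>[0, 1]\<close> times the unit ball: the initial datum does not enter, and \<open>\<zeta>\<close> is \<open>t powr m\<close> on
  the support. If \<open>\<bar>\<phi>\<^sub>t + \<Delta>\<phi>\<bar> \<le> C \<bar>x\<bar> powr (\<alpha> / p) \<phi> powr (1 / p)\<close>, Young's inequality absorbs the term
  with \<open>u\<close> into the nonlinear one, and the forcing term, of exact order \<open>T powr (m + 1)\<close>, is bounded by a
  multiple of \<open>T powr (N / 2 + 1 - p / (p - 1) - \<alpha> / (2 (p - 1)))\<close>. The condition on \<open>p\<close> says that the
  second exponent is smaller, so \<open>T \<longrightarrow> \<infinity>\<close> gives a contradiction.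

  For large \<open>\<alpha> / (p - 1)\<close> the weight is too degenerate at the origin for a product test function:
  \<open>\<phi>\<^sub>t + \<Delta>\<phi>\<close> has to vanish there to high order although \<open>\<phi>\<close> does not. Near the origin \<open>\<phi>\<close> is
  therefore a truncated power series in \<open>\<bar>x\<bar>\<^sup>2\<close> solving the backward heat equation, with
  \<open>\<phi> t 0 = (t (1 - t)) ^ a\<close>; a large multiple of the next power of \<open>\<bar>x\<bar>\<^sup>2\<close> makes it nonnegative.

  For mild solutions the weak formulation follows from Fubini's theorem and the fact that the heat
  kernel, integrated against \<open>\<phi>\<^sub>t + \<Delta>\<phi>\<close>, reproduces \<open>- \<phi>\<close>.\<close>

section \<open>The heat kernel and the singular weight\<close>

text \<open>Two demands on \<open>\<phi>\<close> compete at the origin. Since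
  \<open>\<phi> s (x / sqrt T)\<close> tends to \<open>\<phi> s 0\<close>, the forcing term sees the
  test function only through its values at \<open>x = 0\<close>, so \<open>\<phi> s 0\<close> must
  be positive. On the other hand Young's inequality leaves
  \<open>\<bar>x\<bar> powr (- \<alpha> / (p - 1))\<close> as a factor of a power of the operator,
  and for \<open>\<alpha> \<ge> N * (p - 1)\<close> this factor is not integrable at the origin
  unless the operator vanishes there. Parabolic homogeneity reconciles the two: the
  \<open>k\<close>-th coefficient of the expansion loses \<open>k\<close> powers of
  \<open>\<rho> = t * (1 - t)\<close>, so the whole sum is \<open>\<rho> ^ a\<close> times a
  polynomial in \<open>r / \<rho>\<close>, where \<open>r = \<bar>x\<bar>\<^sup>2\<close>, with
  coefficients bounded in \<open>t\<close>. Positivity thereby becomes a question about one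
  variable. The cut-off in space is a power of \<open>1 - r ^ K\<close>, whose derivatives bring
  their own powers of \<open>r\<close> and do not spoil the vanishing. Differentiation lowers the
  powers of both cut-offs by a fixed amount, while \<open>\<phi> powr (1 / p)\<close> lowers them by
  a fixed proportion; as \<open>p > 1\<close>, large powers make the second loss the greater
  one.\<close>

lemma lborel_integral_affine:
  fixes f :: "'a::euclidean_space \<Rightarrow> real"
  assumes "f \<in> borel_measurable borel" "c \<noteq> 0"
  shows "(LINT x|lborel. f x) = \<bar>c\<bar> ^ DIM('a) * (LINT x|lborel. f (t + c *\<^sub>R x))"
  using assms
  by (subst lborel_affine[of c t]) (simp_all add: integral_density integral_distr)

lemma nn_integral_lborel_translate:
  fixes f :: "'a::euclidean_space \<Rightarrow> ennreal"
  assumes [measurable]: "f \<in> borel_measurable borel"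
  shows "(\<integral>\<^sup>+x. f (t + x) \<partial>lborel) = (\<integral>\<^sup>+x. f x \<partial>lborel)"
  by (subst (2) lborel_distr_plus[of t, symmetric]) (simp add: nn_integral_distr)

lemma lborel_integral_translate:
  fixes f :: "'a::euclidean_space \<Rightarrow> real"
  assumes "f \<in> borel_measurable borel"
  shows "(LINT x|lborel. f (t + x)) = (LINT x|lborel. f x)"
  using lborel_integral_affine[OF assms, of 1 t] by simp

lemma heat_kernel_nonneg [simp]: "0 \<le> heat_kernel s x"
  by (simp add: heat_kernel_def)

lemma heat_kernel_commute: "heat_kernel s (x - y) = heat_kernel s (y - x)"
  by (simp add: heat_kernel_def norm_minus_commute)

lemma heat_kernel_measurable [measurable (raw)]:
  assumes [measurable]: "f \<in> borel_measurable M" "g \<in> borel_measurable M"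
  shows "(\<lambda>z. heat_kernel (f z) (g z)) \<in> borel_measurable M"
  unfolding heat_kernel_def by measurable

text \<open>The kernel is the joint density of independent centred Gaussians of variance
  \<open>2 * s\<close>, so its total mass reduces to the one-dimensional normalisation.\<close>

lemma heat_kernel_eq_prod:
  fixes x :: "real ^ 'n"
  assumes "s > 0"
  shows "heat_kernel s x = (\<Prod>b\<in>Basis. normal_density 0 (sqrt (2 * s)) (x \<bullet> b))"
proof -
  have n: "(norm x)\<^sup>2 = (\<Sum>b\<in>Basis. (x \<bullet> b)\<^sup>2)"
    by (subst power2_norm_eq_inner, subst euclidean_inner) (simp only: power2_eq_square)
  have "(\<Prod>b\<in>Basis. normal_density 0 (sqrt (2 * s)) (x \<bullet> b))
      = (\<Prod>b\<in>(Basis :: (real ^ 'n) set). (1 / sqrt (4 * pi * s)) * exp (- (x \<bullet> b)\<^sup>2 / (4 * s)))"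
    using assms by (intro prod.cong) (auto simp: normal_density_def mult_ac)
  also have "\<dots> = (1 / sqrt (4 * pi * s)) ^ CARD('n) * exp (\<Sum>b\<in>(Basis :: (real ^ 'n) set). - (x \<bullet> b)\<^sup>2 / (4 * s))"
    by (simp add: prod.distrib exp_sum prod_dividef power_divide)
  also have "(\<Sum>b\<in>(Basis :: (real ^ 'n) set). - (x \<bullet> b)\<^sup>2 / (4 * s)) = - (norm x)\<^sup>2 / (4 * s)"
    by (simp add: n sum_negf flip: sum_divide_distrib)
  also have "(1 / sqrt (4 * pi * s)) ^ CARD('n) = (4 * pi * s) powr (- (real CARD('n) / 2))"
    using assms
    by (simp add: powr_minus powr_half_sqrt[symmetric] powr_powr divide_simps
        flip: powr_realpow)
  finally show ?thesis by (simp add: heat_kernel_def)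
qed

lemma nn_integral_heat_kernel:
  fixes y :: "real ^ 'n"
  assumes "s > 0"
  shows "(\<integral>\<^sup>+x. ennreal (heat_kernel s (x - y)) \<partial>lborel) = 1"
proof -
  have *: "(\<integral>\<^sup>+x. ennreal (normal_density 0 (sqrt (2 * s)) x) \<partial>lborel) = 1"
    using assms by (subst nn_integral_eq_integral) auto
  have "(\<integral>\<^sup>+x. ennreal (heat_kernel s (x - y)) \<partial>lborel)
      = (\<integral>\<^sup>+x. ennreal (heat_kernel s (x :: real ^ 'n)) \<partial>lborel)"
    using nn_integral_lborel_translate[of "\<lambda>x. ennreal (heat_kernel s x)" "-y"]
    by (simp add: heat_kernel_def)
  also have "\<dots> = (\<integral>\<^sup>+x. (\<Prod>b\<in>Basis. ennreal (normal_density 0 (sqrt (2 * s)) ((x :: real ^ 'n) \<bullet> b))) \<partial>lborel)"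
    using assms by (simp add: heat_kernel_eq_prod prod_ennreal)
  also have "\<dots> = (\<Prod>b\<in>(Basis :: (real ^ 'n) set). (\<integral>\<^sup>+x. ennreal (normal_density 0 (sqrt (2 * s)) x) \<partial>lborel))"
    by (rule nn_integral_lborel_prod) auto
  finally show ?thesis by (simp add: *)
qed

lemma integrable_heat_kernel:
  assumes "s > 0"
  shows "integrable lborel (\<lambda>x. heat_kernel s (x - y))"
  using nn_integral_heat_kernel[OF assms, of y] by (intro integrableI_nonneg) auto

lemma integral_heat_kernel:
  assumes "s > 0"
  shows "(LINT x|lborel. heat_kernel s (x - y)) = 1"
  using nn_integral_heat_kernel[OF assms, of y]
  by (subst integral_eq_nn_integral) auto

section \<open>Local integrability of the singular weight\<close>

lemma nn_integral_powr_unit_interval: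
  assumes "\<beta> > -1"
  shows "(\<integral>\<^sup>+x. ennreal (\<bar>x\<bar> powr \<beta> * indicator {-1..1} x) \<partial>lborel) < \<infinity>"
proof -
  let ?f = "\<lambda>x. ennreal (\<bar>x\<bar> powr \<beta> * indicator {0..1} x)"
  have "(\<lambda>x :: real. x powr \<beta>) integrable_on {0..1}"
    using assms by (intro integrable_on_powr_from_0) auto
  then obtain I where "((\<lambda>x :: real. x powr \<beta>) has_integral I) {0..1}" by blast
  then have "(\<integral>\<^sup>+x. ennreal (x powr \<beta>) * indicator {0..1} x \<partial>lborel) = ennreal I"
    by (intro nn_integral_has_integral_lebesgue') auto
  also have "(\<integral>\<^sup>+x. ennreal (x powr \<beta>) * indicator {0..1} x \<partial>lborel) = (\<integral>\<^sup>+x. ?f x \<partial>lborel)"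
    by (intro nn_integral_cong) (auto simp: indicator_def)
  finally have *: "(\<integral>\<^sup>+x. ?f x \<partial>lborel) < \<infinity>" by simp
  have **: "(\<integral>\<^sup>+x. ?f (- x) \<partial>lborel) = (\<integral>\<^sup>+x. ?f x \<partial>lborel)"
    by (subst (2) nn_integral_real_affine[of _ "-1" 0]) auto
  have "(\<integral>\<^sup>+x. ennreal (\<bar>x\<bar> powr \<beta> * indicator {-1..1} x) \<partial>lborel) \<le> (\<integral>\<^sup>+x. ?f x + ?f (- x) \<partial>lborel)"
    by (intro nn_integral_mono) (auto simp: indicator_def)
  also have "\<dots> = (\<integral>\<^sup>+x. ?f x \<partial>lborel) + (\<integral>\<^sup>+x. ?f (- x) \<partial>lborel)"
    by (rule nn_integral_add) auto
  also have "\<dots> < \<infinity>" using * unfolding ** by (simp add: less_top[symmetric])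
  finally show ?thesis .

qed

text \<open>No polar coordinates are used. Since
  \<open>\<bar>x \<bullet> b\<bar> \<le> norm x\<close> and \<open>\<alpha> \<le> 0\<close>, the
  weight is at most the product over the coordinates of
  \<open>\<bar>x \<bullet> b\<bar> powr (\<alpha> / N)\<close>, and \<open>\<alpha> / N > -1\<close>
  makes every one-dimensional factor integrable.\<close>

lemma integrable_norm_powr_unit_ball:
  assumes "\<alpha> \<le> 0" "\<alpha> > - real CARD('n)"
  shows "integrable lborel (\<lambda>x :: real ^ 'n. norm x powr \<alpha> * indicator (cball 0 1) x)"
proof -
  let ?b = "\<alpha> / real CARD('n)"
  have b: "?b > -1" "?b \<le> 0" using assms by (auto simp: field_simps divide_nonpos_pos)
  have "(\<integral>\<^sup>+x. ennreal (norm (norm (x :: real ^ 'n) powr \<alpha> * indicator (cball 0 1) x)) \<partial>lborel)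
     \<le> (\<integral>\<^sup>+x. (\<Prod>b\<in>Basis. ennreal (\<bar>x \<bullet> b\<bar> powr ?b * indicator {-1..1} (x \<bullet> b))) \<partial>(lborel :: (real ^ 'n) measure))"
  proof (rule nn_integral_mono_AE)
    \<comment> \<open>Points with a vanishing coordinate are excluded because
      \<open>0 powr a = 0\<close> would make the product zero and break the comparison.\<close>
    have "AE x in (lborel :: (real ^ 'n) measure). \<forall>b\<in>Basis. x \<bullet> b \<noteq> 0"
    proof (intro AE_finite_allI finite_Basis)
      fix b :: "real ^ 'n" assume "b \<in> Basis"
      then have "negligible {x. x \<bullet> b = 0}"
        by (metis negligible_standard_hyperplane)
      then have "{x. x \<bullet> b = 0} \<in> null_sets lborel"
        by (simp add: negligible_iff_null_sets null_sets_completion_iff)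
      then show "AE x in lborel. x \<bullet> b \<noteq> 0"
        by (auto dest: AE_not_in)
    qed
    then show "AE x in (lborel :: (real ^ 'n) measure). ennreal (norm (norm (x :: real ^ 'n) powr \<alpha> * indicator (cball 0 1) x)) \<le> (\<Prod>b\<in>Basis. ennreal (\<bar>x \<bullet> b\<bar> powr ?b * indicator {-1..1} (x \<bullet> b)))"
    proof eventually_elim
      fix x :: "real ^ 'n" assume x: "\<forall>b\<in>Basis. x \<bullet> b \<noteq> 0"
      show "ennreal (norm (norm (x :: real ^ 'n) powr \<alpha> * indicator (cball 0 1) x)) \<le> (\<Prod>b\<in>Basis. ennreal (\<bar>x \<bullet> b\<bar> powr ?b * indicator {-1..1} (x \<bullet> b)))"
      proof (cases "norm x \<le> 1")
        case True
        have 1: "\<bar>x \<bullet> b\<bar> \<le> 1" if "b \<in> Basis" for b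
          using Basis_le_norm[OF that, of x] True by linarith
        have "norm x powr \<alpha> = (\<Prod>b\<in>(Basis :: (real ^ 'n) set). norm x powr ?b)"
          by (simp add: powr_powr flip: powr_realpow')
        also have "\<dots> \<le> (\<Prod>b\<in>(Basis :: (real ^ 'n) set). \<bar>x \<bullet> b\<bar> powr ?b)"
          using x b Basis_le_norm by (intro prod_mono) (auto intro!: powr_mono2')
        also have "\<dots> = (\<Prod>b\<in>Basis. \<bar>x \<bullet> b\<bar> powr ?b * indicator {-1..1} (x \<bullet> b))"
          using 1 by (intro prod.cong) (auto simp: indicator_def abs_le_iff)
        finally show ?thesis using True by (simp add: prod_ennreal ennreal_leI)
      qed auto
    qed
  qed
  also have "\<dots> = (\<Prod>b\<in>(Basis :: (real ^ 'n) set). (\<integral>\<^sup>+x. ennreal (\<bar>x\<bar> powr ?b * indicator {-1..1} x) \<partial>lborel))"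
    by (rule nn_integral_lborel_prod) auto
  also have "\<dots> < \<infinity>"
    using nn_integral_powr_unit_interval[OF b(1)] by (simp add: less_top[symmetric] ennreal_prod_eq_top del: prod_constant)
  finally show ?thesis
    by (intro integrableI_bounded borel_measurable_times borel_measurable_indicator) auto
qed

section \<open>Integration by parts in space and time\<close>

text \<open>Only unmixed second derivatives are recorded, the Laplacian being the sole second-order
  operator that occurs. Continuity is asked for separately.\<close>

definition second_partials ::
  "(real ^ 'n \<Rightarrow> real) \<Rightarrow> ('n \<Rightarrow> real ^ 'n \<Rightarrow> real) \<Rightarrow> ('n \<Rightarrow> real ^ 'n \<Rightarrow> real) \<Rightarrow> bool" where
  "second_partials f D DD \<longleftrightarrow>
     (\<forall>j x. ((\<lambda>h. f (x + h *\<^sub>R axis j 1)) has_real_derivative D j x) (at 0) \<and>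
            ((\<lambda>h. D j (x + h *\<^sub>R axis j 1)) has_real_derivative DD j x) (at 0))"

lemma second_partialsD:
  assumes "second_partials f D DD"
  shows "((\<lambda>s. f (x + s *\<^sub>R axis j 1)) has_real_derivative D j (x + s *\<^sub>R axis j 1)) (at s)"
    and "((\<lambda>s. D j (x + s *\<^sub>R axis j 1)) has_real_derivative DD j (x + s *\<^sub>R axis j 1)) (at s)"
proof -
  have *: "((\<lambda>h. g (x + (h + s) *\<^sub>R axis j 1)) has_real_derivative G) (at 0) \<Longrightarrow>
     ((\<lambda>s. g (x + s *\<^sub>R axis j 1)) has_real_derivative G) (at s)" for g :: "real ^ 'a \<Rightarrow> real" and G
    using DERIV_shift[of "\<lambda>s. g (x + s *\<^sub>R axis j 1)" G 0 s] by (simp add: add.commute)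
  have e: "x + (h + s) *\<^sub>R axis j (1 :: real) = (x + s *\<^sub>R axis j 1) + h *\<^sub>R axis j 1" for h
    by (simp add: algebra_simps)
  show "((\<lambda>s. f (x + s *\<^sub>R axis j 1)) has_real_derivative D j (x + s *\<^sub>R axis j 1)) (at s)"
    using assms unfolding second_partials_def by (intro *) (simp only: e)
  show "((\<lambda>s. D j (x + s *\<^sub>R axis j 1)) has_real_derivative DD j (x + s *\<^sub>R axis j 1)) (at s)"
    using assms unfolding second_partials_def by (intro *) (simp only: e)
qed

text \<open>This is Maclaurin's formula of order two for the even function
  \<open>s \<mapsto> f (x + s e) + f (x - s e) - 2 * f x\<close>, which vanishes at 0 together with
  its first derivative. The exact mean value gives the limit of the difference quotients and also a
  bound on them for dominated convergence.\<close>

lemma second_difference_mean_value: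
  assumes "second_partials f D DD" "h > 0"
  shows "\<exists>\<xi>. 0 < \<xi> \<and> \<xi> < h \<and>
    f (x + h *\<^sub>R axis j 1) + f (x + (- h) *\<^sub>R axis j 1) - 2 * f x =
    h\<^sup>2 * ((DD j (x + \<xi> *\<^sub>R axis j 1) + DD j (x + (- \<xi>) *\<^sub>R axis j 1)) / 2)"
proof -
  let ?p = "\<lambda>s. x + s *\<^sub>R axis j (1 :: real)"
  let ?k = "\<lambda>m s. if m = 0 then f (?p s) + f (?p (- s)) - 2 * f x
     else if m = 1 then D j (?p s) - D j (?p (- s)) else DD j (?p s) + DD j (?p (- s))"
  have "\<forall>m t. m < 2 \<and> 0 \<le> t \<and> t \<le> h \<longrightarrow> DERIV (?k m) t :> ?k (Suc m) t"
  proof (intro allI impI)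
    fix m :: nat and t :: real assume "m < 2 \<and> 0 \<le> t \<and> t \<le> h"
    then have "m = 0 \<or> m = 1" by auto
    moreover have "((\<lambda>s. f (?p (- s))) has_real_derivative D j (?p (- t)) * (- 1)) (at t)"
      by (rule DERIV_chain2[OF second_partialsD(1)[OF assms(1)]]) (auto intro!: derivative_eq_intros)
    moreover have "((\<lambda>s. D j (?p (- s))) has_real_derivative DD j (?p (- t)) * (- 1)) (at t)"
      by (rule DERIV_chain2[OF second_partialsD(2)[OF assms(1)]]) (auto intro!: derivative_eq_intros)
    ultimately show "DERIV (?k m) t :> ?k (Suc m) t"
      by (auto intro!: derivative_eq_intros second_partialsD[OF assms(1)])
  qed
  from Maclaurin[where diff = ?k and n = 2, OF assms(2) _ refl this]
  show ?thesis by (auto simp: numeral_2_eq_2 mult_ac)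
qed

lemma second_difference_tendsto:
  assumes "second_partials f D DD" "continuous_on UNIV (DD j)"
  shows "(\<lambda>n. (f (x + inverse (real (Suc n)) *\<^sub>R axis j 1) + f (x + (- inverse (real (Suc n))) *\<^sub>R axis j 1) - 2 * f x)
     / (inverse (real (Suc n)))\<^sup>2) \<longlonglongrightarrow> DD j x"
proof -
  let ?h = "\<lambda>n. inverse (real (Suc n))"
  obtain \<xi> where \<xi>: "\<And>n. 0 < \<xi> n" "\<And>n. \<xi> n < ?h n"
    "\<And>n. f (x + ?h n *\<^sub>R axis j 1) + f (x + (- ?h n) *\<^sub>R axis j 1) - 2 * f x =
    (?h n)\<^sup>2 * ((DD j (x + \<xi> n *\<^sub>R axis j 1) + DD j (x + (- \<xi> n) *\<^sub>R axis j 1)) / 2)"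
    using second_difference_mean_value[OF assms(1), of "?h _" x j] by (metis inverse_Suc)
  have c: "isCont (DD j) x" using assms(2) by (simp add: continuous_on_eq_continuous_at)
  have z: "\<xi> \<longlonglongrightarrow> 0"
    by (rule real_tendsto_sandwich[OF _ _ tendsto_const LIMSEQ_inverse_real_of_nat])
      (use \<xi> in \<open>auto intro!: always_eventually less_imp_le\<close>)
  have "(\<lambda>n. x + \<xi> n *\<^sub>R axis j 1) \<longlonglongrightarrow> x + 0 *\<^sub>R axis j 1" "(\<lambda>n. x + (- \<xi> n) *\<^sub>R axis j 1) \<longlonglongrightarrow> x + (- 0) *\<^sub>R axis j 1"
    by (intro tendsto_intros z)+
  then have "(\<lambda>n. (DD j (x + \<xi> n *\<^sub>R axis j 1) + DD j (x + (- \<xi> n) *\<^sub>R axis j 1)) / 2) \<longlonglongrightarrow> (DD j x + DD j x) / 2"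
    by (intro tendsto_intros isCont_tendsto_compose[OF c]) auto
  moreover have "(\<lambda>n. (f (x + ?h n *\<^sub>R axis j 1) + f (x + (- ?h n) *\<^sub>R axis j 1) - 2 * f x) / (?h n)\<^sup>2)
     = (\<lambda>n. (DD j (x + \<xi> n *\<^sub>R axis j 1) + DD j (x + (- \<xi> n) *\<^sub>R axis j 1)) / 2)"
    by (subst \<xi>(3)) simp
  ultimately show ?thesis by simp
qed

lemma integrable_continuous_compact_support:
  fixes f :: "'a::euclidean_space \<Rightarrow> real"
  assumes "continuous_on UNIV f" "\<And>x. norm x > R \<Longrightarrow> f x = 0"
  shows "integrable lborel f"
proof -
  have "integrable lborel (\<lambda>x. indicator (cball 0 R) x *\<^sub>R f x)"
    using assms(1) by (intro borel_integrable_compact) (auto intro: continuous_on_subset)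
  also have "(\<lambda>x. indicator (cball 0 R) x *\<^sub>R f x) = f"
    using assms(2) by (auto simp: indicator_def fun_eq_iff not_le)
  finally show ?thesis .
qed

lemma continuous_on_cball_bound:
  fixes g :: "real ^ 'n \<Rightarrow> real"
  assumes "continuous_on UNIV g"
  obtains B where "B \<ge> 0" "\<And>x. norm x \<le> R \<Longrightarrow> \<bar>g x\<bar> \<le> B"
proof -
  have "bounded (g ` cball 0 R)"
    using assms by (intro compact_imp_bounded compact_continuous_image) (auto intro: continuous_on_subset)
  then obtain B where "\<And>x. x \<in> cball 0 R \<Longrightarrow> norm (g x) \<le> B"
    unfolding bounded_iff by (metis imageI)
  then have "\<bar>g x\<bar> \<le> max B 0" if "norm x \<le> R" for x
    using that by (auto simp: le_max_iff_disj)
  then show thesis by (intro that[of "max B 0"]) auto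
qed

text \<open>Second differences can be moved from one factor to the other by translation invariance of the
  Lebesgue measure, so no Fubini argument in the single coordinates is needed.\<close>

lemma integral_second_partial_by_parts:
  fixes f g :: "real ^ 'n \<Rightarrow> real"
  assumes f: "second_partials f D DD" "continuous_on UNIV f" "continuous_on UNIV (DD j)"
    and g: "second_partials g E EE" "continuous_on UNIV g" "continuous_on UNIV (EE j)"
    and R: "\<And>x. norm x > R \<Longrightarrow> g x = 0"
  shows "(LINT x|lborel. DD j x * g x) = (LINT x|lborel. f x * EE j x)"
proof -
  let ?h = "\<lambda>n. inverse (real (Suc n))"
  let ?e = "axis j (1 :: real)"
  let ?S = "\<lambda>f n x. (f (x + ?h n *\<^sub>R ?e) + f (x + (- ?h n) *\<^sub>R ?e) - 2 * f x) / (?h n)\<^sup>2"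
  have h: "0 < ?h n" "?h n \<le> 1" for n by (auto simp: field_simps)
  have ne: "norm (x + s *\<^sub>R ?e) \<le> norm x + \<bar>s\<bar>" "norm x \<le> norm (x + s *\<^sub>R ?e) + \<bar>s\<bar>" for x s
    using norm_triangle_ineq[of x "s *\<^sub>R ?e"] norm_triangle_ineq4[of "x + s *\<^sub>R ?e" "s *\<^sub>R ?e"] by auto
  have cc: "continuous_on UNIV (\<lambda>x. k (x + s *\<^sub>R ?e))" if "continuous_on UNIV k" for k :: "real ^ 'n \<Rightarrow> real" and s
    by (rule continuous_on_compose2[OF that]) (auto intro!: continuous_intros)
  have I1: "integrable lborel (\<lambda>x. f (x + s *\<^sub>R ?e) * g x)" for s
    using R by (intro integrable_continuous_compact_support[of _ R] continuous_on_mult cc f g) auto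
  have I2: "integrable lborel (\<lambda>x. f x * g (x + s *\<^sub>R ?e))" for s
  proof (intro integrable_continuous_compact_support[of _ "R + \<bar>s\<bar>"] continuous_on_mult cc f g)
    fix x :: "real ^ 'n" assume "norm x > R + \<bar>s\<bar>"
    then show "f x * g (x + s *\<^sub>R ?e) = 0"
      using ne(2)[of x s] R[of "x + s *\<^sub>R ?e"] by auto
  qed
  \<comment> \<open>Translation turns a shift of \<open>f\<close> into the opposite shift of
    \<open>g\<close>. The symmetric second difference is unchanged when the two shifts are
    exchanged.\<close>
  have tr: "(LINT x|lborel. f (x + s *\<^sub>R ?e) * g x) = (LINT x|lborel. f x * g (x + (- s) *\<^sub>R ?e))" for s
    using lborel_integral_translate[of "\<lambda>x. f x * g (x + (- s) *\<^sub>R ?e)" "s *\<^sub>R ?e"] I2[of "-s"]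
    by (simp add: algebra_simps)
  have I10: "integrable lborel (\<lambda>x. f x * g x)" using I1[of 0] by simp
  have eq: "(LINT x|lborel. ?S f n x * g x) = (LINT x|lborel. f x * ?S g n x)" for n
  proof -
    have "(LINT x|lborel. ?S f n x * g x) = (LINT x|lborel. (f (x + ?h n *\<^sub>R ?e) * g x + f (x + (- ?h n) *\<^sub>R ?e) * g x - 2 * (f x * g x)) / (?h n)\<^sup>2)"
      by (intro Bochner_Integration.integral_cong) (auto simp: algebra_simps diff_divide_distrib add_divide_distrib)
    also have "\<dots> = ((LINT x|lborel. f (x + ?h n *\<^sub>R ?e) * g x) + (LINT x|lborel. f (x + (- ?h n) *\<^sub>R ?e) * g x)
        - 2 * (LINT x|lborel. f x * g x)) / (?h n)\<^sup>2"
      using I1[of "?h n"] I1[of "- ?h n"] I10 by simp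
    also have "\<dots> = ((LINT x|lborel. f x * g (x + (- ?h n) *\<^sub>R ?e)) + (LINT x|lborel. f x * g (x + ?h n *\<^sub>R ?e))
        - 2 * (LINT x|lborel. f x * g x)) / (?h n)\<^sup>2"
      unfolding tr by simp
    also have "\<dots> = (LINT x|lborel. (f x * g (x + ?h n *\<^sub>R ?e) + f x * g (x + (- ?h n) *\<^sub>R ?e) - 2 * (f x * g x)) / (?h n)\<^sup>2)"
      using I2[of "?h n"] I2[of "- ?h n"] I10 by simp
    also have "\<dots> = (LINT x|lborel. f x * ?S g n x)"
      by (intro Bochner_Integration.integral_cong) (auto simp: algebra_simps diff_divide_distrib add_divide_distrib)
    finally show ?thesis .
  qed
  have Sb: "\<bar>?S k n x\<bar> \<le> B" if k: "second_partials k K KK" and B: "\<And>x. norm x \<le> Q + 1 \<Longrightarrow> \<bar>KK j x\<bar> \<le> B" and x: "norm x \<le> Q"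
    for k K KK n x B Q
  proof -
    obtain \<xi> where \<xi>: "0 < \<xi>" "\<xi> < ?h n" "k (x + ?h n *\<^sub>R ?e) + k (x + (- ?h n) *\<^sub>R ?e) - 2 * k x =
      (?h n)\<^sup>2 * ((KK j (x + \<xi> *\<^sub>R ?e) + KK j (x + (- \<xi>) *\<^sub>R ?e)) / 2)"
      using second_difference_mean_value[OF k h(1)[of n], where x = x and j = j] by blast
    have "\<bar>KK j (x + \<xi> *\<^sub>R ?e)\<bar> \<le> B" "\<bar>KK j (x + (- \<xi>) *\<^sub>R ?e)\<bar> \<le> B"
      using ne(1)[of x \<xi>] ne(1)[of x "- \<xi>"] \<xi> h[of n] x by (auto intro!: B)
    then show ?thesis unfolding \<xi>(3) using h[of n] by simp
  qed
  have mS: "?S k n \<in> borel_measurable lborel" if "continuous_on UNIV k" for k n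
    using borel_measurable_continuous_onI[OF cc[OF that, of "?h n"]] borel_measurable_continuous_onI[OF cc[OF that, of "- ?h n"]]
      borel_measurable_continuous_onI[OF that] by simp
  have m: "f \<in> borel_measurable lborel" "g \<in> borel_measurable lborel" "DD j \<in> borel_measurable lborel" "EE j \<in> borel_measurable lborel"
    using f g by (auto intro: borel_measurable_continuous_onI)
  obtain B1 where B1: "B1 \<ge> 0" "\<And>x. norm x \<le> R + 1 \<Longrightarrow> \<bar>DD j x\<bar> \<le> B1"
    using continuous_on_cball_bound[OF f(3), of "R + 1"] by blast
  \<comment> \<open>The difference quotient of \<open>g\<close> lives on the ball of radius
    \<open>R + 1\<close>, and its intermediate points may lie one unit further out.\<close>
  obtain B2 where B2: "B2 \<ge> 0" "\<And>x. norm x \<le> R + 1 + 1 \<Longrightarrow> \<bar>EE j x\<bar> \<le> B2"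
    using continuous_on_cball_bound[OF g(3), of "R + 1 + 1"] by blast
  have L1: "(\<lambda>n. LINT x|lborel. ?S f n x * g x) \<longlonglongrightarrow> (LINT x|lborel. DD j x * g x)"
  proof (rule integral_dominated_convergence[where w = "\<lambda>x. B1 * \<bar>g x\<bar>"])
    show "integrable lborel (\<lambda>x. B1 * \<bar>g x\<bar>)"
      using R by (intro integrable_continuous_compact_support[of _ R] continuous_intros g) auto
    show "AE x in lborel. norm (?S f n x * g x) \<le> B1 * \<bar>g x\<bar>" for n
    proof (rule AE_I2)
      fix x :: "real ^ 'n" show "norm (?S f n x * g x) \<le> B1 * \<bar>g x\<bar>"
      proof (cases "norm x \<le> R")
        case True
        have "\<bar>?S f n x\<bar> \<le> B1" by (rule Sb[OF f(1) _ True]) (rule B1(2))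
        then show ?thesis unfolding real_norm_def abs_mult by (intro mult_right_mono) auto
      qed (use R in auto)
    qed
    show "AE x in lborel. (\<lambda>n. ?S f n x * g x) \<longlonglongrightarrow> DD j x * g x"
      by (intro AE_I2 tendsto_mult tendsto_const second_difference_tendsto[OF f(1,3)])
  qed (use m mS[OF f(2)] in simp_all)
  have L2: "(\<lambda>n. LINT x|lborel. f x * ?S g n x) \<longlonglongrightarrow> (LINT x|lborel. f x * EE j x)"
  proof (rule integral_dominated_convergence[where w = "\<lambda>x. indicator (cball 0 (R + 1)) x *\<^sub>R (B2 * \<bar>f x\<bar>)"])
    show "integrable lborel (\<lambda>x. indicator (cball 0 (R + 1)) x *\<^sub>R (B2 * \<bar>f x\<bar>))"
      using f(2) by (intro borel_integrable_compact) (auto intro!: continuous_intros intro: continuous_on_subset)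
    show "AE x in lborel. norm (f x * ?S g n x) \<le> indicator (cball 0 (R + 1)) x *\<^sub>R (B2 * \<bar>f x\<bar>)" for n
    proof (rule AE_I2)
      fix x :: "real ^ 'n" show "norm (f x * ?S g n x) \<le> indicator (cball 0 (R + 1)) x *\<^sub>R (B2 * \<bar>f x\<bar>)"
      proof (cases "norm x \<le> R + 1")
        case True
        have "\<bar>?S g n x\<bar> \<le> B2" by (rule Sb[OF g(1) _ True]) (rule B2(2))
        then have "\<bar>f x\<bar> * \<bar>?S g n x\<bar> \<le> \<bar>f x\<bar> * B2" by (intro mult_left_mono) auto
        then show ?thesis unfolding real_norm_def abs_mult using True by (simp add: mult.commute)
      next
        case False
        then have "?S g n x = 0"
          using R[of x] R[of "x + ?h n *\<^sub>R ?e"] R[of "x + (- ?h n) *\<^sub>R ?e"] ne(2)[of x "?h n"] ne(2)[of x "- ?h n"] h[of n]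
          by (simp del: of_nat_Suc)
        then show ?thesis using B2(1) by (simp only:) simp
      qed
    qed
    show "AE x in lborel. (\<lambda>n. f x * ?S g n x) \<longlonglongrightarrow> f x * EE j x"
      by (intro AE_I2 tendsto_mult tendsto_const second_difference_tendsto[OF g(1,3)])
  qed (use m mS[OF g(2)] in simp_all)
  show ?thesis using L1 L2 unfolding eq by (rule LIMSEQ_unique)
qed

text \<open>The space derivatives are hidden behind existential quantifiers and only the Laplacian
  \<open>L\<close> is exposed. The time derivative is two-sided, so \<open>S\<close> is taken to be
  the whole line or an open half-line.\<close>

definition C12_on ::
  "real set \<Rightarrow> (real \<Rightarrow> real ^ 'n \<Rightarrow> real) \<Rightarrow> (real \<Rightarrow> real ^ 'n \<Rightarrow> real) \<Rightarrow> (real \<Rightarrow> real ^ 'n \<Rightarrow> real) \<Rightarrow> bool" where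
  "C12_on S V Vt L \<longleftrightarrow>
     continuous_on (S \<times> UNIV) (\<lambda>(t, x). V t x) \<and>
     continuous_on (S \<times> UNIV) (\<lambda>(t, x). Vt t x) \<and>
     (\<forall>t\<in>S. \<forall>x. ((\<lambda>s. V s x) has_real_derivative Vt t x) (at t)) \<and>
     (\<exists>D DD. (\<forall>t\<in>S. second_partials (V t) (\<lambda>j. D j t) (\<lambda>j. DD j t)) \<and>
             (\<forall>j. continuous_on (S \<times> UNIV) (\<lambda>(t, x). DD j t x)) \<and>
             (\<forall>t\<in>S. \<forall>x. L t x = (\<Sum>j\<in>UNIV. DD j t x)))"

definition test_function ::
  "real \<Rightarrow> real \<Rightarrow> (real \<Rightarrow> real ^ 'n \<Rightarrow> real) \<Rightarrow> (real \<Rightarrow> real ^ 'n \<Rightarrow> real) \<Rightarrow> (real \<Rightarrow> real ^ 'n \<Rightarrow> real) \<Rightarrow> bool" where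
  "test_function a b \<phi> \<phi>t L \<longleftrightarrow> C12_on UNIV \<phi> \<phi>t L \<and>
     (\<exists>R. \<forall>t x. t < a \<or> t > b \<or> norm x > R \<longrightarrow> \<phi> t x = 0 \<and> \<phi>t t x = 0 \<and> L t x = 0)"

lemma continuous_on_slice:
  assumes "continuous_on (S \<times> UNIV) (\<lambda>(t, x). f t x)" "t \<in> S"
  shows "continuous_on UNIV (f t)"
proof -
  have "continuous_on UNIV (\<lambda>x. (\<lambda>(t, x). f t x) (t, x))"
    by (rule continuous_on_compose2[OF assms(1)]) (use assms(2) in \<open>auto intro!: continuous_intros\<close>)
  then show ?thesis by simp
qed

lemma C12_onD:
  assumes "C12_on S V Vt L"
  shows "continuous_on (S \<times> UNIV) (\<lambda>(t, x). V t x)"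
    and "continuous_on (S \<times> UNIV) (\<lambda>(t, x). Vt t x)"
    and "\<And>t x. t \<in> S \<Longrightarrow> ((\<lambda>s. V s x) has_real_derivative Vt t x) (at t)"
  using assms by (simp_all add: C12_on_def)

lemma C12_on_continuous_laplacian:
  assumes "C12_on S V Vt L"
  shows "continuous_on (S \<times> UNIV) (\<lambda>(t, x). L t x)"
proof -
  obtain D DD where D0: "\<forall>t\<in>S. second_partials (V t) (\<lambda>j. D j t) (\<lambda>j. DD j t)"
    "\<forall>j. continuous_on (S \<times> UNIV) (\<lambda>(t, x). DD j t x)"
    "\<forall>t\<in>S. \<forall>x. L t x = (\<Sum>j\<in>UNIV. DD j t x)"
    using assms unfolding C12_on_def by (elim conjE exE)
  note D = D0[rule_format]
  have "continuous_on (S \<times> UNIV) (\<lambda>z. \<Sum>j\<in>UNIV. DD j (fst z) (snd z))"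
    using D(2) by (intro continuous_on_sum) (simp add: case_prod_unfold)
  then show ?thesis
    by (rule continuous_on_eq) (auto simp: D(3))
qed

lemma continuous_on_slice_time:
  assumes "continuous_on (S \<times> UNIV) (\<lambda>(t, x). f t x)"
  shows "continuous_on S (\<lambda>t. f t x)"
proof -
  have "continuous_on S (\<lambda>t. (\<lambda>(t, x). f t x) (t, x))"
    by (rule continuous_on_compose2[OF assms]) (auto intro!: continuous_intros)
  then show ?thesis by simp
qed

lemma integrable_strip_compact_support:
  fixes F :: "real \<Rightarrow> 'a::euclidean_space \<Rightarrow> real"
  assumes "continuous_on ({t1..t2} \<times> UNIV) (\<lambda>(t, x). F t x)" "\<And>t x. norm x > R \<Longrightarrow> F t x = 0"
  shows "integrable lborel (\<lambda>(t, x). indicator {t1..t2} t * F t x)"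
proof -
  have "integrable lborel (\<lambda>z. indicator ({t1..t2} \<times> cball 0 R) z *\<^sub>R (\<lambda>(t, x). F t x) z)"
    using assms(1) by (intro borel_integrable_compact compact_Times) (auto intro: continuous_on_subset)
  also have "(\<lambda>z. indicator ({t1..t2} \<times> cball 0 R) z *\<^sub>R (\<lambda>(t, x). F t x) z) = (\<lambda>(t, x). indicator {t1..t2} t * F t x)"
    using assms(2) by (auto simp: indicator_def fun_eq_iff not_le)
  finally show ?thesis .
qed

lemma test_function_bounded:
  assumes "test_function a b \<phi> \<phi>t L"
  obtains B where "B \<ge> 0" "\<And>t x. \<bar>\<phi> t x\<bar> \<le> B" "\<And>t x. \<bar>\<phi>t t x + L t x\<bar> \<le> B"
proof -
  obtain R where R: "\<And>t x. t < a \<or> t > b \<or> norm x > R \<Longrightarrow> \<phi> t x = 0 \<and> \<phi>t t x = 0 \<and> L t x = 0"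
    using assms unfolding test_function_def by blast
  have C: "C12_on UNIV \<phi> \<phi>t L" using assms by (simp add: test_function_def)
  have bd: "\<exists>B\<ge>0. \<forall>t x. \<bar>f t x\<bar> \<le> B" if c: "continuous_on (UNIV \<times> UNIV) (\<lambda>(t, x). f t x)"
    and z: "\<And>t x. t < a \<or> t > b \<or> norm x > R \<Longrightarrow> f t x = 0" for f :: "real \<Rightarrow> real ^ 'a \<Rightarrow> real"
  proof -
    have "bounded ((\<lambda>(t, x). f t x) ` ({a..b} \<times> cball 0 R))"
      using c by (intro compact_imp_bounded compact_continuous_image compact_Times) (auto intro: continuous_on_subset)
    then obtain B where B: "\<And>z. z \<in> {a..b} \<times> cball 0 R \<Longrightarrow> norm ((\<lambda>(t, x). f t x) z) \<le> B"
      unfolding bounded_iff by (metis imageI)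
    have "\<bar>f t x\<bar> \<le> max B 0" for t x
    proof (cases "t < a \<or> t > b \<or> norm x > R")
      case False
      then show ?thesis using B[of "(t, x)"] by (auto simp: not_less not_le)
    qed (simp add: z)
    then show ?thesis by (intro exI[of _ "max B 0"]) auto
  qed
  obtain B1 where B1: "B1 \<ge> 0" "\<And>t x. \<bar>\<phi> t x\<bar> \<le> B1"
    using bd[OF C12_onD(1)[OF C]] R by meson
  obtain B2 where B2: "B2 \<ge> 0" "\<And>t x. \<bar>\<phi>t t x\<bar> \<le> B2"
    using bd[OF C12_onD(2)[OF C]] R by meson
  obtain B3 where B3: "B3 \<ge> 0" "\<And>t x. \<bar>L t x\<bar> \<le> B3"
    using bd[OF C12_on_continuous_laplacian[OF C]] R by meson
  show thesis
  proof (rule that[of "B1 + B2 + B3"])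
    show "\<bar>\<phi> t x\<bar> \<le> B1 + B2 + B3" for t x using B1(2)[of t x] B2(1) B3(1) by linarith
    show "\<bar>\<phi>t t x + L t x\<bar> \<le> B1 + B2 + B3" for t x using B2(2)[of t x] B3(2)[of t x] B1(1) by linarith
  qed (use B1 B2 B3 in auto)
qed

text \<open>The integrand splits into the time derivative of \<open>V * \<phi>\<close>, to which the
  fundamental theorem applies after Fubini, and \<open>V * L - LV * \<phi>\<close>, whose space
  integral vanishes by parts in each coordinate. Regularity of \<open>V\<close> on \<open>S\<close>
  alone lets the lemma serve both the heat kernel after its singular time and a classical solution
  at positive times.\<close>

lemma C12_on_green:
  assumes V: "C12_on S V Vt LV" "{t1..t2} \<subseteq> S" "t1 \<le> t2" and \<phi>: "test_function a b \<phi> \<phi>t L"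
  shows "integrable lborel (\<lambda>(t, x). indicator {t1..t2} t *
            ((Vt t x - LV t x) * \<phi> t x + V t x * (\<phi>t t x + L t x)))" (is ?A)
    and "(LINT (t, x)|lborel. indicator {t1..t2} t *
            ((Vt t x - LV t x) * \<phi> t x + V t x * (\<phi>t t x + L t x))) =
         (LINT x|lborel. V t2 x * \<phi> t2 x) - (LINT x|lborel. V t1 x * \<phi> t1 x)" (is ?B)
proof -
  obtain R where R: "\<And>t x. norm x > R \<Longrightarrow> \<phi> t x = 0 \<and> \<phi>t t x = 0 \<and> L t x = 0"
    using \<phi> unfolding test_function_def by blast
  have C: "C12_on UNIV \<phi> \<phi>t L" using \<phi> by (simp add: test_function_def)
  obtain D DD where D0: "\<forall>t\<in>S. second_partials (V t) (\<lambda>j. D j t) (\<lambda>j. DD j t)"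
    "\<forall>j. continuous_on (S \<times> UNIV) (\<lambda>(t, x). DD j t x)"
    "\<forall>t\<in>S. \<forall>x. LV t x = (\<Sum>j\<in>UNIV. DD j t x)"
    using V(1) unfolding C12_on_def by (elim conjE exE)
  note D = D0[rule_format]
  obtain E EE where E0: "\<forall>t\<in>UNIV. second_partials (\<phi> t) (\<lambda>j. E j t) (\<lambda>j. EE j t)"
    "\<forall>j. continuous_on (UNIV \<times> UNIV) (\<lambda>(t, x). EE j t x)"
    "\<forall>t\<in>UNIV. \<forall>x. L t x = (\<Sum>j\<in>UNIV. EE j t x)"
    using C unfolding C12_on_def by (elim conjE exE)
  note E = E0(1)[rule_format, OF UNIV_I] E0(2)[rule_format] E0(3)[rule_format, OF UNIV_I]
  have cV: "continuous_on (S \<times> UNIV) (\<lambda>(t, x). V t x)" "continuous_on (S \<times> UNIV) (\<lambda>(t, x). Vt t x)"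
    "continuous_on (S \<times> UNIV) (\<lambda>(t, x). LV t x)"
    by (fact C12_onD[OF V(1)] C12_on_continuous_laplacian[OF V(1)])+
  have cp: "continuous_on (UNIV \<times> UNIV) (\<lambda>(t, x). \<phi> t x)" "continuous_on (UNIV \<times> UNIV) (\<lambda>(t, x). \<phi>t t x)"
    "continuous_on (UNIV \<times> UNIV) (\<lambda>(t, x). L t x)"
    by (fact C12_onD[OF C] C12_on_continuous_laplacian[OF C])+
  have sub: "{t1..t2} \<times> UNIV \<subseteq> S \<times> (UNIV :: (real ^ 'a) set)" "{t1..t2} \<times> UNIV \<subseteq> UNIV \<times> (UNIV :: (real ^ 'a) set)"
    using V(2) by auto
  note c = cV[THEN continuous_on_subset, OF sub(1)] cp[THEN continuous_on_subset, OF sub(2)]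
  let ?G = "\<lambda>t x. Vt t x * \<phi> t x + V t x * \<phi>t t x"
  let ?M = "\<lambda>t x. V t x * L t x - LV t x * \<phi> t x"
  have iG: "integrable lborel (\<lambda>(t, x). indicator {t1..t2} t * ?G t x)"
    using R c by (intro integrable_strip_compact_support[of _ _ _ R]) (auto simp: case_prod_unfold intro!: continuous_on_add continuous_on_mult)
  have iM: "integrable lborel (\<lambda>(t, x). indicator {t1..t2} t * ?M t x)"
    using R c by (intro integrable_strip_compact_support[of _ _ _ R]) (auto simp: case_prod_unfold intro!: continuous_on_diff continuous_on_mult)
  have eq: "(\<lambda>(t, x). indicator {t1..t2} t * ((Vt t x - LV t x) * \<phi> t x + V t x * (\<phi>t t x + L t x))) =
     (\<lambda>z. (case z of (t, x) \<Rightarrow> indicator {t1..t2} t * ?G t x) + (case z of (t, x) \<Rightarrow> indicator {t1..t2} t * ?M t x))"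
    by (auto simp: fun_eq_iff algebra_simps)
  show ?A unfolding eq by (intro Bochner_Integration.integrable_add iG iM)
  have iS: "integrable lborel (\<lambda>x. V s x * \<phi> s x)" if "s \<in> S" for s
    using R continuous_on_slice[OF cV(1) that] continuous_on_slice[OF cp(1), of s]
    by (intro integrable_continuous_compact_support[of _ R] continuous_on_mult) auto
  have "(LINT (t, x)|lborel. indicator {t1..t2} t * ?G t x) = (LINT x|lborel. LINT t|lborel. indicator {t1..t2} t * ?G t x)"
    using lborel_pair.integral_snd[of "\<lambda>t x. indicator {t1..t2} t * ?G t x"] iG by (simp add: lborel_prod)
  also have "\<dots> = (LINT x|lborel. V t2 x * \<phi> t2 x - V t1 x * \<phi> t1 x)"
  proof (rule Bochner_Integration.integral_cong[OF refl])
    fix x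
    have "continuous_on {t1..t2} (\<lambda>t. ?G t x)"
      by (intro continuous_on_add continuous_on_mult c[THEN continuous_on_slice_time])
    moreover have "((\<lambda>t. V t x * \<phi> t x) has_vector_derivative ?G t x) (at t within {t1..t2})" if "t1 \<le> t" "t \<le> t2" for t
    proof -
      have "((\<lambda>s. V s x) has_real_derivative Vt t x) (at t)" "((\<lambda>s. \<phi> s x) has_real_derivative \<phi>t t x) (at t)"
        using V(2) that by (auto intro!: C12_onD(3)[OF V(1)] C12_onD(3)[OF C])
      then have "((\<lambda>s. V s x * \<phi> s x) has_real_derivative ?G t x) (at t)"
        by (auto intro!: derivative_eq_intros)
      then show ?thesis
        using has_field_derivative_at_within has_real_derivative_iff_has_vector_derivative by blast
    qed
    ultimately show "(LINT t|lborel. indicator {t1..t2} t * ?G t x) = V t2 x * \<phi> t2 x - V t1 x * \<phi> t1 x"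
      using integral_FTC_atLeastAtMost[OF V(3), of "\<lambda>t. V t x * \<phi> t x" "\<lambda>t. ?G t x"] by simp
  qed
  also have "\<dots> = (LINT x|lborel. V t2 x * \<phi> t2 x) - (LINT x|lborel. V t1 x * \<phi> t1 x)"
    using iS[of t1] iS[of t2] V by (intro Bochner_Integration.integral_diff) auto
  finally have 1: "(LINT (t, x)|lborel. indicator {t1..t2} t * ?G t x) = \<dots>" .
  have "(LINT (t, x)|lborel. indicator {t1..t2} t * ?M t x) = (LINT t|lborel. LINT x|lborel. indicator {t1..t2} t * ?M t x)"
    using lborel_pair.integral_fst[of "\<lambda>t x. indicator {t1..t2} t * ?M t x"] iM by (simp add: lborel_prod)
  also have "\<dots> = (LINT t|(lborel :: real measure). 0)"
  proof (rule Bochner_Integration.integral_cong[OF refl])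
    fix t
    show "(LINT x|lborel. indicator {t1..t2} t * ?M t x) = 0"
    proof (cases "t \<in> {t1..t2}")
      case True
      then have t: "t \<in> S" using V by auto
      note cs = continuous_on_slice[OF cV(1) t] continuous_on_slice[OF D(2) t]
        continuous_on_slice[OF cp(1), of t] continuous_on_slice[OF E(2), of t]
      have i: "integrable lborel (\<lambda>x. V t x * EE j t x - DD j t x * \<phi> t x)"
         "(LINT x|lborel. V t x * EE j t x - DD j t x * \<phi> t x) = 0" for j
      proof -
        \<comment> \<open>Outside the ball, \<open>test_function\<close> controls only the sum
          \<open>L\<close> of the second partials. Each single one vanishes there as a limit of
          difference quotients of \<open>\<phi>\<close>, which are eventually zero because the
          exterior of the ball is open.\<close>
        have EE0: "EE j t x = 0" if "norm x > R" for x
        proof -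
          have "(\<lambda>n. (\<phi> t (x + inverse (real (Suc n)) *\<^sub>R axis j 1) + \<phi> t (x + (- inverse (real (Suc n))) *\<^sub>R axis j 1) - 2 * \<phi> t x)
             / (inverse (real (Suc n)))\<^sup>2) \<longlonglongrightarrow> EE j t x"
            by (rule second_difference_tendsto[OF E(1)]) (use cs in auto)
          moreover have "(\<lambda>n. (\<phi> t (x + inverse (real (Suc n)) *\<^sub>R axis j 1) + \<phi> t (x + (- inverse (real (Suc n))) *\<^sub>R axis j 1) - 2 * \<phi> t x)
             / (inverse (real (Suc n)))\<^sup>2) \<longlonglongrightarrow> 0"
          proof (rule tendsto_eventually)
            have "(\<lambda>n. x + inverse (real (Suc n)) *\<^sub>R axis j 1) \<longlonglongrightarrow> x + 0 *\<^sub>R axis j 1"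
              "(\<lambda>n. x + (- inverse (real (Suc n))) *\<^sub>R axis j 1) \<longlonglongrightarrow> x + (- 0) *\<^sub>R axis j 1"
              by (intro tendsto_intros LIMSEQ_inverse_real_of_nat)+
            then have "(\<lambda>n. norm (x + inverse (real (Suc n)) *\<^sub>R axis j 1)) \<longlonglongrightarrow> norm x"
              "(\<lambda>n. norm (x + (- inverse (real (Suc n))) *\<^sub>R axis j 1)) \<longlonglongrightarrow> norm x"
              by (auto dest: tendsto_norm)
            then have "\<forall>\<^sub>F n in sequentially. norm (x + inverse (real (Suc n)) *\<^sub>R axis j 1) > R"
              "\<forall>\<^sub>F n in sequentially. norm (x + (- inverse (real (Suc n))) *\<^sub>R axis j 1) > R"
              using that by (auto intro: order_tendstoD)
            then show "\<forall>\<^sub>F n in sequentially. (\<phi> t (x + inverse (real (Suc n)) *\<^sub>R axis j 1) + \<phi> t (x + (- inverse (real (Suc n))) *\<^sub>R axis j 1) - 2 * \<phi> t x)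
             / (inverse (real (Suc n)))\<^sup>2 = 0"
              by eventually_elim (use R that in simp)
          qed
          ultimately show ?thesis by (rule LIMSEQ_unique)
        qed
        have a: "integrable lborel (\<lambda>x. V t x * EE j t x)" "integrable lborel (\<lambda>x. DD j t x * \<phi> t x)"
          using EE0 R cs by (auto intro!: integrable_continuous_compact_support[of _ R] continuous_on_mult)
        then show "integrable lborel (\<lambda>x. V t x * EE j t x - DD j t x * \<phi> t x)" by simp
        have "(LINT x|lborel. DD j t x * \<phi> t x) = (LINT x|lborel. V t x * EE j t x)"
          by (rule integral_second_partial_by_parts[OF D(1)[OF t] _ _ E(1), where R = R and j = j]) (use R cs in auto)
        then show "(LINT x|lborel. V t x * EE j t x - DD j t x * \<phi> t x) = 0"
          using a by simp
      qed
      have "(LINT x|lborel. ?M t x) = (LINT x|lborel. (\<Sum>j\<in>UNIV. V t x * EE j t x - DD j t x * \<phi> t x))"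
        by (intro Bochner_Integration.integral_cong) (auto simp: D(3)[OF t] E(3) sum_subtractf sum_distrib_left sum_distrib_right)
      also have "\<dots> = 0" using i by (simp add: Bochner_Integration.integral_sum)
      finally show ?thesis using True by simp
    qed simp
  qed
  finally have 2: "(LINT (t, x)|lborel. indicator {t1..t2} t * ?M t x) = 0" by simp
  show ?B unfolding eq using 1 2 iG iM by (simp add: Bochner_Integration.integral_add)
qed

section \<open>The heat potential of a test function\<close>

lemma heat_kernel_eq_exp:
  fixes x :: "real ^ 'n"
  assumes "s > 0"
  shows "heat_kernel s x = exp (- (real CARD('n) / 2) * ln (4 * pi * s) - (norm x)\<^sup>2 / (4 * s))"
  using assms by (simp add: heat_kernel_def powr_def flip: exp_add)

lemma norm_add_axis_square:
  fixes x :: "real ^ 'n"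
  shows "(norm (x + h *\<^sub>R axis j 1))\<^sup>2 = (norm x)\<^sup>2 + 2 * h * x $ j + h\<^sup>2"
proof -
  have "x \<bullet> axis j 1 = x $ j" "axis j 1 \<bullet> x = x $ j" "axis j (1 :: real) \<bullet> axis j 1 = 1"
    by (simp_all add: inner_axis inner_axis')
  then show ?thesis
    unfolding power2_norm_eq_inner
    by (simp only: inner_add_left inner_add_right inner_scaleR_left inner_scaleR_right)
      (simp add: power2_eq_square algebra_simps)
qed

lemma norm_square_eq_sum: "(norm (x :: real ^ 'n))\<^sup>2 = (\<Sum>j\<in>UNIV. (x $ j)\<^sup>2)"
  unfolding power2_norm_eq_inner inner_vec_def by (simp add: power2_eq_square)

lemma second_partials_heat_kernel:
  fixes y :: "real ^ 'n"
  assumes "s > 0"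
  shows "second_partials (\<lambda>x. heat_kernel s (x - y))
     (\<lambda>j x. - ((x - y) $ j) / (2 * s) * heat_kernel s (x - y))
     (\<lambda>j x. (((x - y) $ j)\<^sup>2 / (4 * s\<^sup>2) - 1 / (2 * s)) * heat_kernel s (x - y))"
proof -
  have e: "x + h *\<^sub>R axis j 1 - y = (x - y) + h *\<^sub>R axis j 1" for x :: "real ^ 'n" and h j by simp
  have D: "((\<lambda>h. heat_kernel s (x + h *\<^sub>R axis j 1 - y)) has_real_derivative
       - ((x - y) $ j) / (2 * s) * heat_kernel s (x - y)) (at 0)" for x j
  proof -
    have "((\<lambda>h. - (real CARD('n) / 2) * ln (4 * pi * s) - ((norm (x - y))\<^sup>2 + 2 * h * (x - y) $ j + h\<^sup>2) / (4 * s))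
       has_real_derivative - ((x - y) $ j) / (2 * s)) (at 0)"
      using assms by (auto intro!: derivative_eq_intros simp: field_simps)
    from DERIV_fun_exp[OF this] show ?thesis
      unfolding e heat_kernel_eq_exp[OF assms] norm_add_axis_square by (simp add: mult.commute)
  qed
  have D': "((\<lambda>h. - ((x + h *\<^sub>R axis j 1 - y) $ j) / (2 * s)) has_real_derivative
       - 1 / (2 * s)) (at 0)" for x :: "real ^ 'n" and j
    using assms by (auto intro!: derivative_eq_intros simp: field_simps)
  have "((\<lambda>h. - ((x + h *\<^sub>R axis j 1 - y) $ j) / (2 * s) * heat_kernel s (x + h *\<^sub>R axis j 1 - y)) has_real_derivative
       (((x - y) $ j)\<^sup>2 / (4 * s\<^sup>2) - 1 / (2 * s)) * heat_kernel s (x - y)) (at 0)" for x j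
    using DERIV_mult[OF D'[of x j] D[of x j]] assms
    by (simp add: field_simps power2_eq_square)
  with D show ?thesis unfolding second_partials_def by blast
qed

text \<open>The function \<open>Vt\<close> fills both the slot of the time derivative and that of
  the Laplacian: this is the heat equation, and it removes the term with \<open>Vt - LV\<close> from
  Green's identity.\<close>

lemma C12_on_heat_kernel:
  fixes y :: "real ^ 'n" and \<tau> :: real
  defines "Vt \<equiv> (\<lambda>t x. ((norm (x - y))\<^sup>2 / (4 * (t - \<tau>)\<^sup>2) - real CARD('n) / (2 * (t - \<tau>))) * heat_kernel (t - \<tau>) (x - y))"
  shows "C12_on {\<tau><..} (\<lambda>t x. heat_kernel (t - \<tau>) (x - y)) Vt Vt"
proof -
  have c: "continuous_on ({\<tau><..} \<times> UNIV) (\<lambda>(t, x). heat_kernel (t - \<tau>) (x - y))"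
    unfolding heat_kernel_def case_prod_unfold by (intro continuous_intros) auto
  have d: "((\<lambda>s. heat_kernel (s - \<tau>) (x - y)) has_real_derivative Vt t x) (at t)" if "t > \<tau>" for t x
  proof -
    have "((\<lambda>s. exp (- (real CARD('n) / 2) * ln (4 * pi * (s - \<tau>)) - (norm (x - y))\<^sup>2 / (4 * (s - \<tau>))))
      has_real_derivative ((norm (x - y))\<^sup>2 / (4 * (t - \<tau>)\<^sup>2) - real CARD('n) / (2 * (t - \<tau>))) *
        exp (- (real CARD('n) / 2) * ln (4 * pi * (t - \<tau>)) - (norm (x - y))\<^sup>2 / (4 * (t - \<tau>)))) (at t)"
    proof -
      have "((\<lambda>s. ln (4 * pi * (s - \<tau>))) has_real_derivative 1 / (t - \<tau>)) (at t)"
        using that by (auto intro!: derivative_eq_intros simp: divide_simps)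
      moreover have "((\<lambda>s. r / (4 * (s - \<tau>))) has_real_derivative - r / (4 * (t - \<tau>)\<^sup>2)) (at t)" for r
        using that by (auto intro!: derivative_eq_intros simp: divide_simps power2_eq_square)
          (simp add: algebra_simps)
      ultimately show ?thesis
        by (intro DERIV_cong[OF DERIV_fun_exp[OF DERIV_diff[OF DERIV_cmult]]]) (auto simp: algebra_simps)
    qed
    then have "((\<lambda>s. exp (- (real CARD('n) / 2) * ln (4 * pi * (s - \<tau>)) - (norm (x - y))\<^sup>2 / (4 * (s - \<tau>))))
      has_real_derivative Vt t x) (at t)"
      using that by (simp add: Vt_def heat_kernel_eq_exp)
    moreover have "\<forall>\<^sub>F s in nhds t. s > \<tau>"
      using that by (intro eventually_nhds_in_open[of "{\<tau><..}" t, simplified]) auto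
    then have "\<forall>\<^sub>F s in nhds t. heat_kernel (s - \<tau>) (x - y) = exp (- (real CARD('n) / 2) * ln (4 * pi * (s - \<tau>)) - (norm (x - y))\<^sup>2 / (4 * (s - \<tau>)))"
      by eventually_elim (simp add: heat_kernel_eq_exp)
    ultimately show ?thesis
      by (subst DERIV_cong_ev[OF refl _ refl]) auto
  qed
  have c': "continuous_on ({\<tau><..} \<times> UNIV) (\<lambda>(t, x). Vt t x)"
    unfolding Vt_def case_prod_unfold
    by (intro continuous_on_mult c[unfolded case_prod_unfold] continuous_intros) auto
  let ?DD = "\<lambda>j t x. (((x - y) $ j)\<^sup>2 / (4 * (t - \<tau>)\<^sup>2) - 1 / (2 * (t - \<tau>))) * heat_kernel (t - \<tau>) (x - y)"
  have c'': "continuous_on ({\<tau><..} \<times> UNIV) (\<lambda>(t, x). ?DD j t x)" for j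
    unfolding case_prod_unfold
    by (intro continuous_on_mult c[unfolded case_prod_unfold] continuous_intros) auto
  have s: "Vt t x = (\<Sum>j\<in>UNIV. ?DD j t x)" for t x
    by (simp add: Vt_def norm_square_eq_sum sum_subtractf sum_divide_distrib flip: sum_distrib_right)
  show ?thesis unfolding C12_on_def
  proof (intro conjI exI)
    show "\<forall>t\<in>{\<tau><..}. second_partials (\<lambda>x. heat_kernel (t - \<tau>) (x - y))
      (\<lambda>j. (\<lambda>j t x. - ((x - y) $ j) / (2 * (t - \<tau>)) * heat_kernel (t - \<tau>) (x - y)) j t) (\<lambda>j. ?DD j t)"
      by (intro ballI second_partials_heat_kernel) auto
    show "\<forall>t\<in>{\<tau><..}. \<forall>x. Vt t x = (\<Sum>j\<in>UNIV. ?DD j t x)" using s by blast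
    show "\<forall>t\<in>{\<tau><..}. \<forall>x. ((\<lambda>s. heat_kernel (s - \<tau>) (x - y)) has_real_derivative Vt t x) (at t)"
      using d by blast
    show "\<forall>j. continuous_on ({\<tau><..} \<times> UNIV) (\<lambda>(t, x). ?DD j t x)" using c'' by blast
  qed (fact c c')+
qed

section \<open>The heat kernel as an approximate identity\<close>

lemma heat_kernel_scale:
  fixes z :: "real ^ 'n"
  assumes "s > 0"
  shows "sqrt s ^ CARD('n) * heat_kernel s (sqrt s *\<^sub>R z) = heat_kernel 1 z"
proof -
  have "sqrt s ^ CARD('n) = s powr (real CARD('n) / 2)"
    using assms by (simp add: powr_half_sqrt[symmetric] powr_powr flip: powr_realpow)
  then show ?thesis
    using assms by (simp add: heat_kernel_def powr_mult powr_minus power_mult_distrib field_simps)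
qed

text \<open>Substituting \<open>x = y + sqrt (\<delta> n) z\<close> turns the kernel into the fixed
  density \<open>heat_kernel 1\<close>, and \<open>B\<close> times this density dominates. Joint
  continuity of \<open>\<phi>\<close> enters because the time argument moves together with the space
  argument.\<close>

lemma heat_kernel_integral_tendsto:
  fixes y :: "real ^ 'n" and \<phi> :: "real \<Rightarrow> real ^ 'n \<Rightarrow> real"
  assumes c: "continuous_on UNIV (\<lambda>(t, x). \<phi> t x)" and B: "\<And>t x. \<bar>\<phi> t x\<bar> \<le> B"
    and \<delta>: "\<And>n. \<delta> n > 0" "\<delta> \<longlonglongrightarrow> 0"
  shows "(\<lambda>n. LINT x|lborel. heat_kernel (\<delta> n) (x - y) * \<phi> (\<tau> + \<delta> n) x) \<longlonglongrightarrow> \<phi> \<tau> y"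
proof -
  have cs: "continuous_on UNIV (\<phi> t)" for t
    using continuous_on_slice[of UNIV \<phi> t] c by simp
  have [measurable]: "\<phi> t \<in> borel_measurable borel" for t
    using cs by (rule borel_measurable_continuous_onI)
  have eq: "(LINT x|lborel. heat_kernel (\<delta> n) (x - y) * \<phi> (\<tau> + \<delta> n) x) =
     (LINT z|lborel. heat_kernel 1 (z - 0) * \<phi> (\<tau> + \<delta> n) (y + sqrt (\<delta> n) *\<^sub>R z))" for n
  proof -
    have "(LINT x|lborel. heat_kernel (\<delta> n) (x - y) * \<phi> (\<tau> + \<delta> n) x) =
      sqrt (\<delta> n) ^ CARD('n) * (LINT z|lborel. heat_kernel (\<delta> n) (sqrt (\<delta> n) *\<^sub>R z) * \<phi> (\<tau> + \<delta> n) (y + sqrt (\<delta> n) *\<^sub>R z))"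
      using \<delta>(1)[of n] by (subst lborel_integral_affine[where c = "sqrt (\<delta> n)" and t = y]) simp_all
    also have "\<dots> = (LINT z|lborel. (sqrt (\<delta> n) ^ CARD('n) * heat_kernel (\<delta> n) (sqrt (\<delta> n) *\<^sub>R z)) * \<phi> (\<tau> + \<delta> n) (y + sqrt (\<delta> n) *\<^sub>R z))"
      by (simp add: mult.assoc)
    finally show ?thesis by (simp add: heat_kernel_scale[OF \<delta>(1)])
  qed
  have "(\<lambda>n. LINT z|lborel. heat_kernel 1 (z - 0) * \<phi> (\<tau> + \<delta> n) (y + sqrt (\<delta> n) *\<^sub>R z))
    \<longlonglongrightarrow> (LINT z :: real ^ 'n|lborel. heat_kernel 1 (z - 0) * \<phi> \<tau> y)"
  proof (rule integral_dominated_convergence[where w = "\<lambda>z :: real ^ 'n. heat_kernel 1 (z - 0) * B"])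
    show "integrable lborel (\<lambda>z :: real ^ 'n. heat_kernel 1 (z - 0) * B)"
      using integrable_heat_kernel[of 1 "0 :: real ^ 'n"] by simp
    show "AE z in lborel. (\<lambda>n. heat_kernel 1 (z - 0) * \<phi> (\<tau> + \<delta> n) (y + sqrt (\<delta> n) *\<^sub>R z)) \<longlonglongrightarrow> heat_kernel 1 (z - 0) * \<phi> \<tau> y"
    proof (rule AE_I2)
      fix z :: "real ^ 'n"
      have "(\<lambda>n. (\<tau> + \<delta> n, y + sqrt (\<delta> n) *\<^sub>R z)) \<longlonglongrightarrow> (\<tau> + 0, y + sqrt 0 *\<^sub>R z)"
        by (intro tendsto_intros \<delta>)
      then have s: "(\<lambda>n. (\<tau> + \<delta> n, y + sqrt (\<delta> n) *\<^sub>R z)) \<longlonglongrightarrow> (\<tau>, y)" by simp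
      have "isCont (\<lambda>(t, x). \<phi> t x) (\<tau>, y)"
        using c by (simp add: continuous_on_eq_continuous_at)
      from isCont_tendsto_compose[OF this s]
      show "(\<lambda>n. heat_kernel 1 (z - 0) * \<phi> (\<tau> + \<delta> n) (y + sqrt (\<delta> n) *\<^sub>R z)) \<longlonglongrightarrow> heat_kernel 1 (z - 0) * \<phi> \<tau> y"
        by (intro tendsto_mult tendsto_const) simp
    qed
    show "AE z in lborel. norm (heat_kernel 1 (z - 0) * \<phi> (\<tau> + \<delta> n) (y + sqrt (\<delta> n) *\<^sub>R z)) \<le> heat_kernel 1 (z - 0) * B" for n
      using B by (intro AE_I2) (auto simp: abs_mult intro!: mult_left_mono)
  qed measurable
  then show ?thesis
    unfolding eq using integral_heat_kernel[of 1 "0 :: real ^ 'n"] by simp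
qed

lemma integrable_heat_kernel_strip:
  fixes y :: "real ^ 'n"
  shows "integrable lborel (\<lambda>(t, x). indicator {\<tau><..t2} t * heat_kernel (t - \<tau>) (x - y))"
proof (rule integrableI_bounded)
  have [measurable]: "(\<lambda>(t, x). indicator {\<tau><..t2} t * heat_kernel (t - \<tau>) (x - y)) \<in> borel_measurable (lborel \<Otimes>\<^sub>M lborel)"
    by measurable
  then show "(\<lambda>(t, x). indicator {\<tau><..t2} t * heat_kernel (t - \<tau>) (x - y)) \<in> borel_measurable lborel"
    by (simp add: lborel_prod)
  have "(\<integral>\<^sup>+z. ennreal (norm (case z of (t, x) \<Rightarrow> indicator {\<tau><..t2} t * heat_kernel (t - \<tau>) (x - y))) \<partial>lborel)
     = (\<integral>\<^sup>+z. ennreal (norm (case z of (t, x) \<Rightarrow> indicator {\<tau><..t2} t * heat_kernel (t - \<tau>) (x - y))) \<partial>(lborel \<Otimes>\<^sub>M lborel))"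
    by (simp add: lborel_prod)
  also have "\<dots> = (\<integral>\<^sup>+t. \<integral>\<^sup>+x. ennreal (indicator {\<tau><..t2} t * heat_kernel (t - \<tau>) (x - y)) \<partial>lborel \<partial>lborel)"
    by (subst lborel.nn_integral_fst[symmetric]) (simp_all)
  also have "\<dots> = (\<integral>\<^sup>+t. indicator {\<tau><..t2} t \<partial>lborel)"
  proof (rule nn_integral_cong)
    fix t show "(\<integral>\<^sup>+x. ennreal (indicator {\<tau><..t2} t * heat_kernel (t - \<tau>) (x - y)) \<partial>lborel) = indicator {\<tau><..t2} t"
      using nn_integral_heat_kernel[of "t - \<tau>" y] by (cases "t \<in> {\<tau><..t2}") auto
  qed
  also have "\<dots> < \<infinity>" by (cases "\<tau> \<le> t2") (simp_all add: less_top[symmetric])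
  finally show "(\<integral>\<^sup>+z. ennreal (norm (case z of (t, x) \<Rightarrow> indicator {\<tau><..t2} t * heat_kernel (t - \<tau>) (x - y))) \<partial>lborel) < \<infinity>" .
qed

text \<open>Green's identity is applied with the kernel as \<open>V\<close> on intervals that start
  at \<open>\<tau> + \<delta> n\<close>, after the singularity. The final boundary term lies beyond
  the support, and the initial one tends to \<open>\<phi> \<tau> y\<close>. For
  \<open>\<tau>\<close> before the support the value is zero, which later disposes of the initial
  datum.\<close>

lemma heat_kernel_potential:
  fixes y :: "real ^ 'n"
  assumes \<phi>: "test_function a b \<phi> \<phi>t L"
  shows "integrable lborel (\<lambda>(t, x). indicator {\<tau><..} t * heat_kernel (t - \<tau>) (x - y) * (\<phi>t t x + L t x))" (is ?A)
    and "(LINT (t, x)|lborel. indicator {\<tau><..} t * heat_kernel (t - \<tau>) (x - y) * (\<phi>t t x + L t x)) = - \<phi> \<tau> y" (is ?B)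
proof -
  \<comment> \<open>The end time lies beyond the support of \<open>\<phi>\<close> and is late enough
    for every interval from \<open>\<tau> + \<delta> n\<close>, where
    \<open>\<delta> n \<le> 1\<close>.\<close>
  define t2 where "t2 = max b (\<tau> + 1) + 1"
  have t2: "t2 > b" "t2 \<ge> \<tau> + 1" by (auto simp: t2_def)
  obtain R where R: "\<And>t x. t < a \<or> t > b \<or> norm x > R \<Longrightarrow> \<phi> t x = 0 \<and> \<phi>t t x = 0 \<and> L t x = 0"
    using \<phi> unfolding test_function_def by blast
  have C: "C12_on UNIV \<phi> \<phi>t L" using \<phi> by (simp add: test_function_def)
  obtain B where B: "B \<ge> 0" "\<And>t x. \<bar>\<phi> t x\<bar> \<le> B" "\<And>t x. \<bar>\<phi>t t x + L t x\<bar> \<le> B"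
    using test_function_bounded[OF \<phi>] by metis
  have cc: "continuous_on UNIV (\<lambda>(t, x). \<phi>t t x + L t x)"
    using C12_onD(2)[OF C] C12_on_continuous_laplacian[OF C]
    by (simp add: case_prod_unfold continuous_on_add)
  have mm[measurable]: "(\<lambda>(t, x). \<phi>t t x + L t x) \<in> borel_measurable (borel \<Otimes>\<^sub>M borel)"
    using borel_measurable_continuous_onI[OF cc] by (simp add: borel_prod)
  let ?K = "\<lambda>t x. heat_kernel (t - \<tau>) (x - y)"
  let ?F = "\<lambda>S (t, x). indicator S t * ?K t x * (\<phi>t t x + L t x)"
  have m: "?F S \<in> borel_measurable lborel" if [measurable]: "S \<in> sets borel" for S
  proof -
    have "?F S \<in> borel_measurable (lborel \<Otimes>\<^sub>M lborel)"
      by measurable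
    then show ?thesis by (simp add: lborel_prod)
  qed
  have dom: "integrable lborel (\<lambda>z. B * (case z of (t, x) \<Rightarrow> indicator {\<tau><..t2} t * ?K t x))"
    using integrable_heat_kernel_strip by (rule Bochner_Integration.integrable_mult_right)
  have bd: "norm (?F S z) \<le> B * (case z of (t, x) \<Rightarrow> indicator {\<tau><..t2} t * ?K t x)" if "S \<subseteq> {\<tau><..}" for S z
  proof (cases z)
    case (Pair t x)
    show ?thesis
    proof (cases "t \<in> S \<and> t \<le> t2")
      case True
      then have "norm (?F S z) = ?K t x * \<bar>\<phi>t t x + L t x\<bar>" using Pair by (simp add: abs_mult)
      also have "\<dots> \<le> ?K t x * B" by (intro mult_left_mono B) auto
      finally show ?thesis using True that Pair by (auto simp: mult.commute)
    next
      case False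
      then have "?F S z = 0" using R[of t x] t2 Pair by (auto simp: indicator_def)
      then show ?thesis using B(1) Pair by (auto simp: indicator_def)
    qed
  qed
  show ?A
  proof (rule Bochner_Integration.integrable_bound[OF dom m])
    show "AE z in lborel. norm (?F {\<tau><..} z) \<le> norm (B * (case z of (t, x) \<Rightarrow> indicator {\<tau><..t2} t * ?K t x))"
      using order_trans[OF bd abs_ge_self] by (intro AE_I2) simp
  qed simp
  define \<delta> where "\<delta> n = inverse (real (Suc n))" for n
  have \<delta>: "\<delta> n > 0" "\<delta> n \<le> 1" "\<delta> \<longlonglongrightarrow> 0" for n
    using LIMSEQ_inverse_real_of_nat by (auto simp: \<delta>_def[abs_def] field_simps)
  have "(\<lambda>n. LINT z|lborel. ?F {\<tau> + \<delta> n..t2} z) \<longlonglongrightarrow> (LINT z|lborel. ?F {\<tau><..} z)"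
  proof (rule integral_dominated_convergence[OF _ _ dom])
    show "AE z in lborel. norm (?F {\<tau> + \<delta> n..t2} z) \<le> B * (case z of (t, x) \<Rightarrow> indicator {\<tau><..t2} t * ?K t x)" for n
      using \<delta>(1)[of n] by (intro AE_I2 bd) auto
    show "AE z in lborel. (\<lambda>n. ?F {\<tau> + \<delta> n..t2} z) \<longlonglongrightarrow> ?F {\<tau><..} z"
    proof (rule AE_I2)
      fix z :: "real \<times> (real ^ 'n)"
      obtain t x where z: "z = (t, x)" by (cases z)
      have "\<forall>\<^sub>F n in sequentially. ?F {\<tau> + \<delta> n..t2} z = ?F {\<tau><..} z"
      proof (cases "t > \<tau>")
        case True
        then have "\<forall>\<^sub>F n in sequentially. \<delta> n < t - \<tau>"
          using \<delta>(3) by (intro order_tendstoD) auto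
        then show ?thesis
        proof eventually_elim
          case (elim n)
          show ?case using R[of t x] t2 elim True by (auto simp: z indicator_def)
        qed
      next
        case False
        then have "\<tau> + \<delta> n > t" for n using \<delta>(1)[of n] by linarith
        with False show ?thesis by (auto simp: z indicator_def not_le)
      qed
      then show "(\<lambda>n. ?F {\<tau> + \<delta> n..t2} z) \<longlonglongrightarrow> ?F {\<tau><..} z" by (rule tendsto_eventually)
    qed
  qed (use m in auto)
  moreover have "(LINT z|lborel. ?F {\<tau> + \<delta> n..t2} z) = - (LINT x|lborel. heat_kernel (\<delta> n) (x - y) * \<phi> (\<tau> + \<delta> n) x)" for n
  proof -
    have "{\<tau> + \<delta> n..t2} \<subseteq> {\<tau><..}" "\<tau> + \<delta> n \<le> t2" using \<delta>(1,2)[of n] t2 by auto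
    from C12_on_green(2)[OF C12_on_heat_kernel this \<phi>, of y]
    have "(LINT (t, x)|lborel. indicator {\<tau> + \<delta> n..t2} t * (?K t x * (\<phi>t t x + L t x))) =
      - (LINT x|lborel. heat_kernel (\<delta> n) (x - y) * \<phi> (\<tau> + \<delta> n) x)"
      using R[of t2] t2 by simp
    then show ?thesis by (simp add: mult.assoc)
  qed
  ultimately have "(\<lambda>n. - (LINT x|lborel. heat_kernel (\<delta> n) (x - y) * \<phi> (\<tau> + \<delta> n) x)) \<longlonglongrightarrow> (LINT z|lborel. ?F {\<tau><..} z)"
    by simp
  moreover have "(\<lambda>n. - (LINT x|lborel. heat_kernel (\<delta> n) (x - y) * \<phi> (\<tau> + \<delta> n) x)) \<longlonglongrightarrow> - \<phi> \<tau> y"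
    using C12_onD(1)[OF C] B(2) \<delta> by (intro tendsto_minus heat_kernel_integral_tendsto[of _ B]) auto
  ultimately show ?B by (rule LIMSEQ_unique)
qed

section \<open>Weak formulation\<close>

lemma nn_integral_lborel_fst:
  fixes f :: "'a::euclidean_space \<times> 'b::euclidean_space \<Rightarrow> ennreal"
  assumes "f \<in> borel_measurable (borel \<Otimes>\<^sub>M borel)"
  shows "(\<integral>\<^sup>+z. f z \<partial>lborel) = (\<integral>\<^sup>+x. \<integral>\<^sup>+y. f (x, y) \<partial>lborel \<partial>lborel)"
proof -
  have "f \<in> borel_measurable (lborel \<Otimes>\<^sub>M lborel)"
    using assms measurable_cong_sets by (auto cong: sets_pair_measure_cong)
  then show ?thesis by (simp add: lborel.nn_integral_fst lborel_prod)
qed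

lemma nn_integral_lborel_snd:
  fixes f :: "'a::euclidean_space \<times> 'b::euclidean_space \<Rightarrow> ennreal"
  assumes "f \<in> borel_measurable (borel \<Otimes>\<^sub>M borel)"
  shows "(\<integral>\<^sup>+z. f z \<partial>lborel) = (\<integral>\<^sup>+y. \<integral>\<^sup>+x. f (x, y) \<partial>lborel \<partial>lborel)"
proof -
  have "f \<in> borel_measurable (lborel \<Otimes>\<^sub>M lborel)"
    using assms measurable_cong_sets by (auto cong: sets_pair_measure_cong)
  from lborel_pair.nn_integral_snd[OF this] show ?thesis by (simp add: lborel_prod)
qed

lemma test_function_operator:
  assumes "test_function a b \<phi> \<phi>t L"
  obtains B R where "B \<ge> 0" "R \<ge> 0" "\<And>t x. \<bar>\<phi>t t x + L t x\<bar> \<le> B * indicator ({a..b} \<times> cball 0 R) (t, x)"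
    "\<And>t x. \<bar>\<phi> t x\<bar> \<le> B * indicator ({a..b} \<times> cball 0 R) (t, x)"
    "(\<lambda>(t, x). \<phi>t t x + L t x) \<in> borel_measurable (borel \<Otimes>\<^sub>M borel)"
proof -
  obtain R where R: "\<And>t x. t < a \<or> t > b \<or> norm x > R \<Longrightarrow> \<phi> t x = 0 \<and> \<phi>t t x = 0 \<and> L t x = 0"
    using assms unfolding test_function_def by blast
  have C: "C12_on UNIV \<phi> \<phi>t L" using assms by (simp add: test_function_def)
  obtain B where B: "B \<ge> 0" "\<And>t x. \<bar>\<phi> t x\<bar> \<le> B" "\<And>t x. \<bar>\<phi>t t x + L t x\<bar> \<le> B"
    using test_function_bounded[OF assms] by metis
  have cc: "continuous_on UNIV (\<lambda>(t, x). \<phi>t t x + L t x)"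
    using C12_onD(2)[OF C] C12_on_continuous_laplacian[OF C]
    by (simp add: case_prod_unfold continuous_on_add)
  show thesis
  proof (rule that[of B "max R 0"])
    show "\<bar>\<phi>t t x + L t x\<bar> \<le> B * indicator ({a..b} \<times> cball 0 (max R 0)) (t, x)" for t x
      using B(3)[of t x] R[of t x] by (cases "t < a \<or> t > b \<or> norm x > R") (auto simp: indicator_def B(1) not_less)
    show "\<bar>\<phi> t x\<bar> \<le> B * indicator ({a..b} \<times> cball 0 (max R 0)) (t, x)" for t x
      using B(2)[of t x] R[of t x] by (cases "t < a \<or> t > b \<or> norm x > R") (auto simp: indicator_def B(1) not_less)
  qed (use B(1) cc[THEN borel_measurable_continuous_onI] in \<open>auto simp: borel_prod\<close>)
qed

lemma nn_integral_indicator_strip: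
  "(\<integral>\<^sup>+z. ennreal (B * indicator ({a..b} \<times> cball 0 R) z) \<partial>(lborel :: (real \<times> (real ^ 'n)) measure)) < \<infinity>"
proof -
  have "integrable (lborel :: (real \<times> (real ^ 'n)) measure) (\<lambda>z. indicator ({a..b} \<times> cball 0 R) z *\<^sub>R B)"
    by (intro borel_integrable_compact compact_Times) auto
  then have "integrable (lborel :: (real \<times> (real ^ 'n)) measure) (\<lambda>z. B * indicator ({a..b} \<times> cball 0 R) z)"
    by (simp add: mult.commute)
  then have "(\<integral>\<^sup>+z. ennreal (norm (B * indicator ({a..b} \<times> cball 0 R) z)) \<partial>(lborel :: (real \<times> (real ^ 'n)) measure)) < \<infinity>"
    unfolding integrable_iff_bounded by blast
  then show ?thesis
    by (rule order_le_less_trans[rotated]) (intro nn_integral_mono ennreal_leI, simp)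
qed

text \<open>The form of the bound on \<open>f\<close> covers both the nonlinearity, where \<open>g\<close> is the singular part of
  \<open>\<bar>y\<bar> powr \<alpha>\<close>, and the forcing term, where \<open>g = \<bar>w\<bar>\<close>.\<close>

lemma duhamel_weak:
  fixes f :: "real \<Rightarrow> real ^ 'n \<Rightarrow> real"
  assumes \<phi>: "test_function a b \<phi> \<phi>t L" and ab: "0 < a" "a \<le> b"
    and fm: "(\<lambda>(\<tau>, y). indicator {0..b} \<tau> * f \<tau> y) \<in> borel_measurable (borel \<Otimes>\<^sub>M borel)"
    and k: "integrable lborel k" "\<And>\<tau>. 0 \<le> k \<tau>"
    and g: "integrable lborel g" "\<And>y. 0 \<le> g y" and C: "0 \<le> C"
    and bound: "\<And>\<tau> y. 0 \<le> \<tau> \<Longrightarrow> \<tau> \<le> b \<Longrightarrow> \<bar>f \<tau> y\<bar> \<le> k \<tau> * (g y + C)"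
  defines "W \<equiv> (\<lambda>t x. LINT \<tau>:{0..t}|lborel. heat_semigroup (t - \<tau>) (f \<tau>) x)"
  shows "integrable lborel (\<lambda>(t, x). W t x * (\<phi>t t x + L t x))"
    and "integrable lborel (\<lambda>(\<tau>, y). indicator {0..b} \<tau> * f \<tau> y * \<phi> \<tau> y)"
    and "(LINT (t, x)|lborel. W t x * (\<phi>t t x + L t x)) =
         - (LINT (\<tau>, y)|lborel. indicator {0..b} \<tau> * f \<tau> y * \<phi> \<tau> y)"
proof -
  obtain B R where B: "B \<ge> 0" "R \<ge> 0" "\<And>t x. \<bar>\<phi>t t x + L t x\<bar> \<le> B * indicator ({a..b} \<times> cball 0 R) (t, x)"
    and Pm[measurable]: "(\<lambda>(t, x). \<phi>t t x + L t x) \<in> borel_measurable (borel \<Otimes>\<^sub>M borel)"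
    by (rule test_function_operator[OF \<phi>]) (rule that)
  define P where "P z = \<phi>t (fst z) (snd z) + L (fst z) (snd z)" for z
  define F where "F w = indicator {0..b} (fst w) * f (fst w) (snd w)" for w
  have [measurable]: "P \<in> borel_measurable (borel \<Otimes>\<^sub>M borel)" "F \<in> borel_measurable (borel \<Otimes>\<^sub>M borel)"
    using Pm fm by (simp_all add: P_def[abs_def] F_def[abs_def] case_prod_unfold)
  have [measurable]: "P \<in> borel_measurable borel" "F \<in> borel_measurable borel"
    using \<open>P \<in> borel_measurable (borel \<Otimes>\<^sub>M borel)\<close> \<open>F \<in> borel_measurable (borel \<Otimes>\<^sub>M borel)\<close> by (simp_all add: borel_prod)
  have [measurable]: "k \<in> borel_measurable borel" "g \<in> borel_measurable borel" using k g by auto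
  have P0: "P z = 0" if "z \<notin> {a..b} \<times> cball 0 R" for z
    using B(3)[of "fst z" "snd z"] that by (simp add: P_def)
  have PB: "\<bar>P z\<bar> \<le> B" for z
    using order_trans[OF B(3)[of "fst z" "snd z"]] B(1) by (auto simp: P_def indicator_def)
  \<comment> \<open>The causal kernel: it vanishes unless the time of \<open>z\<close> exceeds that
    of \<open>w\<close>, and otherwise has mass 1 in either space variable. This symmetry permits
    the two orders of integration in \<open>I1\<close> and \<open>I2\<close>.\<close>
  define H :: "real \<times> (real ^ 'n) \<Rightarrow> real \<times> (real ^ 'n) \<Rightarrow> real"
    where "H z w = indicator {fst w<..} (fst z) * heat_kernel (fst z - fst w) (snd z - snd w)" for z w
  have H0: "0 \<le> H z w" for z w by (simp add: H_def)
  have Hm[measurable]: "(\<lambda>q. H (fst q) (snd q)) \<in> borel_measurable ((borel \<Otimes>\<^sub>M borel) \<Otimes>\<^sub>M (borel \<Otimes>\<^sub>M borel))"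
    unfolding H_def greaterThan_def by measurable
  have Hm2[measurable]: "H z \<in> borel_measurable (borel \<Otimes>\<^sub>M borel)" "(\<lambda>z. H z w) \<in> borel_measurable (borel \<Otimes>\<^sub>M borel)" for z w
    unfolding H_def greaterThan_def by measurable
  have Hx: "(\<integral>\<^sup>+x. ennreal (H (t, x) w) \<partial>lborel) = indicator {fst w<..} t" for t w
    using nn_integral_heat_kernel[of "t - fst w" "snd w"] by (cases "t > fst w") (auto simp: H_def)
  have Hy: "(\<integral>\<^sup>+y. ennreal (H z (\<tau>, y)) \<partial>lborel) = indicator {\<tau><..} (fst z)" for \<tau> z
    using nn_integral_heat_kernel[of "fst z - \<tau>" "snd z"] by (cases "fst z > \<tau>") (auto simp: H_def heat_kernel_commute)
  let ?Q = "\<lambda>q. P (fst q) * H (fst q) (snd q) * F (snd q)"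
  let ?k = "\<lambda>w. indicator {0..b} (fst w) * k (fst w)"
  have Qm: "?Q \<in> borel_measurable ((borel \<Otimes>\<^sub>M borel) \<Otimes>\<^sub>M (borel \<Otimes>\<^sub>M borel))"
    by measurable
  then have Qm': "?Q \<in> borel_measurable lborel" by (simp add: borel_prod)
  \<comment> \<open>For the integrable part \<open>g\<close> the variable \<open>z = (t, x)\<close>
    is integrated first: the mass of the kernel in \<open>x\<close> is at most 1, and the bound and
    time support of \<open>P\<close> leave the factor \<open>B * b\<close>.\<close>
  have I1: "(\<integral>\<^sup>+q. ennreal (\<bar>P (fst q)\<bar> * H (fst q) (snd q) * (?k (snd q) * g (snd (snd q)))) \<partial>lborel) < \<infinity>"
  proof -
    have "(\<integral>\<^sup>+q. ennreal (\<bar>P (fst q)\<bar> * H (fst q) (snd q) * (?k (snd q) * g (snd (snd q)))) \<partial>lborel)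
       = (\<integral>\<^sup>+w. \<integral>\<^sup>+z. ennreal (\<bar>P z\<bar> * H z w * (?k w * g (snd w))) \<partial>lborel \<partial>lborel)"
      by (subst nn_integral_lborel_snd) (simp_all add: borel_prod[symmetric])
    also have "\<dots> \<le> (\<integral>\<^sup>+w. ennreal (B * b) * ennreal (k (fst w) * g (snd w)) \<partial>lborel)"
    proof (rule nn_integral_mono)
      fix w :: "real \<times> (real ^ 'n)"
      show "(\<integral>\<^sup>+z. ennreal (\<bar>P z\<bar> * H z w * (?k w * g (snd w))) \<partial>lborel) \<le> ennreal (B * b) * ennreal (k (fst w) * g (snd w))"
      proof (cases "fst w \<in> {0..b}")
        case True
        have "(\<integral>\<^sup>+z. ennreal (\<bar>P z\<bar> * H z w) \<partial>lborel) \<le> (\<integral>\<^sup>+z. ennreal (B * indicator {0..b} (fst z) * H z w) \<partial>lborel)"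
        proof (intro nn_integral_mono ennreal_leI mult_right_mono H0)
          fix z show "\<bar>P z\<bar> \<le> B * indicator {0..b} (fst z)"
            using PB[of z] P0[of z] ab by (cases "fst z \<in> {a..b}") (auto simp: mem_Times_iff)
        qed
        also have "\<dots> = (\<integral>\<^sup>+t. \<integral>\<^sup>+x. ennreal (B * indicator {0..b} t * H (t, x) w) \<partial>lborel \<partial>lborel)"
          by (subst nn_integral_lborel_fst) simp_all
        also have "\<dots> = (\<integral>\<^sup>+t. ennreal (B * indicator {0..b} t) * indicator {fst w<..} t \<partial>lborel)"
          using B(1) by (intro nn_integral_cong) (simp add: ennreal_mult' nn_integral_cmult Hx)
        also have "\<dots> \<le> (\<integral>\<^sup>+t. ennreal B * indicator {0..b} t \<partial>lborel)"
          by (intro nn_integral_mono) (auto simp: indicator_def)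
        also have "\<dots> = ennreal (B * b)"
          using ab B(1) by (simp add: nn_integral_cmult ennreal_mult)
        finally have s: "(\<integral>\<^sup>+z. ennreal (\<bar>P z\<bar> * H z w) \<partial>lborel) \<le> ennreal (B * b)" .
        have "(\<integral>\<^sup>+z. ennreal (\<bar>P z\<bar> * H z w * (?k w * g (snd w))) \<partial>lborel)
          = (\<integral>\<^sup>+z. ennreal (\<bar>P z\<bar> * H z w) * ennreal (k (fst w) * g (snd w)) \<partial>lborel)"
          using True k(2) g(2) H0 by (intro nn_integral_cong) (auto simp: ennreal_mult'[symmetric])
        also have "\<dots> = (\<integral>\<^sup>+z. ennreal (\<bar>P z\<bar> * H z w) \<partial>lborel) * ennreal (k (fst w) * g (snd w))"
          by (rule nn_integral_multc) (simp add: borel_prod[symmetric])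
        also have "\<dots> \<le> ennreal (B * b) * ennreal (k (fst w) * g (snd w))"
          by (rule mult_right_mono[OF s]) simp
        finally show ?thesis .
      qed simp
    qed
    also have "\<dots> = ennreal (B * b) * (\<integral>\<^sup>+w. ennreal (k (fst w) * g (snd w)) \<partial>lborel)"
      by (rule nn_integral_cmult) (simp add: borel_prod[symmetric])
    also have "(\<integral>\<^sup>+w. ennreal (k (fst w) * g (snd w)) \<partial>lborel) = (\<integral>\<^sup>+\<tau>. \<integral>\<^sup>+y. ennreal (k \<tau> * g y) \<partial>lborel \<partial>lborel)"
      by (subst nn_integral_lborel_fst) simp_all
    also have "\<dots> = (\<integral>\<^sup>+\<tau>. ennreal (k \<tau>) \<partial>lborel) * (\<integral>\<^sup>+y. ennreal (g y) \<partial>lborel)"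
      using k(2) by (simp add: ennreal_mult' nn_integral_cmult nn_integral_multc)
    also have "ennreal (B * b) * \<dots> < \<infinity>"
      using k g by (simp add: integrable_iff_bounded ennreal_mult_less_top)
    finally show ?thesis .
  qed
  \<comment> \<open>A nonzero constant is not integrable in \<open>y\<close>, so here
    \<open>w = (\<tau>, y)\<close> is integrated first, using the mass of the kernel in
    \<open>y\<close>; the remaining integral over \<open>z\<close> is finite because
    \<open>P\<close> is bounded with compact support.\<close>
  have I2: "(\<integral>\<^sup>+q. ennreal (\<bar>P (fst q)\<bar> * H (fst q) (snd q) * (?k (snd q) * C)) \<partial>lborel) < \<infinity>"
  proof -
    have "(\<integral>\<^sup>+q. ennreal (\<bar>P (fst q)\<bar> * H (fst q) (snd q) * (?k (snd q) * C)) \<partial>lborel)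
       = (\<integral>\<^sup>+z. \<integral>\<^sup>+w. ennreal (\<bar>P z\<bar> * H z w * (?k w * C)) \<partial>lborel \<partial>lborel)"
      by (subst nn_integral_lborel_fst) (simp_all add: borel_prod[symmetric])
    also have "\<dots> \<le> (\<integral>\<^sup>+z. ennreal \<bar>P z\<bar> * (ennreal C * (\<integral>\<^sup>+\<tau>. ennreal (k \<tau>) \<partial>lborel)) \<partial>lborel)"
    proof (rule nn_integral_mono)
      fix z :: "real \<times> (real ^ 'n)"
      have "(\<integral>\<^sup>+w. ennreal (k (fst w) * H z w) \<partial>lborel) = (\<integral>\<^sup>+\<tau>. \<integral>\<^sup>+y. ennreal (k \<tau> * H z (\<tau>, y)) \<partial>lborel \<partial>lborel)"
        by (subst nn_integral_lborel_fst) simp_all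
      also have "\<dots> = (\<integral>\<^sup>+\<tau>. ennreal (k \<tau>) * indicator {\<tau><..} (fst z) \<partial>lborel)"
        using k(2) by (intro nn_integral_cong) (simp add: ennreal_mult' nn_integral_cmult Hy)
      also have "\<dots> \<le> (\<integral>\<^sup>+\<tau>. ennreal (k \<tau>) \<partial>lborel)"
        by (intro nn_integral_mono) (auto simp: indicator_def)
      finally have s: "(\<integral>\<^sup>+w. ennreal (k (fst w) * H z w) \<partial>lborel) \<le> (\<integral>\<^sup>+\<tau>. ennreal (k \<tau>) \<partial>lborel)" .
      have "(\<integral>\<^sup>+w. ennreal (\<bar>P z\<bar> * H z w * (?k w * C)) \<partial>lborel)
        \<le> (\<integral>\<^sup>+w. ennreal (\<bar>P z\<bar> * C) * ennreal (k (fst w) * H z w) \<partial>lborel)"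
        using k(2) H0 C by (intro nn_integral_mono) (auto simp: ennreal_mult'[symmetric] indicator_def mult_ac)
      also have "\<dots> = ennreal (\<bar>P z\<bar> * C) * (\<integral>\<^sup>+w. ennreal (k (fst w) * H z w) \<partial>lborel)"
        by (rule nn_integral_cmult) (simp add: borel_prod[symmetric])
      also have "\<dots> \<le> ennreal (\<bar>P z\<bar> * C) * (\<integral>\<^sup>+\<tau>. ennreal (k \<tau>) \<partial>lborel)"
        by (rule mult_left_mono[OF s]) simp
      finally show "(\<integral>\<^sup>+w. ennreal (\<bar>P z\<bar> * H z w * (?k w * C)) \<partial>lborel) \<le> ennreal \<bar>P z\<bar> * (ennreal C * (\<integral>\<^sup>+\<tau>. ennreal (k \<tau>) \<partial>lborel))"
        by (simp add: ennreal_mult' mult.assoc)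
    qed
    also have "\<dots> = (\<integral>\<^sup>+z. ennreal \<bar>P z\<bar> \<partial>lborel) * (ennreal C * (\<integral>\<^sup>+\<tau>. ennreal (k \<tau>) \<partial>lborel))"
      by (rule nn_integral_multc) simp
    also have "\<dots> < \<infinity>"
    proof -
      have "(\<integral>\<^sup>+z. ennreal \<bar>P z\<bar> \<partial>lborel) \<le> (\<integral>\<^sup>+z. ennreal (B * indicator ({a..b} \<times> cball 0 R) z) \<partial>(lborel :: (real \<times> (real ^ 'n)) measure))"
        using B(3)[of "fst z" "snd z" for z] by (intro nn_integral_mono ennreal_leI) (simp add: P_def)
      also have "\<dots> < \<infinity>" by (rule nn_integral_indicator_strip)
      finally show ?thesis using k by (simp add: integrable_iff_bounded ennreal_mult_less_top)
    qed
    finally show ?thesis .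
  qed
  have "integrable lborel ?Q"
  proof (rule integrableI_bounded[OF Qm'])
    have "(\<integral>\<^sup>+q. ennreal (norm (?Q q)) \<partial>lborel) \<le>
      (\<integral>\<^sup>+q. ennreal (\<bar>P (fst q)\<bar> * H (fst q) (snd q) * (?k (snd q) * g (snd (snd q))))
        + ennreal (\<bar>P (fst q)\<bar> * H (fst q) (snd q) * (?k (snd q) * C)) \<partial>lborel)"
    proof (rule nn_integral_mono)
      fix q :: "(real \<times> (real ^ 'n)) \<times> (real \<times> (real ^ 'n))"
      have "\<bar>F (snd q)\<bar> \<le> ?k (snd q) * (g (snd (snd q)) + C)"
        using bound[of "fst (snd q)" "snd (snd q)"] by (auto simp: F_def indicator_def)
      then have "\<bar>P (fst q)\<bar> * H (fst q) (snd q) * \<bar>F (snd q)\<bar> \<le> \<bar>P (fst q)\<bar> * H (fst q) (snd q) * (?k (snd q) * (g (snd (snd q)) + C))"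
        using H0 by (intro mult_left_mono) auto
      moreover have nn: "0 \<le> \<bar>P (fst q)\<bar> * H (fst q) (snd q) * (?k (snd q) * g (snd (snd q)))"
        "0 \<le> \<bar>P (fst q)\<bar> * H (fst q) (snd q) * (?k (snd q) * C)"
        using H0 k(2) g(2) C by auto
      ultimately have "norm (?Q q) \<le> \<bar>P (fst q)\<bar> * H (fst q) (snd q) * (?k (snd q) * g (snd (snd q)))
        + \<bar>P (fst q)\<bar> * H (fst q) (snd q) * (?k (snd q) * C)"
        using H0 by (simp add: abs_mult distrib_left)
      then show "ennreal (norm (?Q q)) \<le> ennreal (\<bar>P (fst q)\<bar> * H (fst q) (snd q) * (?k (snd q) * g (snd (snd q))))
        + ennreal (\<bar>P (fst q)\<bar> * H (fst q) (snd q) * (?k (snd q) * C))"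
        unfolding ennreal_plus[OF nn, symmetric] by (rule ennreal_leI)
    qed
    also have "\<dots> = (\<integral>\<^sup>+q. ennreal (\<bar>P (fst q)\<bar> * H (fst q) (snd q) * (?k (snd q) * g (snd (snd q)))) \<partial>lborel)
        + (\<integral>\<^sup>+q. ennreal (\<bar>P (fst q)\<bar> * H (fst q) (snd q) * (?k (snd q) * C)) \<partial>lborel)"
      by (rule nn_integral_add) (simp_all add: borel_prod[symmetric])
    also have "\<dots> < \<infinity>" using I1 I2 by simp
    finally show "(\<integral>\<^sup>+q. ennreal (norm (?Q q)) \<partial>lborel) < \<infinity>" .
  qed
  then have int: "integrable (lborel \<Otimes>\<^sub>M lborel) (\<lambda>(z, w). P z * H z w * F w)"
    by (simp add: lborel_prod case_prod_unfold)
  have w_side: "(LINT z|lborel. P z * H z w * F w) = - (case w of (\<tau>, y) \<Rightarrow> indicator {0..b} \<tau> * f \<tau> y * \<phi> \<tau> y)" for w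
  proof -
    have "(LINT z|lborel. P z * H z w * F w) = F w * (LINT z|lborel. P z * H z w)"
      by (simp add: mult.commute)
    also have "(LINT z|lborel. P z * H z w) = (LINT (t, x)|lborel. indicator {fst w<..} t * heat_kernel (t - fst w) (x - snd w) * (\<phi>t t x + L t x))"
      by (intro Bochner_Integration.integral_cong) (auto simp: P_def H_def)
    also have "\<dots> = - \<phi> (fst w) (snd w)" by (rule heat_kernel_potential(2)[OF \<phi>])
    finally show ?thesis by (simp add: F_def case_prod_unfold)
  qed
  have "integrable lborel (\<lambda>w. LINT z|lborel. P z * H z w * F w)"
    by (rule lborel_pair.integrable_snd[OF int])
  then show "integrable lborel (\<lambda>(\<tau>, y). indicator {0..b} \<tau> * f \<tau> y * \<phi> \<tau> y)"
    unfolding w_side by simp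
  have W: "W t x * (\<phi>t t x + L t x) = P (t, x) * (LINT \<tau>|lborel. LINT y|lborel. H (t, x) (\<tau>, y) * F (\<tau>, y))" for t x
  proof (cases "(t, x) \<in> {a..b} \<times> cball 0 R")
    case True
    then have t: "0 < t" "t \<le> b" using ab by auto
    have "W t x = (LINT \<tau>|lborel. LINT y|lborel. H (t, x) (\<tau>, y) * F (\<tau>, y))"
      unfolding W_def set_lebesgue_integral_def
    \<comment> \<open>At \<open>\<tau> = t\<close> the semigroup is the identity whereas
      \<open>H\<close> is zero. The integrands may differ only at this single time.\<close>
    proof (rule integral_discrete_difference[of "{t}"])
      fix \<tau> :: real assume "\<tau> \<notin> {t}"
      then show "indicator {0..t} \<tau> *\<^sub>R heat_semigroup (t - \<tau>) (f \<tau>) x = (LINT y|lborel. H (t, x) (\<tau>, y) * F (\<tau>, y))"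
        using t by (cases "0 \<le> \<tau>"; cases "\<tau> < t") (auto simp: heat_semigroup_def H_def F_def)
    qed auto
    then show ?thesis by (simp add: P_def)
  next
    case False
    then show ?thesis using P0[of "(t, x)"] by (simp add: P_def)
  qed
  have Wm: "(\<lambda>(t, x). W t x * (\<phi>t t x + L t x)) \<in> borel_measurable lborel"
  proof -
    have *: "(\<lambda>(z, \<tau>). LINT y|lborel. H z (\<tau>, y) * F (\<tau>, y)) \<in> borel_measurable ((borel \<Otimes>\<^sub>M borel) \<Otimes>\<^sub>M lborel)"
      unfolding H_def greaterThan_def by measurable
    have "(\<lambda>z. P z * (LINT \<tau>|lborel. LINT y|lborel. H z (\<tau>, y) * F (\<tau>, y))) \<in> borel_measurable (borel \<Otimes>\<^sub>M borel)"
      using lborel.borel_measurable_lebesgue_integral[OF *] by measurable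
    then show ?thesis unfolding W by (simp add: case_prod_unfold borel_prod)
  qed
  \<comment> \<open>The identity is claimed almost everywhere only: splitting the integral over
    \<open>w\<close> into iterated ones needs an integrable section, which Fubini provides for
    almost every \<open>z\<close> with \<open>P z \<noteq> 0\<close>. Where \<open>P z = 0\<close>
    both sides vanish.\<close>
  have z_side: "AE z in lborel. (LINT w|lborel. P z * H z w * F w) = (case z of (t, x) \<Rightarrow> W t x * (\<phi>t t x + L t x))"
    using lborel_pair.AE_integrable_fst[OF int]
  proof eventually_elim
    case (elim z)
    show ?case
    proof (cases "P z = 0")
      case True
      then show ?thesis by (auto simp: P_def split: prod.split)
    next
      case False
      then have i: "integrable lborel (\<lambda>w. H z w * F w)"
        using elim by (simp add: mult.assoc)
      have "(LINT w|lborel. P z * H z w * F w) = P z * (LINT w|lborel. H z w * F w)"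
        by (simp add: mult.assoc)
      also have "(LINT w|lborel. H z w * F w) = (LINT \<tau>|lborel. LINT y|lborel. H z (\<tau>, y) * F (\<tau>, y))"
        using lborel_pair.integral_fst'[of "\<lambda>w. H z w * F w"] i by (simp add: lborel_prod)
      finally show ?thesis by (simp add: W split: prod.split)
    qed
  qed
  show "integrable lborel (\<lambda>(t, x). W t x * (\<phi>t t x + L t x))"
    using lborel_pair.integrable_fst[OF int] z_side Wm by (subst integrable_cong_AE[OF Wm]) auto
  have "(LINT (t, x)|lborel. W t x * (\<phi>t t x + L t x)) = (LINT z|lborel. LINT w|lborel. P z * H z w * F w)"
    using lborel_pair.integrable_fst[OF int] z_side Wm by (intro integral_cong_AE) auto
  also have "\<dots> = (LINT w|lborel. LINT z|lborel. P z * H z w * F w)"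
    using lborel_pair.integral_fst[OF int] lborel_pair.integral_snd[OF int] by simp
  also have "\<dots> = - (LINT (\<tau>, y)|lborel. indicator {0..b} \<tau> * f \<tau> y * \<phi> \<tau> y)"
    unfolding w_side by simp
  finally show "(LINT (t, x)|lborel. W t x * (\<phi>t t x + L t x)) =
         - (LINT (\<tau>, y)|lborel. indicator {0..b} \<tau> * f \<tau> y * \<phi> \<tau> y)" .
qed

text \<open>After Fubini the datum is multiplied by the potential of the test function at time 0,
  which is \<open>- \<phi> 0 y\<close> and vanishes since the support starts at
  \<open>a > 0\<close>.\<close>

lemma heat_initial_weak:
  fixes u0 :: "real ^ 'n \<Rightarrow> real"
  assumes \<phi>: "test_function a b \<phi> \<phi>t L" and a: "0 < a"
    and u0: "continuous_on UNIV u0" "\<And>x. \<bar>u0 x\<bar> \<le> C"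
  shows "integrable lborel (\<lambda>(t, x). heat_semigroup t u0 x * (\<phi>t t x + L t x))"
    and "(LINT (t, x)|lborel. heat_semigroup t u0 x * (\<phi>t t x + L t x)) = 0"
proof -
  obtain B R where B: "B \<ge> 0" "R \<ge> 0" "\<And>t x. \<bar>\<phi>t t x + L t x\<bar> \<le> B * indicator ({a..b} \<times> cball 0 R) (t, x)"
    and \<phi>B: "\<And>t x. \<bar>\<phi> t x\<bar> \<le> B * indicator ({a..b} \<times> cball 0 R) (t, x)"
    and Pm[measurable]: "(\<lambda>(t, x). \<phi>t t x + L t x) \<in> borel_measurable (borel \<Otimes>\<^sub>M borel)"
    by (rule test_function_operator[OF \<phi>]) (rule that)
  define P where "P z = \<phi>t (fst z) (snd z) + L (fst z) (snd z)" for z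
  have [measurable]: "P \<in> borel_measurable (borel \<Otimes>\<^sub>M borel)"
    using Pm by (simp add: P_def[abs_def] case_prod_unfold)
  then have [measurable]: "P \<in> borel_measurable borel" by (simp add: borel_prod)
  have [measurable]: "u0 \<in> borel_measurable borel"
    using u0(1) by (rule borel_measurable_continuous_onI)
  have C: "0 \<le> C" using u0(2)[of 0] by linarith
  define H :: "real \<times> (real ^ 'n) \<Rightarrow> real ^ 'n \<Rightarrow> real"
    where "H z y = indicator {0<..} (fst z) * heat_kernel (fst z - 0) (snd z - y)" for z y
  have H0: "0 \<le> H z y" for z y by (simp add: H_def)
  have Hm[measurable]: "(\<lambda>q. H (fst q) (snd q)) \<in> borel_measurable ((borel \<Otimes>\<^sub>M borel) \<Otimes>\<^sub>M borel)"
    unfolding H_def greaterThan_def by measurable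
  have Hm2[measurable]: "H z \<in> borel_measurable borel" for z
    unfolding H_def greaterThan_def by measurable
  have Hy: "(\<integral>\<^sup>+y. ennreal (H z y) \<partial>lborel) \<le> 1" for z
    using nn_integral_heat_kernel[of "fst z" "snd z"] by (cases "fst z > 0") (auto simp: H_def heat_kernel_commute)
  let ?Q = "\<lambda>q. P (fst q) * H (fst q) (snd q) * u0 (snd q)"
  have "integrable lborel ?Q"
  proof (rule integrableI_bounded)
    have "?Q \<in> borel_measurable ((borel \<Otimes>\<^sub>M borel) \<Otimes>\<^sub>M borel)" by measurable
    then show "?Q \<in> borel_measurable lborel" by (simp add: borel_prod)
    have "(\<integral>\<^sup>+q. ennreal (norm (?Q q)) \<partial>lborel) = (\<integral>\<^sup>+z. \<integral>\<^sup>+y. ennreal (norm (P z * H z y * u0 y)) \<partial>lborel \<partial>lborel)"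
      by (subst nn_integral_lborel_fst) (simp_all add: borel_prod[symmetric])
    also have "\<dots> \<le> (\<integral>\<^sup>+z. ennreal C * ennreal (B * indicator ({a..b} \<times> cball 0 R) z) \<partial>(lborel :: (real \<times> (real ^ 'n)) measure))"
    proof (rule nn_integral_mono)
      fix z :: "real \<times> (real ^ 'n)"
      have "(\<integral>\<^sup>+y. ennreal (norm (P z * H z y * u0 y)) \<partial>lborel) \<le> (\<integral>\<^sup>+y. ennreal (C * \<bar>P z\<bar>) * ennreal (H z y) \<partial>lborel)"
      proof (rule nn_integral_mono)
        fix y
        have "norm (P z * H z y * u0 y) \<le> \<bar>P z\<bar> * H z y * C"
          using u0(2)[of y] H0[of z y] by (simp add: abs_mult mult_left_mono)
        then show "ennreal (norm (P z * H z y * u0 y)) \<le> ennreal (C * \<bar>P z\<bar>) * ennreal (H z y)"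
          using C H0[of z y] by (simp add: ennreal_mult[symmetric] mult_ac ennreal_leI)
      qed
      also have "\<dots> = ennreal (C * \<bar>P z\<bar>) * (\<integral>\<^sup>+y. ennreal (H z y) \<partial>lborel)"
        by (rule nn_integral_cmult) simp
      also have "\<dots> \<le> ennreal (C * \<bar>P z\<bar>) * 1" by (rule mult_left_mono[OF Hy]) simp
      also have "\<dots> \<le> ennreal C * ennreal (B * indicator ({a..b} \<times> cball 0 R) z)"
        using B(3)[of "fst z" "snd z"] B(1) C by (simp add: P_def ennreal_mult[symmetric] ennreal_leI mult_left_mono)
      finally show "(\<integral>\<^sup>+y. ennreal (norm (P z * H z y * u0 y)) \<partial>lborel) \<le> ennreal C * ennreal (B * indicator ({a..b} \<times> cball 0 R) z)" .
    qed
    also have "\<dots> = ennreal C * (\<integral>\<^sup>+z. ennreal (B * indicator ({a..b} \<times> cball 0 R) z) \<partial>(lborel :: (real \<times> (real ^ 'n)) measure))"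
      by (rule nn_integral_cmult) (simp add: borel_prod[symmetric])
    also have "\<dots> < \<infinity>"
      using nn_integral_indicator_strip[where ?'n = 'n] by (simp add: ennreal_mult_less_top)
    finally show "(\<integral>\<^sup>+q. ennreal (norm (?Q q)) \<partial>lborel) < \<infinity>" .
  qed
  then have int: "integrable (lborel \<Otimes>\<^sub>M lborel) (\<lambda>(z, y). P z * H z y * u0 y)"
    by (simp add: lborel_prod case_prod_unfold)
  have y_side: "(LINT z|lborel. P z * H z y * u0 y) = 0" for y
  proof -
    have "(LINT z|lborel. P z * H z y * u0 y) = u0 y * (LINT z|lborel. P z * H z y)"
      by (simp add: mult.commute)
    also have "(LINT z|lborel. P z * H z y) = (LINT (t, x)|lborel. indicator {0<..} t * heat_kernel (t - 0) (x - y) * (\<phi>t t x + L t x))"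
      by (intro Bochner_Integration.integral_cong) (auto simp: P_def H_def)
    also have "\<dots> = - \<phi> 0 y" by (rule heat_kernel_potential(2)[OF \<phi>])
    also have "\<phi> 0 y = 0" using \<phi>B[of 0 y] a by simp
    finally show ?thesis by simp
  qed
  have z_side: "(LINT y|lborel. P z * H z y * u0 y) = (case z of (t, x) \<Rightarrow> heat_semigroup t u0 x * (\<phi>t t x + L t x))" for z
  proof (cases z)
    case (Pair t x)
    show ?thesis
    proof (cases "t > 0")
      case True
      then show ?thesis by (simp add: Pair H_def heat_semigroup_def P_def mult.assoc)
    next
      case False
      then have "P z = 0" using B(3)[of t x] a by (simp add: Pair P_def)
      then show ?thesis by (simp add: Pair P_def)
    qed
  qed
  show "integrable lborel (\<lambda>(t, x). heat_semigroup t u0 x * (\<phi>t t x + L t x))"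
    using lborel_pair.integrable_fst[OF int] unfolding z_side .
  have "(LINT z|lborel. LINT y|lborel. P z * H z y * u0 y) = (LINT y|lborel. LINT z|lborel. P z * H z y * u0 y)"
    using lborel_pair.integral_fst[OF int] lborel_pair.integral_snd[OF int] by simp
  then show "(LINT (t, x)|lborel. heat_semigroup t u0 x * (\<phi>t t x + L t x)) = 0"
    unfolding z_side y_side by simp
qed

section \<open>The weak identity for mild and for classical solutions\<close>

lemma integrable_zeta:
  assumes "\<sigma> > -1" "m \<le> 0"
  shows "integrable lborel (\<lambda>t. indicator {0..b} t * zeta \<sigma> m t)"
proof (rule Bochner_Integration.integrable_bound)
  have "integrable lborel (\<lambda>t. \<bar>t\<bar> powr \<sigma> * indicator {-1..1} t :: real)"
    using nn_integral_powr_unit_interval[OF assms(1)] by (intro integrableI_bounded) auto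
  moreover have "integrable lborel (\<lambda>t. indicator {0..b} t :: real)"
    using integrable_real_indicator[of "{0..b}" lborel] by (cases "0 \<le> b") auto
  ultimately show "integrable lborel (\<lambda>t. \<bar>t\<bar> powr \<sigma> * indicator {-1..1} t + indicator {0..b} t :: real)"
    by simp
  have "norm (indicator {0..b} t * zeta \<sigma> m t) \<le> norm (\<bar>t\<bar> powr \<sigma> * indicator {-1..1} t + indicator {0..b} t :: real)" for t
  proof (cases "t \<in> {0..b}")
    case True
    have "t \<ge> 1 \<Longrightarrow> t powr m \<le> 1" using assms(2) powr_mono[of m 0 t] by simp
    then show ?thesis using True by (auto simp: zeta_def indicator_def intro: add_increasing)
  qed simp
  then show "AE t in lborel. norm (indicator {0..b} t * zeta \<sigma> m t) \<le> norm (\<bar>t\<bar> powr \<sigma> * indicator {-1..1} t + indicator {0..b} t :: real)"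
    by simp
  show "(\<lambda>t. indicator {0..b} t * zeta \<sigma> m t) \<in> borel_measurable lborel"
    unfolding zeta_def by measurable
qed

lemma zeta_measurable [measurable]: "zeta \<sigma> m \<in> borel_measurable borel"
  unfolding zeta_def[abs_def] by measurable

lemma zeta_nonneg [simp]: "0 \<le> zeta \<sigma> m t"
  by (simp add: zeta_def)

text \<open>Duhamel's formula is tested term by term: the part with the initial datum contributes
  nothing, and each source term is an instance of \<open>duhamel_weak\<close>.\<close>

lemma mild_solution_weak:
  fixes u :: "real \<Rightarrow> real ^ 'n \<Rightarrow> real"
  assumes \<phi>: "test_function a b \<phi> \<phi>t L" and ab: "0 < a" "a \<le> b"
    and \<alpha>: "- real CARD('n) < \<alpha>" "\<alpha> \<le> 0" and p: "1 < p" and \<sigma>: "\<sigma> > -1" and m: "m \<le> 0"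
    and w: "continuous_on UNIV w" "integrable lborel w"
    and u0: "u0 \<in> bcontfun" and u: "u \<in> CB_strip b" and mild: "mild_solution \<alpha> p \<sigma> m w u0 u"
  shows "integrable lborel (\<lambda>(t, x). u t x * (\<phi>t t x + L t x))"
    and "integrable lborel (\<lambda>(t, x). norm x powr \<alpha> * \<bar>u t x\<bar> powr p * \<phi> t x)"
    and "integrable lborel (\<lambda>(t, x). zeta \<sigma> m t * w x * \<phi> t x)"
    and "(LINT (t, x)|lborel. u t x * (\<phi>t t x + L t x)) =
      - (LINT (t, x)|lborel. norm x powr \<alpha> * \<bar>u t x\<bar> powr p * \<phi> t x) - (LINT (t, x)|lborel. zeta \<sigma> m t * w x * \<phi> t x)"
proof -
  obtain R where R: "\<And>t x. t < a \<or> t > b \<or> norm x > R \<Longrightarrow> \<phi> t x = 0 \<and> \<phi>t t x = 0 \<and> L t x = 0"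
    using \<phi> unfolding test_function_def by blast
  let ?N = "\<lambda>t x. norm x powr \<alpha> * \<bar>u t x\<bar> powr p"
  let ?Z = "\<lambda>t x. zeta \<sigma> m t * w x"
  have drop: "(\<lambda>(t, x). indicator {0..b} t * f t x * \<phi> t x) = (\<lambda>(t, x). f t x * \<phi> t x)" for f :: "real \<Rightarrow> real ^ 'n \<Rightarrow> real"
  proof -
    have "0 \<le> t \<and> t \<le> b" if "\<phi> t x \<noteq> 0" for t x using R[of t x] ab that by force
    then show ?thesis by (auto simp: fun_eq_iff indicator_def)
  qed
  have [measurable]: "w \<in> borel_measurable borel" using w(1) by (rule borel_measurable_continuous_onI)
  have uc: "continuous_on ({0..b} \<times> UNIV) (\<lambda>(t, x). u t x)" and "bounded ((\<lambda>(t, x). u t x) ` ({0..b} \<times> UNIV))"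
    using u by (auto simp: CB_strip_def)
  then obtain M where M: "\<And>z. z \<in> {0..b} \<times> UNIV \<Longrightarrow> norm (case z of (t, x) \<Rightarrow> u t x) \<le> M"
    unfolding bounded_iff by (metis imageI)
  \<comment> \<open>Nothing is known about \<open>u\<close> outside the time interval
    \<open>{0..b}\<close>, so measurability is stated for the truncated function.\<close>
  have um: "(\<lambda>z. indicator ({0..b} \<times> UNIV) z *\<^sub>R (case z of (t, x) \<Rightarrow> u t x)) \<in> borel_measurable borel"
    by (rule borel_measurable_continuous_on_indicator[OF _ uc]) (auto intro: borel_closed closed_Times)
  have um2: "(\<lambda>z. norm (snd z) powr \<alpha> * \<bar>indicator ({0..b} \<times> UNIV) z *\<^sub>R (case z of (t, x) \<Rightarrow> u t x)\<bar> powr p) \<in> borel_measurable (borel \<Otimes>\<^sub>M borel)"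
    using um[unfolded borel_prod[symmetric]] by measurable
  have Nm: "(\<lambda>(\<tau>, y). indicator {0..b} \<tau> * ?N \<tau> y) \<in> borel_measurable (borel \<Otimes>\<^sub>M borel)"
    using um2 by (rule measurable_cong[THEN iffD1, rotated]) (auto simp: indicator_def)
  \<comment> \<open>Outside the unit ball the weight is at most 1, which accounts for the constant
    \<open>C = 1\<close>; the bound \<open>M\<close> on \<open>u\<close> goes into the time factor
    \<open>k\<close>.\<close>
  note D1 = duhamel_weak[OF \<phi> ab Nm, of "\<lambda>t. indicator {0..b} t * M powr p" "\<lambda>y. norm y powr \<alpha> * indicator (cball 0 1) y" 1,
    unfolded drop]
  have b1: "\<bar>?N \<tau> y\<bar> \<le> indicator {0..b} \<tau> * M powr p * (norm y powr \<alpha> * indicator (cball 0 1) y + 1)" if "0 \<le> \<tau>" "\<tau> \<le> b" for \<tau> y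
  proof -
    have "norm y powr \<alpha> \<le> norm y powr \<alpha> * indicator (cball 0 1) y + 1"
      using powr_mono[of \<alpha> 0 "norm y"] \<alpha>(2) by (cases "norm y \<le> 1"; cases "y = 0") auto
    moreover have "\<bar>u \<tau> y\<bar> powr p \<le> M powr p"
      using M[of "(\<tau>, y)"] that p by (intro powr_mono2) auto
    ultimately have "norm y powr \<alpha> * \<bar>u \<tau> y\<bar> powr p \<le> (norm y powr \<alpha> * indicator (cball 0 1) y + 1) * M powr p"
      by (intro mult_mono) auto
    then show ?thesis using that by (simp add: mult.commute)
  qed
  have k1: "integrable lborel (\<lambda>t. indicator {0..b} t * M powr p)"
    using ab integrable_real_indicator[of "{0..b}" lborel] by simp
  have g1: "integrable lborel (\<lambda>y :: real ^ 'n. norm y powr \<alpha> * indicator (cball 0 1) y)"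
    by (rule integrable_norm_powr_unit_ball[OF \<alpha>(2,1)])
  note D1' = D1[OF k1 _ g1 _ _ b1, simplified]
  have Zm: "(\<lambda>(\<tau>, y). indicator {0..b} \<tau> * ?Z \<tau> y) \<in> borel_measurable (borel \<Otimes>\<^sub>M borel)"
    by measurable
  note D2 = duhamel_weak[OF \<phi> ab Zm, of "\<lambda>t. indicator {0..b} t * zeta \<sigma> m t" "\<lambda>y. \<bar>w y\<bar>" 0,
    unfolded drop]
  have b2: "\<bar>?Z \<tau> y\<bar> \<le> indicator {0..b} \<tau> * zeta \<sigma> m \<tau> * (\<bar>w y\<bar> + 0)" if "0 \<le> \<tau>" "\<tau> \<le> b" for \<tau> y
    using that by (simp add: abs_mult)
  have g2: "integrable lborel (\<lambda>y. \<bar>w y\<bar>)" using w(2) by simp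
  note D2' = D2[OF integrable_zeta[OF \<sigma> m] _ g2 _ _ b2, simplified]
  have "bounded (range u0)" and u0c: "continuous_on UNIV u0" using u0 by (auto simp: bcontfun_def)
  then obtain C where "\<And>x. \<bar>u0 x\<bar> \<le> C" unfolding bounded_iff by auto
  note D0 = heat_initial_weak[OF \<phi> ab(1) u0c this]
  let ?W1 = "\<lambda>t x. LINT \<tau>:{0..t}|lborel. heat_semigroup (t - \<tau>) (?N \<tau>) x"
  let ?W2 = "\<lambda>t x. LINT \<tau>:{0..t}|lborel. heat_semigroup (t - \<tau>) (?Z \<tau>) x"
  have eq: "(\<lambda>(t, x). u t x * (\<phi>t t x + L t x)) = (\<lambda>z. (case z of (t, x) \<Rightarrow> heat_semigroup t u0 x * (\<phi>t t x + L t x))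
     + (case z of (t, x) \<Rightarrow> ?W1 t x * (\<phi>t t x + L t x)) + (case z of (t, x) \<Rightarrow> ?W2 t x * (\<phi>t t x + L t x)))"
  proof
    fix z :: "real \<times> (real ^ 'n)"
    obtain t x where z: "z = (t, x)" by (cases z)
    show "(case z of (t, x) \<Rightarrow> u t x * (\<phi>t t x + L t x)) = (case z of (t, x) \<Rightarrow> heat_semigroup t u0 x * (\<phi>t t x + L t x))
     + (case z of (t, x) \<Rightarrow> ?W1 t x * (\<phi>t t x + L t x)) + (case z of (t, x) \<Rightarrow> ?W2 t x * (\<phi>t t x + L t x))"
    proof (cases "t \<ge> 0")
      case True
      then have "u t x = heat_semigroup t u0 x + ?W1 t x + ?W2 t x"
        using mild unfolding mild_solution_def by blast
      then show ?thesis unfolding z prod.case by (simp only: distrib_right)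
    next
      case False
      then show ?thesis using R[of t x] ab by (simp add: z)
    qed
  qed
  show "integrable lborel (\<lambda>(t, x). u t x * (\<phi>t t x + L t x))"
    unfolding eq by (intro Bochner_Integration.integrable_add D0(1) D1'(1) D2'(1))
  show "integrable lborel (\<lambda>(t, x). ?N t x * \<phi> t x)" "integrable lborel (\<lambda>(t, x). ?Z t x * \<phi> t x)"
    using D1'(2) D2'(2) by simp_all
  have "(LINT (t, x)|lborel. u t x * (\<phi>t t x + L t x)) =
    (LINT (t, x)|lborel. heat_semigroup t u0 x * (\<phi>t t x + L t x)) + (LINT (t, x)|lborel. ?W1 t x * (\<phi>t t x + L t x))
    + (LINT (t, x)|lborel. ?W2 t x * (\<phi>t t x + L t x))"
    unfolding eq using D0(1) D1'(1) D2'(1) by (simp add: Bochner_Integration.integral_add)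
  then show "(LINT (t, x)|lborel. u t x * (\<phi>t t x + L t x)) =
      - (LINT (t, x)|lborel. ?N t x * \<phi> t x) - (LINT (t, x)|lborel. ?Z t x * \<phi> t x)"
    using D0(2) D1'(3) D2'(3) by simp
qed

text \<open>Green's identity with \<open>V = u\<close> on an interval that contains the support of
  \<open>\<phi>\<close> in its interior and stays away from time 0: the boundary terms vanish, and
  the equation replaces \<open>ut - LV\<close> by the two source terms.\<close>

lemma classical_solution_weak:
  fixes u :: "real \<Rightarrow> real ^ 'n \<Rightarrow> real"
  assumes \<phi>: "test_function a b \<phi> \<phi>t L" and ab: "0 < a" "a \<le> b"
    and \<alpha>: "\<alpha> > 0" and p: "1 < p" and u: "classical_solution \<alpha> p \<sigma> m w u0 u"
  shows "integrable lborel (\<lambda>(t, x). u t x * (\<phi>t t x + L t x))"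
    and "integrable lborel (\<lambda>(t, x). norm x powr \<alpha> * \<bar>u t x\<bar> powr p * \<phi> t x)"
    and "integrable lborel (\<lambda>(t, x). zeta \<sigma> m t * w x * \<phi> t x)"
    and "(LINT (t, x)|lborel. u t x * (\<phi>t t x + L t x)) =
      - (LINT (t, x)|lborel. norm x powr \<alpha> * \<bar>u t x\<bar> powr p * \<phi> t x) - (LINT (t, x)|lborel. zeta \<sigma> m t * w x * \<phi> t x)"
proof -
  obtain R where R: "\<And>t x. t < a \<or> t > b \<or> norm x > R \<Longrightarrow> \<phi> t x = 0 \<and> \<phi>t t x = 0 \<and> L t x = 0"
    using \<phi> unfolding test_function_def by blast
  have C: "C12_on UNIV \<phi> \<phi>t L" using \<phi> by (simp add: test_function_def)
  have uc: "continuous_on ({0..} \<times> UNIV) (\<lambda>(t, x). u t x)"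
    using u by (simp add: classical_solution_def)
  obtain ut Du DDu where ut: "\<forall>t>0. \<forall>x. ((\<lambda>s. u s x) has_real_derivative ut t x) (at t)"
    and Du: "\<forall>j. \<forall>t>0. \<forall>x. ((\<lambda>h. u t (x + h *\<^sub>R axis j 1)) has_real_derivative Du j t x) (at 0)"
    and DDu: "\<forall>i j. \<forall>t>0. \<forall>x. ((\<lambda>h. Du j t (x + h *\<^sub>R axis i 1)) has_real_derivative DDu i j t x) (at 0)"
    and c: "continuous_on ({0<..} \<times> UNIV) (\<lambda>(t, x). ut t x)"
      "\<forall>i j. continuous_on ({0<..} \<times> UNIV) (\<lambda>(t, x). DDu i j t x)"
    and pde: "\<forall>t>0. \<forall>x. ut t x - (\<Sum>i\<in>UNIV. DDu i i t x) = norm x powr \<alpha> * \<bar>u t x\<bar> powr p + zeta \<sigma> m t * w x"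
    using u unfolding classical_solution_def by (elim conjE exE)
  define LV where "LV t x = (\<Sum>i\<in>UNIV. DDu i i t x)" for t x
  have V: "C12_on {0<..} u ut LV"
    unfolding C12_on_def
  proof (intro conjI exI)
    show "\<forall>t\<in>{0<..}. second_partials (u t) (\<lambda>j. Du j t) (\<lambda>j. (\<lambda>j. DDu j j) j t)"
      using Du DDu by (simp add: second_partials_def)
  qed (use ut c LV_def in \<open>auto intro: continuous_on_subset[OF uc]\<close>)
  let ?N = "\<lambda>t x. norm x powr \<alpha> * \<bar>u t x\<bar> powr p"
  let ?Z = "\<lambda>t x. zeta \<sigma> m t * w x"
  let ?P = "\<lambda>t x. \<phi>t t x + L t x"
  have drop: "(\<lambda>(t, x). indicator {a/2..b+1} t * f t x) = (\<lambda>(t, x). f t x)"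
    if "\<And>t x. t < a \<or> t > b \<Longrightarrow> f t x = 0" for f :: "real \<Rightarrow> real ^ 'n \<Rightarrow> real"
  proof -
    have "a / 2 \<le> t \<and> t \<le> b + 1" if "f t x \<noteq> 0" for t x
      using \<open>\<And>t x. t < a \<or> t > b \<Longrightarrow> f t x = 0\<close>[of t x] ab that by (cases "t < a"; cases "t > b") auto
    then show ?thesis by (auto simp: fun_eq_iff indicator_def)
  qed
  \<comment> \<open>The margins on both sides of \<open>{a..b}\<close> put the end times where
    \<open>\<phi>\<close> is zero by definition of a test function.\<close>
  have sub: "{a/2..b+1} \<subseteq> {0<..}" "a/2 \<le> b+1" using ab by auto
  have cu: "continuous_on ({a/2..b+1} \<times> UNIV) (\<lambda>(t, x). u t x)"
    by (rule continuous_on_subset[OF uc]) (use ab in auto)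
  have cP: "continuous_on ({a/2..b+1} \<times> UNIV) (\<lambda>(t, x). ?P t x)" "continuous_on ({a/2..b+1} \<times> UNIV) (\<lambda>(t, x). \<phi> t x)"
    using C12_onD(1,2)[OF C] C12_on_continuous_laplacian[OF C]
    by (auto simp: case_prod_unfold intro!: continuous_on_add intro: continuous_on_subset)
  have "integrable lborel (\<lambda>(t, x). indicator {a/2..b+1} t * (u t x * ?P t x))"
    using R cu cP(1) by (intro integrable_strip_compact_support[of _ _ _ R]) (auto simp: case_prod_unfold intro!: continuous_on_mult)
  then show 1: "integrable lborel (\<lambda>(t, x). u t x * ?P t x)"
    by (subst (asm) drop) (use R in auto)
  have cN: "continuous_on ({a/2..b+1} \<times> UNIV) (\<lambda>(t, x). ?N t x * \<phi> t x)"
    unfolding case_prod_unfold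
    using \<alpha> p by (intro continuous_on_mult continuous_on_powr' cu[unfolded case_prod_unfold] cP(2)[unfolded case_prod_unfold] continuous_intros) auto
  have "integrable lborel (\<lambda>(t, x). indicator {a/2..b+1} t * (?N t x * \<phi> t x))"
    using R cN by (intro integrable_strip_compact_support[of _ _ _ R]) auto
  then show 2: "integrable lborel (\<lambda>(t, x). ?N t x * \<phi> t x)"
    by (subst (asm) drop) (use R in auto)
  let ?G = "\<lambda>t x. (ut t x - LV t x) * \<phi> t x + u t x * ?P t x"
  note G = C12_on_green[OF V sub \<phi>]
  have G0: "(\<lambda>(t, x). indicator {a/2..b+1} t * ?G t x) = (\<lambda>(t, x). ?G t x)"
    by (rule drop) (use R in auto)
  have Geq: "(\<lambda>(t, x). ?G t x) = (\<lambda>z. (case z of (t, x) \<Rightarrow> ?N t x * \<phi> t x) + (case z of (t, x) \<Rightarrow> ?Z t x * \<phi> t x) + (case z of (t, x) \<Rightarrow> u t x * ?P t x))"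
  proof
    fix z :: "real \<times> (real ^ 'n)"
    obtain t x where z: "z = (t, x)" by (cases z)
    show "(case z of (t, x) \<Rightarrow> ?G t x) = (case z of (t, x) \<Rightarrow> ?N t x * \<phi> t x) + (case z of (t, x) \<Rightarrow> ?Z t x * \<phi> t x) + (case z of (t, x) \<Rightarrow> u t x * ?P t x)"
    proof (cases "t > 0")
      case True
      then have "ut t x - LV t x = ?N t x + ?Z t x" using pde by (simp add: LV_def)
      then show ?thesis unfolding z prod.case by (simp only: distrib_right)
    next
      case False
      then show ?thesis using R[of t x] ab by (simp add: z)
    qed
  qed
  have iG: "integrable lborel (\<lambda>(t, x). ?G t x)" using G(1) unfolding G0 .
  \<comment> \<open>The integrability of the forcing term is read off from the equation, which
    presents it as a combination of three integrable functions.\<close>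
  have "(\<lambda>(t, x). ?Z t x * \<phi> t x) = (\<lambda>z. (case z of (t, x) \<Rightarrow> ?G t x) - (case z of (t, x) \<Rightarrow> ?N t x * \<phi> t x) - (case z of (t, x) \<Rightarrow> u t x * ?P t x))"
    using fun_cong[OF Geq] by (auto simp: fun_eq_iff)
  then show 3: "integrable lborel (\<lambda>(t, x). ?Z t x * \<phi> t x)"
    by (simp only:) (intro Bochner_Integration.integrable_diff iG 1 2)
  have "(LINT (t, x)|lborel. ?G t x) = 0"
    using G(2) unfolding G0 using R[of "a/2"] R[of "b+1"] ab by simp
  then show "(LINT (t, x)|lborel. u t x * ?P t x) = - (LINT (t, x)|lborel. ?N t x * \<phi> t x) - (LINT (t, x)|lborel. ?Z t x * \<phi> t x)"
    unfolding Geq using 1 2 3 by (simp add: Bochner_Integration.integral_add)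
qed

section \<open>The test function\<close>

text \<open>Profiles are functions of \<open>r = (norm x)\<^sup>2\<close> rather than of
  \<open>norm x\<close>, which keeps them regular at the origin. In this variable the Laplacian of
  \<open>F r\<close> is \<open>2 * N * F' + 4 * r * F''\<close>.\<close>

lemma C12_on_radial_sum:
  fixes T T' F F1 F2 :: "nat \<Rightarrow> real \<Rightarrow> real"
  assumes T: "\<And>k t. k \<le> K \<Longrightarrow> (T k has_real_derivative T' k t) (at t)" "\<And>k. k \<le> K \<Longrightarrow> continuous_on UNIV (T' k)"
    and F: "\<And>k r. k \<le> K \<Longrightarrow> (F k has_real_derivative F1 k r) (at r)"
      "\<And>k r. k \<le> K \<Longrightarrow> (F1 k has_real_derivative F2 k r) (at r)" "\<And>k. k \<le> K \<Longrightarrow> continuous_on UNIV (F2 k)"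
  shows "C12_on UNIV (\<lambda>t (x :: real ^ 'n). \<Sum>k\<le>K. T k t * F k ((norm x)\<^sup>2))
     (\<lambda>t x. \<Sum>k\<le>K. T' k t * F k ((norm x)\<^sup>2))
     (\<lambda>t x. \<Sum>k\<le>K. T k t * (2 * real CARD('n) * F1 k ((norm x)\<^sup>2) + 4 * (norm x)\<^sup>2 * F2 k ((norm x)\<^sup>2)))"
proof -
  have cT: "continuous_on UNIV (T k)" if "k \<le> K" for k
    using T(1)[OF that] by (intro continuous_at_imp_continuous_on ballI) (blast intro: DERIV_isCont)
  have cF: "continuous_on UNIV (F k)" "continuous_on UNIV (F1 k)" if "k \<le> K" for k
    using F(1,2)[OF that] by (intro continuous_at_imp_continuous_on ballI; blast intro: DERIV_isCont)+
  have c1: "continuous_on A (\<lambda>z. G (fst z))" if "continuous_on UNIV G" for G :: "real \<Rightarrow> real" and A :: "(real \<times> (real ^ 'n)) set"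
    by (rule continuous_on_compose2[OF that]) (auto intro!: continuous_intros)
  have c2: "continuous_on A (\<lambda>z. G ((norm (snd z))\<^sup>2))" if "continuous_on UNIV G" for G :: "real \<Rightarrow> real" and A :: "(real \<times> (real ^ 'n)) set"
    by (rule continuous_on_compose2[OF that]) (auto intro!: continuous_intros)
  let ?D = "\<lambda>j t (x :: real ^ 'n). \<Sum>k\<le>K. T k t * (F1 k ((norm x)\<^sup>2) * (2 * x $ j))"
  let ?DD = "\<lambda>j t (x :: real ^ 'n). \<Sum>k\<le>K. T k t * (F2 k ((norm x)\<^sup>2) * (2 * x $ j)\<^sup>2 + F1 k ((norm x)\<^sup>2) * 2)"
  have dq: "((\<lambda>h. (norm (x + h *\<^sub>R axis j 1))\<^sup>2) has_real_derivative 2 * x $ j) (at 0)" for x :: "real ^ 'n" and j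
    unfolding norm_add_axis_square by (auto intro!: derivative_eq_intros)
  have dG: "((\<lambda>h. G ((norm (x + h *\<^sub>R axis j 1))\<^sup>2)) has_real_derivative G1 ((norm x)\<^sup>2) * (2 * x $ j)) (at 0)"
    if "\<And>r. (G has_real_derivative G1 r) (at r)" for G G1 and x :: "real ^ 'n" and j
    using DERIV_chain2[OF that dq[of x j]] by simp
  have dx: "((\<lambda>h. 2 * (x + h *\<^sub>R axis j 1) $ j) has_real_derivative 2) (at 0)" for x :: "real ^ 'n" and j
    by (auto intro!: derivative_eq_intros)
  show ?thesis
    unfolding C12_on_def
  proof (intro conjI exI ballI allI)
    show "((\<lambda>s. \<Sum>k\<le>K. T k s * F k ((norm x)\<^sup>2)) has_real_derivative (\<Sum>k\<le>K. T' k t * F k ((norm x)\<^sup>2))) (at t)" for t and x :: "real ^ 'n"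
      by (intro DERIV_sum DERIV_cmult_right T) auto
    show "continuous_on (UNIV \<times> UNIV) (\<lambda>(t, x :: real ^ 'n). \<Sum>k\<le>K. T k t * F k ((norm x)\<^sup>2))"
      "continuous_on (UNIV \<times> UNIV) (\<lambda>(t, x :: real ^ 'n). \<Sum>k\<le>K. T' k t * F k ((norm x)\<^sup>2))"
      "continuous_on (UNIV \<times> UNIV) (\<lambda>(t, x). ?DD j t x)" for j
      unfolding case_prod_unfold
      by (intro continuous_on_sum continuous_on_mult continuous_on_add c1 c2 cT T cF F continuous_intros; simp)+
    show "second_partials (\<lambda>x. \<Sum>k\<le>K. T k t * F k ((norm x)\<^sup>2)) (\<lambda>j. ?D j t) (\<lambda>j. ?DD j t)" for t
      unfolding second_partials_def
    proof (intro allI conjI)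
      show "((\<lambda>h. \<Sum>k\<le>K. T k t * F k ((norm (x + h *\<^sub>R axis j 1))\<^sup>2)) has_real_derivative ?D j t x) (at 0)" for x :: "real ^ 'n" and j
        by (intro DERIV_sum DERIV_cmult dG F) auto
      show "((\<lambda>h. ?D j t (x + h *\<^sub>R axis j 1)) has_real_derivative ?DD j t x) (at 0)" for x :: "real ^ 'n" and j
      proof (intro DERIV_sum DERIV_cmult)
        fix k assume "k \<in> {..K}"
        then have "(F1 k has_real_derivative F2 k r) (at r)" for r by (simp add: F)
        from DERIV_mult[OF dG[OF this, of x j] dx[of x j]]
        show "((\<lambda>h. F1 k ((norm (x + h *\<^sub>R axis j 1))\<^sup>2) * (2 * (x + h *\<^sub>R axis j 1) $ j)) has_real_derivative
           F2 k ((norm x)\<^sup>2) * (2 * x $ j)\<^sup>2 + F1 k ((norm x)\<^sup>2) * 2) (at 0)"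
          by (rule DERIV_cong) (simp add: power2_eq_square)
      qed
    qed
    show "(\<Sum>k\<le>K. T k t * (2 * real CARD('n) * F1 k ((norm x)\<^sup>2) + 4 * (norm x)\<^sup>2 * F2 k ((norm x)\<^sup>2)))
       = (\<Sum>j\<in>UNIV. ?DD j t x)" for t and x :: "real ^ 'n"
    proof -
      have *: "(\<Sum>j\<in>UNIV. T k t * (F2 k ((norm x)\<^sup>2) * (2 * x $ j)\<^sup>2 + F1 k ((norm x)\<^sup>2) * 2))
        = T k t * (2 * real CARD('n) * F1 k ((norm x)\<^sup>2) + 4 * (norm x)\<^sup>2 * F2 k ((norm x)\<^sup>2))" for k
      proof -
        have "(\<Sum>j\<in>UNIV. F2 k ((norm x)\<^sup>2) * (2 * x $ j)\<^sup>2 + F1 k ((norm x)\<^sup>2) * 2)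
          = F2 k ((norm x)\<^sup>2) * (4 * (\<Sum>j\<in>UNIV. (x $ j)\<^sup>2)) + real CARD('n) * (F1 k ((norm x)\<^sup>2) * 2)"
          by (simp add: sum.distrib sum_distrib_left power_mult_distrib)
        then show ?thesis by (simp add: sum_distrib_left[symmetric] norm_square_eq_sum[symmetric] mult_ac)
      qed
      have "(\<Sum>j\<in>UNIV. ?DD j t x) = (\<Sum>k\<le>K. \<Sum>j\<in>UNIV. T k t * (F2 k ((norm x)\<^sup>2) * (2 * x $ j)\<^sup>2 + F1 k ((norm x)\<^sup>2) * 2))"
        by (rule sum.swap)
      also have "\<dots> = (\<Sum>k\<le>K. T k t * (2 * real CARD('n) * F1 k ((norm x)\<^sup>2) + 4 * (norm x)\<^sup>2 * F2 k ((norm x)\<^sup>2)))"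
        by (intro sum.cong refl *)
      finally show ?thesis by simp
    qed
  qed
qed

text \<open>Powers of positive parts serve as cut-offs in time and in space. The exponent 2 is the
  least one that is differentiable at the gluing point, and each differentiation costs one
  power.\<close>

lemma DERIV_max_0_power:
  assumes "n \<ge> 2"
  shows "((\<lambda>x. max 0 x ^ n) has_real_derivative real n * max 0 x ^ (n - 1)) (at x)"
proof -
  consider "x > 0" | "x < 0" | "x = 0" by linarith
  then show ?thesis
  proof cases
    case 1
    then have "((\<lambda>x. x ^ n) has_real_derivative real n * max 0 x ^ (n - 1)) (at x)"
      by (auto intro!: derivative_eq_intros)
    then show ?thesis
      by (rule has_field_derivative_transform_within_open[where S = "{0<..}"]) (use 1 in auto)
  next
    case 2
    have "((\<lambda>x. 0) has_real_derivative real n * max 0 x ^ (n - 1)) (at x)"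
      using 2 assms by (simp add: power_0_left)
    then show ?thesis
      by (rule has_field_derivative_transform_within_open[where S = "{..<0}"]) (use 2 assms in auto)
  next
    case 3
    have "((\<lambda>h. max 0 h ^ n / h) \<longlongrightarrow> 0) (at (0 :: real))"
    proof (rule tendsto_0_le[where f = "\<lambda>h. h" and K = 1])
      have "norm (max 0 h ^ n / h) \<le> norm h * 1" if "h \<noteq> 0" "\<bar>h\<bar> < 1" for h :: real
      proof (cases "h > 0")
        case True
        have "h ^ n \<le> h ^ 2" using that True assms by (intro power_decreasing) auto
        then show ?thesis using True by (simp add: power2_eq_square divide_le_eq)
      qed (use that assms in \<open>auto simp: power_0_left\<close>)
      moreover have "\<forall>\<^sub>F h in at (0 :: real). h \<noteq> 0 \<and> \<bar>h\<bar> < 1"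
        by (auto simp: eventually_at intro!: exI[of _ 1])
      ultimately show "\<forall>\<^sub>F h in at 0. norm (max 0 h ^ n / h) \<le> norm (h :: real) * 1"
        by (auto elim: eventually_mono)
    qed (rule tendsto_ident_at)
    then show ?thesis using 3 assms by (simp add: DERIV_def power_0_left)
  qed
qed

text \<open>\<open>taylor_poly a k\<close> is the polynomial \<open>h\<close> such that the \<open>k\<close>-th derivative of
  \<open>(t (1 - t)) ^ a\<close> is \<open>(t (1 - t)) ^ (a - k) * h t\<close>.\<close>

fun taylor_poly :: "nat \<Rightarrow> nat \<Rightarrow> real poly" where
  "taylor_poly a 0 = 1"
| "taylor_poly a (Suc k) = smult (real a - real k) ([:1, -2:] * taylor_poly a k) + [:0, 1, -1:] * pderiv (taylor_poly a k)"

lemma DERIV_taylor_poly: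
  assumes "k + 2 \<le> a"
  shows "((\<lambda>t. max 0 (t * (1 - t)) ^ (a - k) * poly (taylor_poly a k) t) has_real_derivative
     max 0 (t * (1 - t)) ^ (a - Suc k) * poly (taylor_poly a (Suc k)) t) (at t)"
proof -
  let ?m = "max 0 (t * (1 - t))"
  have "((\<lambda>t. t * (1 - t)) has_real_derivative 1 - 2 * t) (at t)"
    by (auto intro!: derivative_eq_intros)
  from DERIV_mult[OF DERIV_chain2[OF DERIV_max_0_power this, of "a - k"] poly_DERIV[of "taylor_poly a k" t]]
  have d: "((\<lambda>t. max 0 (t * (1 - t)) ^ (a - k) * poly (taylor_poly a k) t) has_real_derivative
    real (a - k) * ?m ^ (a - k - 1) * (1 - 2 * t) * poly (taylor_poly a k) t + poly (pderiv (taylor_poly a k)) t * ?m ^ (a - k)) (at t)"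
    using assms by simp
  \<comment> \<open>One factor of the positive part may be replaced by \<open>t * (1 - t)\<close>
    itself: the remaining exponent \<open>a - Suc k\<close> is at least 1, so that power vanishes
    wherever the two differ.\<close>
  have e: "?m ^ (a - k) = ?m ^ (a - Suc k) * (t * (1 - t))"
  proof -
    have "a - k = Suc (a - Suc k)" using assms by auto
    then have "?m ^ (a - k) = ?m ^ (a - Suc k) * ?m" by simp
    also have "\<dots> = ?m ^ (a - Suc k) * (t * (1 - t))"
      using assms by (cases "t * (1 - t) > 0") (auto simp: max_def)
    finally show ?thesis .
  qed
  have f: "real (a - k) = real a - real k" using assms by simp
  show ?thesis
    by (rule DERIV_cong[OF d], unfold e f) (simp add: algebra_simps)
qed

text \<open>Intermediate powers are absorbed by a small constant and a large multiple of the top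
  power: for \<open>s \<le> \<epsilon>\<close> the first summand suffices, for
  \<open>s > \<epsilon>\<close> the second. In the construction of the test function this limits the
  loss in the leading coefficient.\<close>

lemma power_le_eps_add:
  fixes s \<epsilon> :: real
  assumes "0 \<le> s" "0 < \<epsilon>" "\<epsilon> \<le> 1" "1 \<le> k" "k \<le> K"
  shows "s ^ k \<le> \<epsilon> + s ^ K / \<epsilon> ^ K"
proof (cases "s \<le> \<epsilon>")
  case True
  have "s ^ k \<le> s ^ 1" using assms True by (intro power_decreasing) auto
  moreover have "0 \<le> s ^ K / \<epsilon> ^ K" using assms by simp
  ultimately show ?thesis using True by simp
next
  case False
  have "s ^ k * \<epsilon> ^ K \<le> s ^ k * \<epsilon> ^ (K - k)"
    using assms by (intro mult_left_mono power_decreasing) auto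
  also have "\<dots> \<le> s ^ k * s ^ (K - k)"
    using assms False by (intro mult_left_mono power_mono) auto
  also have "\<dots> = s ^ K" using assms by (simp flip: power_add)
  finally have "s ^ k \<le> s ^ K / \<epsilon> ^ K" using assms by (simp add: pos_le_divide_eq)
  then show ?thesis using assms by linarith
qed

text \<open>Two facts are combined: \<open>\<phi>\<close> is at least
  \<open>\<rho> ^ a * X ^ b / 2\<close>, and the operator is
  \<open>r ^ (K - 1) * \<rho> ^ (a - K - 1) * X ^ (b - 2)\<close> times a function that is bounded
  on the support. The asserted inequality then holds factor by factor.\<close>

lemma base_test_function:
  fixes \<alpha> p :: real
  assumes p: "1 < p"
  obtains \<phi> \<phi>t L :: "real \<Rightarrow> real ^ 'n \<Rightarrow> real" and C
  where "test_function 0 1 \<phi> \<phi>t L" "0 \<le> C" "\<And>t x. 0 \<le> \<phi> t x" "\<And>t. 0 < t \<Longrightarrow> t < 1 \<Longrightarrow> 0 < \<phi> t 0"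
    "\<And>t x. x \<noteq> 0 \<Longrightarrow> \<bar>\<phi>t t x + L t x\<bar> \<le> C * norm x powr (\<alpha> / p) * \<phi> t x powr (1 / p)"
proof -
  define N where "N = real CARD('n)"
  have N: "N \<ge> 1" by (simp add: N_def Suc_le_eq)
  have q: "0 < 1 - 1 / p" using p by (simp add: field_simps)
  \<comment> \<open>Each exponent pays for one factor of the final estimate, with bases between 0
    and 1: \<open>K\<close> gives \<open>r ^ (K - 1) \<le> norm x powr (\<alpha> / p)\<close>, while
    \<open>b\<close> and \<open>a\<close> make \<open>X ^ (b - 2)\<close> and
    \<open>\<rho> ^ (a - K - 1)\<close> at most the powers \<open>1 / p\<close> of
    \<open>X ^ b\<close> and \<open>\<rho> ^ a\<close>.\<close>
  obtain K :: nat where K: "2 \<le> K" "\<alpha> / p \<le> 2 * (real K - 1)"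
  proof -
    obtain n :: nat where "\<alpha> / p / 2 < real n" using reals_Archimedean2 by blast
    then show thesis by (intro that[of "n + 2"]) auto
  qed
  obtain b :: nat where b: "4 \<le> b" "real b / p \<le> real b - 2"
  proof -
    obtain n :: nat where "2 / (1 - 1 / p) < real n" using reals_Archimedean2 by blast
    then have "2 < real n * (1 - 1 / p)" using q by (simp add: pos_divide_less_eq)
    also have "\<dots> \<le> real (n + 4) * (1 - 1 / p)" using q by (intro mult_right_mono) auto
    finally show thesis by (intro that[of "n + 4"]) (auto simp: algebra_simps add_divide_distrib)
  qed
  obtain a :: nat where a: "K + 3 \<le> a" "real a / p \<le> real (a - K - 1)"
  proof -
    obtain n :: nat where "real (K + 1) / (1 - 1 / p) < real n" using reals_Archimedean2 by blast
    then have "real (K + 1) < real n * (1 - 1 / p)" using q by (simp add: pos_divide_less_eq)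
    also have "\<dots> \<le> real (n + K + 3) * (1 - 1 / p)" using q by (intro mult_right_mono) auto
    finally show thesis by (intro that[of "n + K + 3"]) (auto simp: algebra_simps add_divide_distrib of_nat_diff)
  qed
  define h where "h k = poly (taylor_poly a k)" for k
  have h0: "h 0 t = 1" for t by (simp add: h_def)
  have hc: "continuous_on S (h k)" for S k
    unfolding h_def by (intro continuous_intros)
  define d where "d k = real k * (2 * N + 4 * (real k - 1))" for k
  define c where "c k = (\<Prod>i=1..k. d i)" for k
  have d1: "1 \<le> d k" if "1 \<le> k" for k
  proof -
    have "1 * 1 \<le> real k * (2 * N + 4 * (real k - 1))" using that N by (intro mult_mono) auto
    then show ?thesis by (simp add: d_def)
  qed
  have c1: "1 \<le> c k" for k unfolding c_def by (intro prod_ge_1) (auto intro: d1)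
  have cS: "c (Suc k) = c k * d (Suc k)" for k by (simp add: c_def mult.commute)
  define \<rho> where "\<rho> t = max 0 (t * (1 - t))" for t :: real
  have \<rho>0: "0 \<le> \<rho> t" for t by (simp add: \<rho>_def)
  have \<rho>c: "continuous_on S \<rho>" for S unfolding \<rho>_def by (intro continuous_intros)
  have \<rho>1: "\<rho> t \<le> 1" for t
  proof -
    have "t * (1 - t) = 1 / 4 - (t - 1 / 2)\<^sup>2" by (simp add: power2_eq_square algebra_simps)
    then have "t * (1 - t) \<le> 1" using zero_le_power2[of "t - 1 / 2"] by linarith
    then show ?thesis by (simp add: \<rho>_def)
  qed
  have \<rho>pos: "0 < \<rho> t \<longleftrightarrow> 0 < t \<and> t < 1" for t
    by (auto simp: \<rho>_def less_max_iff_disj zero_less_mult_iff)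
  have \<rho>z: "\<rho> t = 0" if "t < 0 \<or> t > 1" for t
    using \<rho>pos[of t] \<rho>0[of t] that by force
  obtain H where H: "0 \<le> H" "\<And>k t. k \<le> K \<Longrightarrow> 0 \<le> t \<Longrightarrow> t \<le> 1 \<Longrightarrow> \<bar>h k t\<bar> \<le> H"
  proof -
    have "bounded ((\<lambda>t. \<Sum>k\<le>K. \<bar>h k t\<bar>) ` {0..1})"
      by (intro compact_imp_bounded compact_continuous_image continuous_on_sum continuous_on_rabs hc) auto
    then obtain H where "\<And>t. t \<in> {0..1} \<Longrightarrow> norm (\<Sum>k\<le>K. \<bar>h k t\<bar>) \<le> H"
      unfolding bounded_iff by (metis imageI)
    then have "\<bar>h k t\<bar> \<le> max H 0" if "k \<le> K" "0 \<le> t" "t \<le> 1" for k t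
      using member_le_sum[of k "{..K}" "\<lambda>k. \<bar>h k t\<bar>"] that by (force simp: le_max_iff_disj)
    then show thesis by (intro that[of "max H 0"]) auto
  qed
  \<comment> \<open>There are fewer than \<open>K\<close> intermediate terms, with coefficients
    bounded by \<open>H\<close>; their part proportional to \<open>\<epsilon>\<close> may consume at
    most half of the leading coefficient \<open>h 0 = 1\<close>. The summand 1 in the denominator
    covers \<open>H = 0\<close> and keeps \<open>\<epsilon> \<le> 1\<close>.\<close>
  define \<epsilon> where "\<epsilon> = 1 / (2 * H * real K + 1)"
  have \<epsilon>: "0 < \<epsilon>" "\<epsilon> \<le> 1" "H * real K * \<epsilon> \<le> 1 / 2"
  proof -
    have HK: "0 \<le> H * real K" using H(1) by simp
    then have "0 < 2 * H * real K + 1" by linarith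
    then show "0 < \<epsilon>" "\<epsilon> \<le> 1" "H * real K * \<epsilon> \<le> 1 / 2"
      using HK by (simp_all add: \<epsilon>_def pos_divide_le_eq)
  qed
  \<comment> \<open>\<open>M\<close> covers what \<open>power_le_eps_add\<close> leaves in front of
    the top power, summed over the intermediate terms.\<close>
  define M where "M = H * real K / \<epsilon> ^ K"
  have M: "0 \<le> M" using H \<epsilon> by (simp add: M_def)
  \<comment> \<open>\<open>T k\<close> for \<open>k < K\<close> is the \<open>k\<close>-th coefficient of the backward heat expansion, since
    \<open>\<Delta> (r ^ k) = d k * r ^ (k - 1)\<close> for \<open>r = \<bar>x\<bar>\<^sup>2\<close>; the last term restores positivity.\<close>
  define T where "T k t = (if k < K then (-1) ^ k * (\<rho> t ^ (a - k) * h k t) / c k else M * \<rho> t ^ (a - K))" for k t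
  define T' where "T' k t = (if k < K then (-1) ^ k * (\<rho> t ^ (a - Suc k) * h (Suc k) t) / c k
     else M * (real (a - K) * \<rho> t ^ (a - K - 1) * (1 - 2 * t)))" for k t
  \<comment> \<open>The power \<open>r ^ K\<close> instead of \<open>r\<close> is essential: the
    first derivative of the cut-off carries \<open>r ^ (K - 1)\<close>, and so does \<open>r\<close>
    times the second, which is how these enter the Laplacian. The errors made by the cut-off thus
    vanish at the origin to the required order.\<close>
  define X where "X r = max 0 (1 - r ^ K)" for r :: real
  have Xc: "continuous_on S X" for S unfolding X_def by (intro continuous_intros)
  define Y1 where "Y1 r = - (real b * real K) * r ^ (K - 1) * X r ^ (b - 1)" for r
  define Y2 where "Y2 r = - (real b * real K * real (K - 1)) * r ^ (K - 2) * X r ^ (b - 1)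
     + real b * real (b - 1) * (real K)\<^sup>2 * (r ^ (K - 1) * r ^ (K - 1)) * X r ^ (b - 2)" for r
  define F where "F k r = r ^ k * X r ^ b" for k r
  \<comment> \<open>The truncated exponents \<open>k - 1\<close> and \<open>k - 1 - 1\<close> do no
    harm: whenever one of them is cut off at 0, the factor \<open>real k\<close> or
    \<open>real (k - 1)\<close> vanishes.\<close>
  define F1 where "F1 k r = real k * r ^ (k - 1) * X r ^ b + r ^ k * Y1 r" for k r
  define F2 where "F2 k r = real k * real (k - 1) * r ^ (k - 1 - 1) * X r ^ b + 2 * (real k * r ^ (k - 1) * Y1 r) + r ^ k * Y2 r" for k r
  have dT: "(T k has_real_derivative T' k t) (at t)" if "k \<le> K" for k t
  proof (cases "k < K")
    case True
    then have "k + 2 \<le> a" using a by simp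
    from DERIV_cdivide[OF DERIV_cmult[OF DERIV_taylor_poly[OF this]], of "(-1) ^ k" "c k" t]
    show ?thesis using True by (simp add: T_def[abs_def] T'_def h_def \<rho>_def[abs_def])
  next
    case False
    have "((\<lambda>t. t * (1 - t)) has_real_derivative 1 - 2 * t) (at t)"
      by (auto intro!: derivative_eq_intros)
    from DERIV_cmult[OF DERIV_chain2[OF DERIV_max_0_power this, of "a - K"], of M]
    have "((\<lambda>t. M * max 0 (t * (1 - t)) ^ (a - K)) has_real_derivative
      M * (real (a - K) * max 0 (t * (1 - t)) ^ (a - K - 1) * (1 - 2 * t))) (at t)" using a by simp
    then show ?thesis using False that by (simp add: T_def[abs_def] T'_def \<rho>_def[abs_def])
  qed
  have cT': "continuous_on UNIV (T' k)" for k
    unfolding T'_def[abs_def] by (cases "k < K") (use c1[of k] in \<open>auto intro!: continuous_intros \<rho>c hc\<close>)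
  have dX: "((\<lambda>r. X r ^ n) has_real_derivative real n * X r ^ (n - 1) * (- (real K * r ^ (K - 1)))) (at r)" if "2 \<le> n" for n r
  proof -
    have "((\<lambda>r. 1 - r ^ K) has_real_derivative - (real K * r ^ (K - 1))) (at r)"
      by (auto intro!: derivative_eq_intros)
    from DERIV_chain2[OF DERIV_max_0_power this, of n] that show ?thesis by (simp add: X_def[abs_def])
  qed
  have dp: "((\<lambda>r. r ^ n) has_real_derivative real n * r ^ (n - 1)) (at r)" for n and r :: real
    by (auto intro!: derivative_eq_intros)
  have dY1: "((\<lambda>r. X r ^ b) has_real_derivative Y1 r) (at r)" for r
    by (rule DERIV_cong[OF dX]) (use b in \<open>auto simp: Y1_def\<close>)
  have dY2: "(Y1 has_real_derivative Y2 r) (at r)" for r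
    unfolding Y1_def[abs_def]
    by (rule DERIV_cong[OF DERIV_mult[OF DERIV_cmult[OF dp] dX]])
      (use b in \<open>auto simp: Y2_def algebra_simps power2_eq_square numeral_2_eq_2\<close>)
  have dF: "(F k has_real_derivative F1 k r) (at r)" for k r
    unfolding F_def[abs_def] by (rule DERIV_cong[OF DERIV_mult[OF dp dY1]]) (simp add: F1_def mult.commute)
  have dF1: "(F1 k has_real_derivative F2 k r) (at r)" for k r
    unfolding F1_def[abs_def]
    by (rule DERIV_cong[OF DERIV_add[OF DERIV_mult[OF DERIV_cmult[OF dp] dY1] DERIV_mult[OF dp dY2]]])
      (simp add: F2_def algebra_simps)
  have cF2: "continuous_on UNIV (F2 k)" for k
    unfolding F2_def[abs_def] Y1_def Y2_def by (intro continuous_intros Xc)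
  define \<phi> where "\<phi> t x = (\<Sum>k\<le>K. T k t * F k ((norm (x :: real ^ 'n))\<^sup>2))" for t x
  define \<phi>t where "\<phi>t t x = (\<Sum>k\<le>K. T' k t * F k ((norm (x :: real ^ 'n))\<^sup>2))" for t x
  define L where "L t x = (\<Sum>k\<le>K. T k t * (2 * N * F1 k ((norm (x :: real ^ 'n))\<^sup>2) + 4 * (norm x)\<^sup>2 * F2 k ((norm x)\<^sup>2)))" for t x
  have C12: "C12_on UNIV \<phi> \<phi>t L"
    unfolding \<phi>_def[abs_def] \<phi>t_def[abs_def] L_def[abs_def] N_def
    by (intro C12_on_radial_sum dT cT' dF dF1 cF2)
  have Tz: "T k t = 0" "T' k t = 0" if "\<rho> t = 0" "k \<le> K" for k t
    using that a by (auto simp: T_def T'_def power_0_left)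
  have Fz: "F k r = 0" "F1 k r = 0" "F2 k r = 0" if "X r = 0" for k r
    using that b by (auto simp: F_def F1_def F2_def Y1_def Y2_def power_0_left)
  have Xz: "X ((norm x)\<^sup>2) = 0" if "norm x > 1" for x :: "real ^ 'n"
    using one_le_power[of "(norm x)\<^sup>2" K] one_le_power[of "norm x" 2] that by (simp add: X_def)
  have zero: "\<phi> t x = 0 \<and> \<phi>t t x = 0 \<and> L t x = 0" if "\<rho> t = 0 \<or> X ((norm x)\<^sup>2) = 0" for t and x :: "real ^ 'n"
    using that Tz[of t] Fz[of "(norm x)\<^sup>2"] by (auto simp: \<phi>_def \<phi>t_def L_def)
  have test: "test_function 0 1 \<phi> \<phi>t L"
    unfolding test_function_def
  proof (intro conjI C12 exI[of _ 1] allI impI)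
    fix t :: real and x :: "real ^ 'n" assume "t < 0 \<or> t > 1 \<or> norm x > 1"
    then have "\<rho> t = 0 \<or> X ((norm x)\<^sup>2) = 0" using \<rho>z Xz by blast
    from zero[OF this] show "\<phi> t x = 0" "\<phi>t t x = 0" "L t x = 0" by auto
  qed
  have lower: "\<rho> t ^ a * X ((norm x)\<^sup>2) ^ b / 2 \<le> \<phi> t x" for t and x :: "real ^ 'n"
  proof (cases "\<rho> t = 0")
    case True
    then show ?thesis using zero[of t x] a by (simp add: power_0_left)
  next
    case False
    define r where "r = (norm x)\<^sup>2"
    have \<rho>: "0 < \<rho> t" using False \<rho>0[of t] by simp
    have t: "0 \<le> t" "t \<le> 1" using \<rho> \<rho>pos by auto
    \<comment> \<open>The parabolic similarity variable. In terms of \<open>s\<close> every summand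
      is \<open>\<rho> t ^ a\<close> times a bounded coefficient and a power of \<open>s\<close>, so
      positivity no longer depends on how small \<open>\<rho> t\<close> is.\<close>
    define s where "s = r / \<rho> t"
    have s: "0 \<le> s" using \<rho> by (simp add: s_def r_def)
    have e: "T k t * r ^ k = \<rho> t ^ a * ((-1) ^ k * h k t / c k * s ^ k)" if "k < K" for k
    proof -
      have "\<rho> t ^ a = \<rho> t ^ (a - k) * \<rho> t ^ k" using that a by (simp flip: power_add)
      then show ?thesis using that \<rho> by (simp add: T_def s_def power_divide)
    qed
    have eK: "T K t * r ^ K = \<rho> t ^ a * (M * s ^ K)"
    proof -
      have "\<rho> t ^ a = \<rho> t ^ (a - K) * \<rho> t ^ K" using a by (simp flip: power_add)
      then show ?thesis using \<rho> by (simp add: T_def s_def power_divide)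
    qed
    have "- (H * real K * (\<epsilon> + s ^ K / \<epsilon> ^ K)) \<le> (\<Sum>k\<in>{1..<K}. (-1) ^ k * h k t / c k * s ^ k)"
    proof -
      have "- (H * (\<epsilon> + s ^ K / \<epsilon> ^ K)) \<le> (-1) ^ k * h k t / c k * s ^ k" if k: "k \<in> {1..<K}" for k
      proof -
        have "\<bar>(-1) ^ k * h k t / c k * s ^ k\<bar> = \<bar>h k t\<bar> / c k * s ^ k"
          using c1[of k] s by (simp add: abs_mult power_abs)
        also have "\<dots> \<le> H / 1 * (\<epsilon> + s ^ K / \<epsilon> ^ K)"
          using k t s \<epsilon> H c1[of k] by (intro mult_mono frac_le power_le_eps_add) (auto intro!: add_nonneg_nonneg)
        finally have "\<bar>(-1) ^ k * h k t / c k * s ^ k\<bar> \<le> H / 1 * (\<epsilon> + s ^ K / \<epsilon> ^ K)" .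
        from abs_le_D2[OF this] show ?thesis unfolding div_by_1 by linarith
      qed
      then have "(\<Sum>k\<in>{1..<K}. - (H * (\<epsilon> + s ^ K / \<epsilon> ^ K))) \<le> (\<Sum>k\<in>{1..<K}. (-1) ^ k * h k t / c k * s ^ k)"
        by (rule sum_mono)
      moreover have "real (K - 1) * (H * (\<epsilon> + s ^ K / \<epsilon> ^ K)) \<le> real K * (H * (\<epsilon> + s ^ K / \<epsilon> ^ K))"
        using H \<epsilon> s by (intro mult_right_mono) auto
      ultimately show ?thesis by (simp add: mult_ac)
    qed
    moreover have "H * real K * (\<epsilon> + s ^ K / \<epsilon> ^ K) \<le> 1 / 2 + M * s ^ K"
      using \<epsilon> by (simp add: M_def distrib_left)
    ultimately have "1 / 2 \<le> 1 + (\<Sum>k\<in>{1..<K}. (-1) ^ k * h k t / c k * s ^ k) + M * s ^ K" by linarith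
    also have "\<dots> = (\<Sum>k<K. (-1) ^ k * h k t / c k * s ^ k) + M * s ^ K"
    proof -
      have "{..<K} = insert 0 {1..<K}" using K by auto
      then show ?thesis by (simp add: h0 c_def)
    qed
    finally have "\<rho> t ^ a * (1 / 2) \<le> \<rho> t ^ a * ((\<Sum>k<K. (-1) ^ k * h k t / c k * s ^ k) + M * s ^ K)"
      using \<rho> by (intro mult_left_mono) auto
    also have "\<dots> = (\<Sum>k<K. T k t * r ^ k) + T K t * r ^ K"
      by (simp add: distrib_left eK e sum_distrib_left)
    also have "\<dots> = (\<Sum>k\<le>K. T k t * r ^ k)"
      by (simp add: lessThan_Suc_atMost[symmetric])
    finally have "\<rho> t ^ a * (1 / 2) * X r ^ b \<le> (\<Sum>k\<le>K. T k t * r ^ k) * X r ^ b"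
      by (rule mult_right_mono) (simp add: X_def)
    then show ?thesis by (simp add: \<phi>_def F_def r_def sum_distrib_right mult.assoc)
  qed
  \<comment> \<open>\<open>\<tau>\<close>, \<open>e\<close> and \<open>E\<close> are what remains of
    the coefficients \<open>T\<close>, of the derivatives of \<open>X ^ b\<close> and of the whole
    operator once the common powers of \<open>\<rho>\<close>, \<open>X\<close> and \<open>r\<close>
    are taken out. All that matters about \<open>E\<close> is its continuity on the unit
    square.\<close>
  define \<tau> where "\<tau> k t = (if k < K then (-1) ^ k * (\<rho> t ^ (Suc K - k) * h k t) / c k else M * \<rho> t)" for k t
  define e where "e k r = - ((2 * N + 8 * real k) * real b * real K * X r) - 4 * real b * real K * real (K - 1) * X r
     + 4 * real b * real (b - 1) * (real K)\<^sup>2 * r ^ K" for k r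
  define E where "E t r = (X r)\<^sup>2 * ((-1) ^ (K - 1) * (\<rho> t * h K t) / c (K - 1) + M * (real (a - K) * (1 - 2 * t)) * r + M * \<rho> t * d K)
     + (\<Sum>k\<le>K. \<tau> k t * r ^ k * e k r)" for t r
  \<comment> \<open>The coefficients telescope, which leaves only terms with the factor \<open>r ^ (K - 1)\<close>.\<close>
  have op: "\<phi>t t x + L t x = r ^ (K - 1) * \<rho> t ^ (a - K - 1) * X r ^ (b - 2) * E t r" if "r = (norm x)\<^sup>2" for t r and x :: "real ^ 'n"
  proof -
    have Xb: "X r ^ b = X r ^ (b - 2) * (X r)\<^sup>2" "X r ^ (b - 1) = X r ^ (b - 2) * X r"
    proof -
      have "b - 2 + 2 = b" "Suc (b - 2) = b - 1" using b by simp_all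
      then show "X r ^ b = X r ^ (b - 2) * (X r)\<^sup>2" "X r ^ (b - 1) = X r ^ (b - 2) * X r"
        by (metis power_add, metis power_Suc2)
    qed
    have rK: "r * r ^ (K - 2) = r ^ (K - 1)" "r * r ^ (K - 1) = r ^ K"
    proof -
      have e: "Suc (K - 2) = K - 1" "Suc (K - 1) = K" using K by simp_all
      have "r * r ^ (K - 2) = r ^ Suc (K - 2)" "r * r ^ (K - 1) = r ^ Suc (K - 1)"
        by (simp_all only: power_Suc)
      then show "r * r ^ (K - 2) = r ^ (K - 1)" "r * r ^ (K - 1) = r ^ K"
        by (simp_all only: e)
    qed
    have lapF: "2 * N * F1 k r + 4 * r * F2 k r = X r ^ b * (d k * r ^ (k - 1)) + r ^ k * (r ^ (K - 1) * X r ^ (b - 2) * e k r)" for k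
    proof -
      have 1: "r * (real k * r ^ (k - 1)) = real k * r ^ k" "r * (real k * real (k - 1) * r ^ (k - 1 - 1)) = real k * (real k - 1) * r ^ (k - 1)"
      proof -
        show "r * (real k * r ^ (k - 1)) = real k * r ^ k" by (cases k) simp_all
        show "r * (real k * real (k - 1) * r ^ (k - 1 - 1)) = real k * (real k - 1) * r ^ (k - 1)"
        proof (cases k)
          case (Suc i)
          then show ?thesis by (cases i) simp_all
        qed simp
      qed
      have 2: "(2 * N + 8 * real k) * Y1 r + 4 * (r * Y2 r) = r ^ (K - 1) * X r ^ (b - 2) * e k r"
      proof -
        have "r * Y2 r = - (real b * real K * real (K - 1)) * (r * r ^ (K - 2)) * X r ^ (b - 1)
            + real b * real (b - 1) * (real K)\<^sup>2 * ((r * r ^ (K - 1)) * r ^ (K - 1)) * X r ^ (b - 2)"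
          by (simp add: Y2_def algebra_simps)
        then show ?thesis unfolding rK Xb Y1_def e_def by (simp add: algebra_simps)
      qed
      have "2 * N * F1 k r + 4 * r * F2 k r =
         2 * N * (real k * r ^ (k - 1) * X r ^ b) + 4 * (r * (real k * real (k - 1) * r ^ (k - 1 - 1))) * X r ^ b
         + 8 * (r * (real k * r ^ (k - 1))) * Y1 r + r ^ k * (2 * N * Y1 r + 4 * (r * Y2 r))"
        by (simp add: F1_def F2_def algebra_simps)
      also have "\<dots> = X r ^ b * (d k * r ^ (k - 1)) + r ^ k * ((2 * N + 8 * real k) * Y1 r + 4 * (r * Y2 r))"
        unfolding 1 d_def by (simp add: algebra_simps)
      finally show ?thesis unfolding 2 .
    qed
    have tel: "(\<Sum>k<Suc n. T' k t * r ^ k + T k t * (d k * r ^ (k - 1))) = T' n t * r ^ n" if "n < K" for n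
      using that
    proof (induction n)
      case 0
      then show ?case by (simp add: d_def)
    next
      case (Suc n)
      have "T (Suc n) t * d (Suc n) = - T' n t"
        using Suc.prems c1[of n] d1[of "Suc n"] by (simp add: T_def T'_def cS)
      then have "T (Suc n) t * (d (Suc n) * r ^ (Suc n - 1)) = - T' n t * r ^ n"
        by (simp add: mult.assoc[symmetric])
      with Suc show ?case by simp
    qed
    have \<rho>K: "\<rho> t ^ (a - K) = \<rho> t ^ (a - K - 1) * \<rho> t"
    proof -
      have "Suc (a - K - 1) = a - K" using a by simp
      then show ?thesis by (metis power_Suc2)
    qed
    have "(\<Sum>k\<le>K. T' k t * r ^ k + T k t * (d k * r ^ (k - 1))) =
      (\<Sum>k<K. T' k t * r ^ k + T k t * (d k * r ^ (k - 1))) + (T' K t * r ^ K + T K t * (d K * r ^ (K - 1)))"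
      by (simp add: lessThan_Suc_atMost[symmetric])
    also have "(\<Sum>k<K. T' k t * r ^ k + T k t * (d k * r ^ (k - 1))) = T' (K - 1) t * r ^ (K - 1)"
      using tel[of "K - 1"] K by simp
    also have "T' (K - 1) t * r ^ (K - 1) + (T' K t * r ^ K + T K t * (d K * r ^ (K - 1)))
      = r ^ (K - 1) * \<rho> t ^ (a - K - 1) * ((-1) ^ (K - 1) * (\<rho> t * h K t) / c (K - 1) + M * (real (a - K) * (1 - 2 * t)) * r + M * \<rho> t * d K)"
    proof -
      have "T' (K - 1) t = (-1) ^ (K - 1) * (\<rho> t ^ (a - K) * h K t) / c (K - 1)"
        using K by (simp add: T'_def)
      then show ?thesis unfolding rK(2)[symmetric] by (simp add: T'_def T_def \<rho>K algebra_simps)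
    qed
    finally have A: "(\<Sum>k\<le>K. T' k t * r ^ k + T k t * (d k * r ^ (k - 1))) = \<dots>" .
    have T\<tau>: "T k t = \<rho> t ^ (a - K - 1) * \<tau> k t" if "k \<le> K" for k
    proof (cases "k < K")
      case True
      then have "\<rho> t ^ (a - k) = \<rho> t ^ (a - K - 1) * \<rho> t ^ (Suc K - k)" using a by (simp flip: power_add)
      then show ?thesis using True by (simp add: T_def \<tau>_def)
    qed (use that \<rho>K in \<open>simp add: T_def \<tau>_def\<close>)
    have "\<phi>t t x + L t x = (\<Sum>k\<le>K. T' k t * F k r + T k t * (2 * N * F1 k r + 4 * r * F2 k r))"
      by (simp add: \<phi>t_def L_def that sum.distrib)
    also have "\<dots> = (\<Sum>k\<le>K. X r ^ b * (T' k t * r ^ k + T k t * (d k * r ^ (k - 1))) + r ^ (K - 1) * X r ^ (b - 2) * (T k t * r ^ k * e k r))"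
      unfolding lapF F_def by (intro sum.cong refl) (simp add: algebra_simps)
    also have "\<dots> = X r ^ b * (\<Sum>k\<le>K. T' k t * r ^ k + T k t * (d k * r ^ (k - 1))) + r ^ (K - 1) * X r ^ (b - 2) * (\<Sum>k\<le>K. T k t * r ^ k * e k r)"
      by (subst sum.distrib) (simp only: sum_distrib_left)
    also have "(\<Sum>k\<le>K. T k t * r ^ k * e k r) = \<rho> t ^ (a - K - 1) * (\<Sum>k\<le>K. \<tau> k t * r ^ k * e k r)"
      unfolding sum_distrib_left by (intro sum.cong refl) (simp add: T\<tau>)
    finally show ?thesis unfolding A E_def Xb(1) by (simp add: algebra_simps)
  qed
  obtain C where C: "0 \<le> C" "\<And>t r. 0 \<le> t \<Longrightarrow> t \<le> 1 \<Longrightarrow> 0 \<le> r \<Longrightarrow> r \<le> 1 \<Longrightarrow> \<bar>E t r\<bar> \<le> C"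
  proof -
    have f: "continuous_on S (\<lambda>z. G (fst z))" if "\<And>S. continuous_on S G" for G :: "real \<Rightarrow> real" and S :: "(real \<times> real) set"
      by (rule continuous_on_compose2[OF that[of UNIV]]) (auto intro!: continuous_intros)
    have s: "continuous_on S (\<lambda>z. G (snd z))" if "\<And>S. continuous_on S G" for G :: "real \<Rightarrow> real" and S :: "(real \<times> real) set"
      by (rule continuous_on_compose2[OF that[of UNIV]]) (auto intro!: continuous_intros)
    have \<tau>c: "continuous_on S (\<tau> k)" for S k
      unfolding \<tau>_def[abs_def] by (cases "k < K") (use c1[of k] in \<open>auto intro!: continuous_intros \<rho>c hc\<close>)
    have ec: "continuous_on S (e k)" for S k
      unfolding e_def[abs_def] by (intro continuous_intros Xc)
    have "c (K - 1) \<noteq> 0" using c1[of "K - 1"] by simp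
    then have "continuous_on ({0..1} \<times> {0..1}) (\<lambda>z. E (fst z) (snd z))"
      unfolding E_def by (intro continuous_intros f[OF \<rho>c] f[OF hc] f[OF \<tau>c] s[OF ec] s[OF Xc]) auto
    then have "bounded ((\<lambda>z. E (fst z) (snd z)) ` ({0..1} \<times> {0..1}))"
      by (intro compact_imp_bounded compact_continuous_image compact_Times) auto
    then obtain C where C: "\<And>z. z \<in> {0..1} \<times> {0..1} \<Longrightarrow> norm (E (fst z) (snd z)) \<le> C"
      unfolding bounded_iff by (metis (no_types, lifting) imageI)
    show thesis
    proof (rule that[of "max C 0"])
      show "\<bar>E t r\<bar> \<le> max C 0" if "0 \<le> t" "t \<le> 1" "0 \<le> r" "r \<le> 1" for t r
        using C[of "(t, r)"] that by auto
    qed simp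
  qed
  show thesis
  proof (rule that[OF test])
    show "0 \<le> C * 2" using C by simp
    show "0 \<le> \<phi> t x" for t x
      by (rule order_trans[OF _ lower]) (simp add: \<rho>_def X_def)
    show "0 < \<phi> t 0" if "0 < t" "t < 1" for t
    proof -
      have "0 < \<rho> t ^ a / 2" using \<rho>pos[of t] that by simp
      also have "\<dots> \<le> \<phi> t 0" using lower[of t 0] K by (simp add: X_def power_0_left)
      finally show ?thesis .
    qed
    show "\<bar>\<phi>t t x + L t x\<bar> \<le> C * 2 * norm x powr (\<alpha> / p) * \<phi> t x powr (1 / p)" if x: "x \<noteq> 0" for t x
    proof (cases "\<rho> t = 0 \<or> X ((norm x)\<^sup>2) = 0")
      case True
      then show ?thesis using zero[of t x] by simp
    next
      case False
      define r where "r = (norm x)\<^sup>2"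
      have \<rho>: "0 < \<rho> t" "0 \<le> t" "t \<le> 1" using False \<rho>0[of t] \<rho>pos[of t] by auto
      have X: "0 < X r" "X r \<le> 1" using False by (auto simp: X_def r_def)
      have nx: "0 < norm x" "norm x \<le> 1" using x Xz[of x] False by (simp, meson not_le)
      have r: "0 \<le> r" "r \<le> 1" using nx by (auto simp: r_def power_le_one)
      have 1: "r ^ (K - 1) \<le> norm x powr (\<alpha> / p)"
      proof -
        have "r ^ (K - 1) = norm x powr (2 * (real K - 1))"
        proof -
          have "r ^ (K - 1) = norm x ^ (2 * (K - 1))" by (simp only: r_def power_mult)
          also have "\<dots> = norm x powr real (2 * (K - 1))" using nx by (simp only: powr_realpow)
          also have "real (2 * (K - 1)) = 2 * (real K - 1)" using K by (simp add: of_nat_diff)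
          finally show ?thesis .
        qed
        also have "\<dots> \<le> norm x powr (\<alpha> / p)" using nx K by (intro powr_mono') auto
        finally show ?thesis .
      qed
      have 2: "\<rho> t ^ (a - K - 1) \<le> \<rho> t powr (real a / p)"
        using \<rho> \<rho>1[of t] a by (simp add: powr_mono' flip: powr_realpow)
      have 3: "X r ^ (b - 2) \<le> X r powr (real b / p)"
        using X b by (simp add: powr_mono' of_nat_diff flip: powr_realpow)
      \<comment> \<open>The lower bound for \<open>\<phi>\<close> converts the powers of the
        cut-offs into \<open>\<phi> powr (1 / p)\<close>; the lost factor
        \<open>2 powr (1 / p) \<le> 2\<close> explains the constant \<open>C * 2\<close>.\<close>
      have "\<rho> t powr (real a / p) * X r powr (real b / p) = (2 * (\<rho> t ^ a * X r ^ b / 2)) powr (1 / p)"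
        using \<rho> X by (simp add: powr_mult powr_powr flip: powr_realpow)
      also have "\<dots> \<le> (2 * \<phi> t x) powr (1 / p)"
        using lower[of t x] \<rho> X p by (intro powr_mono2) (auto simp: r_def)
      also have "\<dots> = 2 powr (1 / p) * \<phi> t x powr (1 / p)"
        using order_trans[OF _ lower[of t x], of 0] \<rho> X by (simp add: powr_mult r_def)
      also have "\<dots> \<le> 2 powr 1 * \<phi> t x powr (1 / p)"
        using p by (intro mult_right_mono powr_mono) auto
      finally have 4: "\<rho> t powr (real a / p) * X r powr (real b / p) \<le> 2 * \<phi> t x powr (1 / p)" by simp
      have "\<bar>\<phi>t t x + L t x\<bar> = r ^ (K - 1) * (\<rho> t ^ (a - K - 1) * X r ^ (b - 2)) * \<bar>E t r\<bar>"
        unfolding op[OF r_def] using \<rho> X r by (simp add: abs_mult)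
      also have "\<dots> \<le> norm x powr (\<alpha> / p) * (\<rho> t powr (real a / p) * X r powr (real b / p)) * C"
        using \<rho> X r by (intro mult_mono 1 2 3 C) auto
      also have "\<dots> \<le> norm x powr (\<alpha> / p) * (2 * \<phi> t x powr (1 / p)) * C"
        by (intro mult_right_mono mult_left_mono 4 C) auto
      finally show ?thesis by (simp add: mult_ac)
    qed
  qed
qed

section \<open>Parabolic scaling and the contradiction\<close>

lemma C12_on_parabolic_scale:
  fixes \<phi> :: "real \<Rightarrow> real ^ 'n \<Rightarrow> real"
  assumes "C12_on UNIV \<phi> \<phi>t L" "T > 0"
  shows "C12_on UNIV (\<lambda>t x. \<phi> ((t - T) / T) (c *\<^sub>R x)) (\<lambda>t x. \<phi>t ((t - T) / T) (c *\<^sub>R x) / T)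
     (\<lambda>t x. c\<^sup>2 * L ((t - T) / T) (c *\<^sub>R x))"
proof -
  obtain D DD where D0: "\<forall>t\<in>UNIV. second_partials (\<phi> t) (\<lambda>j. D j t) (\<lambda>j. DD j t)"
    "\<forall>j. continuous_on (UNIV \<times> UNIV) (\<lambda>(t, x). DD j t x)"
    "\<forall>t\<in>UNIV. \<forall>x. L t x = (\<Sum>j\<in>UNIV. DD j t x)"
    using assms(1) unfolding C12_on_def by (elim conjE exE)
  note D = D0(1)[rule_format, OF UNIV_I] D0(2)[rule_format] D0(3)[rule_format, OF UNIV_I]
  have cc: "continuous_on (UNIV \<times> UNIV) (\<lambda>(t, x). G ((t - T) / T) (c *\<^sub>R x))"
    if "continuous_on (UNIV \<times> UNIV) (\<lambda>(t, x). G t x)" for G :: "real \<Rightarrow> real ^ 'n \<Rightarrow> real"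
  proof -
    have "continuous_on (UNIV \<times> UNIV) (\<lambda>z. (\<lambda>(t, x). G t x) ((fst z - T) / T, c *\<^sub>R snd z))"
      by (rule continuous_on_compose2[OF that]) (use assms(2) in \<open>auto intro!: continuous_intros\<close>)
    then show ?thesis by (simp add: case_prod_unfold)
  qed
  have e: "c *\<^sub>R (x + k *\<^sub>R axis j 1) = c *\<^sub>R x + (c * k) *\<^sub>R axis j 1" for x :: "real ^ 'n" and k j
    by (simp add: scaleR_add_right)
  have dc: "((\<lambda>k. c * k) has_real_derivative c) (at 0)"
    by (auto intro!: derivative_eq_intros)
  have dd: "((\<lambda>k. G (c *\<^sub>R (x + k *\<^sub>R axis j 1))) has_real_derivative G' * c) (at 0)"
    if "((\<lambda>k. G (c *\<^sub>R x + k *\<^sub>R axis j 1)) has_real_derivative G') (at 0)" for G G' and x :: "real ^ 'n" and j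
    unfolding e using DERIV_chain2[where g = "\<lambda>k. c * k" and x = 0 and f = "\<lambda>k. G (c *\<^sub>R x + k *\<^sub>R axis j 1)", OF _ dc] that by simp
  show ?thesis
    unfolding C12_on_def
  proof (intro conjI exI ballI allI)
    show "continuous_on (UNIV \<times> UNIV) (\<lambda>(t, x). \<phi> ((t - T) / T) (c *\<^sub>R x))"
      by (rule cc[OF C12_onD(1)[OF assms(1)]])
    show "continuous_on (UNIV \<times> UNIV) (\<lambda>(t, x). \<phi>t ((t - T) / T) (c *\<^sub>R x) / T)"
      using cc[OF C12_onD(2)[OF assms(1)]] assms(2)
      by (simp add: case_prod_unfold continuous_on_divide)
    show "((\<lambda>s. \<phi> ((s - T) / T) (c *\<^sub>R x)) has_real_derivative \<phi>t ((t - T) / T) (c *\<^sub>R x) / T) (at t)" for t and x :: "real ^ 'n"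
    proof -
      have "((\<lambda>s. (s - T) / T) has_real_derivative 1 / T) (at t)"
        using assms(2) by (auto intro!: derivative_eq_intros)
      from DERIV_chain2[OF C12_onD(3)[OF assms(1) UNIV_I] this] show ?thesis by simp
    qed
    show "second_partials (\<lambda>x. \<phi> ((t - T) / T) (c *\<^sub>R x)) (\<lambda>j. (\<lambda>j t x. D j ((t - T) / T) (c *\<^sub>R x) * c) j t)
       (\<lambda>j. (\<lambda>j t x. DD j ((t - T) / T) (c *\<^sub>R x) * c * c) j t)" for t
      unfolding second_partials_def
    proof (intro allI conjI)
      fix j and x :: "real ^ 'n"
      have "((\<lambda>k. \<phi> ((t - T) / T) (c *\<^sub>R x + k *\<^sub>R axis j 1)) has_real_derivative D j ((t - T) / T) (c *\<^sub>R x)) (at 0)"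
        "((\<lambda>k. D j ((t - T) / T) (c *\<^sub>R x + k *\<^sub>R axis j 1)) has_real_derivative DD j ((t - T) / T) (c *\<^sub>R x)) (at 0)"
        using D(1)[of "(t - T) / T"] by (simp_all add: second_partials_def)
      from dd[OF this(1)] dd[OF this(2), THEN DERIV_cmult_right, of c]
      show "((\<lambda>h. \<phi> ((t - T) / T) (c *\<^sub>R (x + h *\<^sub>R axis j 1))) has_real_derivative D j ((t - T) / T) (c *\<^sub>R x) * c) (at 0)"
        "((\<lambda>h. D j ((t - T) / T) (c *\<^sub>R (x + h *\<^sub>R axis j 1)) * c) has_real_derivative DD j ((t - T) / T) (c *\<^sub>R x) * c * c) (at 0)"
        by auto
    qed
    show "continuous_on (UNIV \<times> UNIV) (\<lambda>(t, x). (\<lambda>j t x. DD j ((t - T) / T) (c *\<^sub>R x) * c * c) j t x)" for j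
      using cc[OF D(2)[of j]] by (simp add: case_prod_unfold continuous_on_mult_right)
    show "c\<^sup>2 * L ((t - T) / T) (c *\<^sub>R x) = (\<Sum>j\<in>UNIV. (\<lambda>j t x. DD j ((t - T) / T) (c *\<^sub>R x) * c * c) j t x)" for t and x :: "real ^ 'n"
      by (simp add: D(3) sum_distrib_left power2_eq_square mult_ac)
  qed
qed

text \<open>With dilation factor \<open>1 / sqrt T\<close> the time derivative and the Laplacian
  both acquire the factor \<open>1 / T\<close>, so the bound on their sum rescales as a
  whole.\<close>

lemma test_function_parabolic_scale:
  assumes "test_function 0 1 \<phi> \<phi>t L" "T > 0"
  shows "test_function T (2 * T) (\<lambda>t x. \<phi> ((t - T) / T) (x /\<^sub>R sqrt T)) (\<lambda>t x. \<phi>t ((t - T) / T) (x /\<^sub>R sqrt T) / T)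
     (\<lambda>t x. L ((t - T) / T) (x /\<^sub>R sqrt T) / T)"
proof -
  have C: "C12_on UNIV \<phi> \<phi>t L" using assms by (simp add: test_function_def)
  obtain R where R: "\<And>t x. t < 0 \<or> t > 1 \<or> norm x > R \<Longrightarrow> \<phi> t x = 0 \<and> \<phi>t t x = 0 \<and> L t x = 0"
    using assms(1) unfolding test_function_def by blast
  show ?thesis
    unfolding test_function_def
  proof (intro conjI exI[of _ "R * sqrt T"] allI impI)
    have "(inverse (sqrt T))\<^sup>2 = inverse T" using assms(2) by (simp add: power_inverse)
    then show "C12_on UNIV (\<lambda>t x. \<phi> ((t - T) / T) (x /\<^sub>R sqrt T)) (\<lambda>t x. \<phi>t ((t - T) / T) (x /\<^sub>R sqrt T) / T)
     (\<lambda>t x. L ((t - T) / T) (x /\<^sub>R sqrt T) / T)"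
      using C12_on_parabolic_scale[OF C assms(2), of "inverse (sqrt T)"] by (simp add: divide_inverse mult.commute)
    fix t :: real and x :: "real ^ 'a" assume "t < T \<or> 2 * T < t \<or> R * sqrt T < norm x"
    moreover have nr: "norm (x /\<^sub>R sqrt T) > R \<longleftrightarrow> norm x > R * sqrt T"
      using assms(2) by (simp add: divide_inverse_commute[symmetric] pos_less_divide_eq)
    ultimately have "(t - T) / T < 0 \<or> (t - T) / T > 1 \<or> norm (x /\<^sub>R sqrt T) > R"
      unfolding nr using assms(2) by (auto simp: divide_less_0_iff pos_less_divide_eq)
    from R[OF this] show "\<phi> ((t - T) / T) (x /\<^sub>R sqrt T) = 0" "\<phi>t ((t - T) / T) (x /\<^sub>R sqrt T) / T = 0" "L ((t - T) / T) (x /\<^sub>R sqrt T) / T = 0"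
      by auto
  qed
qed

lemma global_solution_weak:
  fixes u :: "real \<Rightarrow> real ^ 'n \<Rightarrow> real"
  assumes \<phi>: "test_function a b \<phi> \<phi>t L" and ab: "0 < a" "a \<le> b"
    and \<alpha>: "- real CARD('n) < \<alpha>" and p: "1 < p" and \<sigma>: "\<sigma> > -1" and m: "m \<le> 0"
    and w: "w \<in> C0" "integrable lborel w" and u: "global_solution \<alpha> p \<sigma> m w u0 u"
  shows "integrable lborel (\<lambda>(t, x). u t x * (\<phi>t t x + L t x))"
    and "integrable lborel (\<lambda>(t, x). norm x powr \<alpha> * \<bar>u t x\<bar> powr p * \<phi> t x)"
    and "(LINT (t, x)|lborel. u t x * (\<phi>t t x + L t x)) =
      - (LINT (t, x)|lborel. norm x powr \<alpha> * \<bar>u t x\<bar> powr p * \<phi> t x) - (LINT (t, x)|lborel. zeta \<sigma> m t * w x * \<phi> t x)"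
    and "integrable lborel (\<lambda>(t, x). zeta \<sigma> m t * w x * \<phi> t x)"
proof -
  have *: "integrable lborel (\<lambda>(t, x). u t x * (\<phi>t t x + L t x)) \<and>
    integrable lborel (\<lambda>(t, x). norm x powr \<alpha> * \<bar>u t x\<bar> powr p * \<phi> t x) \<and>
    (LINT (t, x)|lborel. u t x * (\<phi>t t x + L t x)) =
      - (LINT (t, x)|lborel. norm x powr \<alpha> * \<bar>u t x\<bar> powr p * \<phi> t x) - (LINT (t, x)|lborel. zeta \<sigma> m t * w x * \<phi> t x) \<and>
    integrable lborel (\<lambda>(t, x). zeta \<sigma> m t * w x * \<phi> t x)"
  proof (cases "\<alpha> \<le> 0")
    case True
    then have u: "u0 \<in> bcontfun" "u \<in> CB_strip b" "mild_solution \<alpha> p \<sigma> m w u0 u"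
      using u ab by (auto simp: global_solution_def)
    have "continuous_on UNIV w" using w(1) by (simp add: C0_def)
    note W = mild_solution_weak[OF \<phi> ab \<alpha> True p \<sigma> m this w(2) u]
    show ?thesis by (intro conjI W)
  next
    case False
    then have u: "classical_solution \<alpha> p \<sigma> m w u0 u" and "\<alpha> > 0"
      using u by (auto simp: global_solution_def)
    note W = classical_solution_weak[OF \<phi> ab this(2) p u]
    show ?thesis by (intro conjI W)
  qed
  show "integrable lborel (\<lambda>(t, x). u t x * (\<phi>t t x + L t x))"
    and "integrable lborel (\<lambda>(t, x). norm x powr \<alpha> * \<bar>u t x\<bar> powr p * \<phi> t x)"
    and "(LINT (t, x)|lborel. u t x * (\<phi>t t x + L t x)) =
      - (LINT (t, x)|lborel. norm x powr \<alpha> * \<bar>u t x\<bar> powr p * \<phi> t x) - (LINT (t, x)|lborel. zeta \<sigma> m t * w x * \<phi> t x)"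
    and "integrable lborel (\<lambda>(t, x). zeta \<sigma> m t * w x * \<phi> t x)"
    using * by blast+
qed

text \<open>A form of Young's inequality in which the larger of \<open>B\<close> and
  \<open>A powr (p - 1)\<close> decides which summand suffices. The coefficient 1 of
  \<open>A powr p\<close> is what matches the nonlinear term exactly.\<close>

lemma mult_le_powr_add_powr_conjugate:
  fixes A B p :: real
  assumes "0 \<le> A" "0 \<le> B" "1 < p"
  shows "A * B \<le> A powr p + B powr (p / (p - 1))"
proof (cases "B \<le> A powr (p - 1)")
  case True
  then have "A * B \<le> A * A powr (p - 1)" using assms by (intro mult_left_mono) auto
  also have "\<dots> = A powr p" using assms by (cases "A = 0") (auto simp: powr_mult_base)
  finally show ?thesis using powr_ge_zero[of B "p / (p - 1)"] by linarith
next
  case False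
  then have B: "0 < B" "A powr (p - 1) \<le> B" using powr_ge_zero[of A "p - 1"] by linarith+
  have "A = (A powr (p - 1)) powr (1 / (p - 1))" using assms by (simp add: powr_powr)
  also have "\<dots> \<le> B powr (1 / (p - 1))" using B assms by (intro powr_mono2) auto
  finally have "A * B \<le> B powr (1 / (p - 1)) * B powr 1" using B by (simp add: mult_right_mono)
  also have "\<dots> = B powr (p / (p - 1))" using assms unfolding powr_add[symmetric] by (simp add: field_simps)
  finally show ?thesis using powr_ge_zero[of A p] by linarith
qed

lemma measure_parabolic_cylinder:
  assumes "0 \<le> T" "0 \<le> R"
  shows "emeasure (lborel :: (real \<times> (real ^ 'n)) measure) ({T..2 * T} \<times> cball 0 R) = ennreal (T * (unit_ball_vol (real CARD('n)) * R ^ CARD('n)))"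
proof -
  have "emeasure (lborel \<Otimes>\<^sub>M lborel) ({T..2 * T} \<times> (cball 0 R :: (real ^ 'n) set)) = emeasure lborel {T..2 * T} * emeasure lborel (cball 0 R :: (real ^ 'n) set)"
    by (rule lborel.emeasure_pair_measure_Times) auto
  then show ?thesis using assms by (simp add: lborel_prod emeasure_cball ennreal_mult)
qed

text \<open>The exponent collects \<open>N / 2 + 1\<close> from the volume of the space-time
  cylinder and \<open>- p / (p - 1) - \<alpha> / (2 * (p - 1))\<close> from the second summand in
  Young's inequality. The constant depends on the test function and the parameters, but not on
  \<open>T\<close>.\<close>

lemma forcing_upper_bound:
  fixes u :: "real \<Rightarrow> real ^ 'n \<Rightarrow> real"
  assumes \<phi>: "test_function 0 1 \<phi> \<phi>t L" "\<And>t x. 0 \<le> \<phi> t x" and C: "0 \<le> C"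
      "\<And>t x. x \<noteq> 0 \<Longrightarrow> \<bar>\<phi>t t x + L t x\<bar> \<le> C * norm x powr (\<alpha> / p) * \<phi> t x powr (1 / p)"
    and \<alpha>: "- real CARD('n) < \<alpha>" and p: "1 < p" and \<sigma>: "\<sigma> > -1" and m: "m \<le> 0"
    and w: "w \<in> C0" "integrable lborel w" and u: "global_solution \<alpha> p \<sigma> m w u0 u"
  obtains C1 where "\<And>T. T > 0 \<Longrightarrow> (LINT (t, x)|lborel. zeta \<sigma> m t * w x * \<phi> ((t - T) / T) (x /\<^sub>R sqrt T))
     \<le> C1 * T powr (real CARD('n) / 2 + 1 - p / (p - 1) - \<alpha> / (2 * (p - 1)))"
proof -
  obtain R where R: "R \<ge> 0" "\<And>t x. t < 0 \<or> t > 1 \<or> norm x > R \<Longrightarrow> \<phi> t x = 0 \<and> \<phi>t t x = 0 \<and> L t x = 0"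
  proof -
    obtain R where "\<forall>t x. t < 0 \<or> t > 1 \<or> norm x > R \<longrightarrow> \<phi> t x = 0 \<and> \<phi>t t x = 0 \<and> L t x = 0"
      using \<phi>(1) unfolding test_function_def by (elim conjE exE)
    then show thesis by (intro that[of "max R 0"]) auto
  qed
  let ?C1 = "C powr (p / (p - 1)) * (unit_ball_vol (real CARD('n)) * R ^ CARD('n))"
  show thesis
  proof (rule that[of ?C1])
    fix T :: real assume T: "T > 0"
    define P where "P t x = \<phi>t ((t - T) / T) (x /\<^sub>R sqrt T) / T + L ((t - T) / T) (x /\<^sub>R sqrt T) / T" for t x
    define \<psi> where "\<psi> t x = \<phi> ((t - T) / T) (x /\<^sub>R sqrt T)" for t x
    have \<psi>0: "0 \<le> \<psi> t x" for t x using \<phi>(2) by (simp add: \<psi>_def)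
    have "T \<le> 2 * T" using T by simp
    note W = global_solution_weak[OF test_function_parabolic_scale[OF \<phi>(1) T] T this \<alpha> p \<sigma> m w u, folded P_def \<psi>_def]
    \<comment> \<open>The rescaled operator bound contributes \<open>1 / T\<close> from the
      derivatives and \<open>T powr (- \<alpha> / (2 * p))\<close> from the weight at
      \<open>x / sqrt T\<close>; \<open>Y\<close> is the conjugate power of this factor.\<close>
    define Y where "Y = (C * T powr (- 1 - \<alpha> / (2 * p))) powr (p / (p - 1))"
    have Y0: "0 \<le> Y" by (simp add: Y_def)
    let ?S = "{T..2 * T} \<times> (cball 0 (R * sqrt T) :: (real ^ 'n) set)"
    have S: "emeasure lborel ?S = ennreal (T * (unit_ball_vol (real CARD('n)) * (R * sqrt T) ^ CARD('n)))"
      using T R by (intro measure_parabolic_cylinder) auto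
    have iS: "integrable lborel (\<lambda>z. Y * indicator ?S z)"
      using S by (intro integrable_mult_right integrable_real_indicator) (auto simp: borel_prod[symmetric])
    have pt: "norm (u t x * P t x) \<le> norm x powr \<alpha> * \<bar>u t x\<bar> powr p * \<psi> t x + Y * indicator ?S (t, x)" if x: "x \<noteq> 0" for t x
    proof (cases "(t, x) \<in> ?S")
      case False
      moreover have nr: "norm (x /\<^sub>R sqrt T) > R \<longleftrightarrow> norm x > R * sqrt T"
        using T by (simp add: divide_inverse_commute[symmetric] pos_less_divide_eq)
      ultimately have "(t - T) / T < 0 \<or> (t - T) / T > 1 \<or> norm (x /\<^sub>R sqrt T) > R"
        unfolding nr using T by (auto simp: divide_less_0_iff pos_less_divide_eq)
      from R(2)[OF this] show ?thesis using False Y0 by (simp add: P_def \<psi>_def)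
    next
      case True
      have nx: "norm (x /\<^sub>R sqrt T) powr (\<alpha> / p) = norm x powr (\<alpha> / p) * T powr (- \<alpha> / (2 * p))"
      proof -
        have "inverse (sqrt T) = T powr (- 1 / 2)" using T by (simp add: powr_minus powr_half_sqrt)
        then have n: "norm (x /\<^sub>R sqrt T) = T powr (- 1 / 2) * norm x" using T by simp
        show ?thesis unfolding n by (simp add: powr_mult powr_powr)
      qed
      have "\<bar>P t x\<bar> = \<bar>\<phi>t ((t - T) / T) (x /\<^sub>R sqrt T) + L ((t - T) / T) (x /\<^sub>R sqrt T)\<bar> / T"
        using T by (simp add: P_def add_divide_distrib[symmetric])
      also have "\<dots> \<le> (C * norm (x /\<^sub>R sqrt T) powr (\<alpha> / p) * \<psi> t x powr (1 / p)) / T"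
        unfolding \<psi>_def using T x by (intro divide_right_mono C(2)) auto
      also have "\<dots> = C * T powr (- 1 - \<alpha> / (2 * p)) * (norm x powr (\<alpha> / p) * \<psi> t x powr (1 / p))"
      proof -
        have "T powr (- 1 - \<alpha> / (2 * p)) = T powr (- \<alpha> / (2 * p)) / T"
          using T by (simp add: powr_diff powr_minus field_simps)
        then show ?thesis unfolding nx by simp
      qed
      finally have "norm (u t x * P t x) \<le> \<bar>u t x\<bar> * (C * T powr (- 1 - \<alpha> / (2 * p)) * (norm x powr (\<alpha> / p) * \<psi> t x powr (1 / p)))"
        by (simp add: abs_mult mult_left_mono)
      also have "\<dots> = (norm x powr (\<alpha> / p) * \<bar>u t x\<bar> * \<psi> t x powr (1 / p)) * (C * T powr (- 1 - \<alpha> / (2 * p)))"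
        by (simp add: mult_ac)
      also have "\<dots> \<le> (norm x powr (\<alpha> / p) * \<bar>u t x\<bar> * \<psi> t x powr (1 / p)) powr p + Y"
        unfolding Y_def using C p by (intro mult_le_powr_add_powr_conjugate) auto
      also have "(norm x powr (\<alpha> / p) * \<bar>u t x\<bar> * \<psi> t x powr (1 / p)) powr p = norm x powr \<alpha> * \<bar>u t x\<bar> powr p * \<psi> t x"
        using p \<psi>0[of t x] by (simp add: powr_mult powr_powr)
      finally show ?thesis using True by simp
    qed
    have n0: "AE z in (lborel :: (real \<times> (real ^ 'n)) measure). snd z \<noteq> 0"
    proof -
      have "AE y in (lborel :: (real ^ 'n) measure). y \<noteq> 0" by (rule AE_lborel_singleton)
      then have "AE t in (lborel :: real measure). AE y in (lborel :: (real ^ 'n) measure). snd (t, y) \<noteq> 0" by simp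
      moreover have "{z \<in> space (lborel \<Otimes>\<^sub>M lborel). snd z \<noteq> 0} \<in> sets ((lborel :: real measure) \<Otimes>\<^sub>M (lborel :: (real ^ 'n) measure))"
        by measurable
      ultimately have "AE z in ((lborel :: real measure) \<Otimes>\<^sub>M (lborel :: (real ^ 'n) measure)). snd z \<noteq> 0"
        by (intro lborel_pair.AE_pair_measure)
      then show ?thesis unfolding lborel_prod .
    qed
    let ?N = "\<lambda>z. case z of (t, x) \<Rightarrow> norm x powr \<alpha> * \<bar>u t x\<bar> powr p * \<psi> t x"
    have "- (LINT (t, x)|lborel. u t x * P t x) \<le> (LINT z|lborel. norm (case z of (t, x) \<Rightarrow> u t x * P t x))"
      using integral_norm_bound[of lborel "\<lambda>(t, x). u t x * P t x"] by (simp add: abs_le_iff)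
    also have "\<dots> \<le> (LINT z|lborel. ?N z + Y * indicator ?S z)"
    proof (rule integral_mono_AE)
      show "AE z in lborel. norm (case z of (t, x) \<Rightarrow> u t x * P t x) \<le> ?N z + Y * indicator ?S z"
        using n0
      proof eventually_elim
        case (elim z)
        show ?case
          using pt[OF elim, where t = "fst z"] by (simp only: case_prod_unfold prod.collapse)
      qed
      show "integrable lborel (\<lambda>z. norm (case z of (t, x) \<Rightarrow> u t x * P t x))" using W(1) by (rule integrable_norm)
      show "integrable lborel (\<lambda>z. ?N z + Y * indicator ?S z)" by (rule Bochner_Integration.integrable_add[OF W(2) iS])
    qed
    also have "\<dots> = (LINT z|lborel. ?N z) + Y * measure lborel ?S"
      using W(2) iS by (simp add: Bochner_Integration.integral_add)
    \<comment> \<open>The nonlinear integral of the weak identity and the one produced by Young's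
      inequality cancel.\<close>
    finally have "(LINT (t, x)|lborel. zeta \<sigma> m t * w x * \<psi> t x) \<le> Y * measure lborel ?S"
      using W(3) by simp
    also have "measure lborel ?S = T * (unit_ball_vol (real CARD('n)) * (R * sqrt T) ^ CARD('n))"
      using S T R by (simp add: measure_def)
    also have "(R * sqrt T) ^ CARD('n) = R ^ CARD('n) * T powr (real CARD('n) / 2)"
      using T by (simp add: power_mult_distrib powr_half_sqrt[symmetric] powr_powr flip: powr_realpow)
    also have "Y = C powr (p / (p - 1)) * T powr (- p / (p - 1) - \<alpha> / (2 * (p - 1)))"
    proof -
      have "(- 1 - \<alpha> / (2 * p)) * (p / (p - 1)) = - p / (p - 1) - \<alpha> / (2 * (p - 1))"
      proof -
        have e: "\<alpha> / (2 * p) * (p / (p - 1)) = \<alpha> / (2 * (p - 1))" using p by (simp add: divide_simps)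
        have "(- 1 - A) * B = - B - A * B" for A B :: real by (simp add: left_diff_distrib)
        then show ?thesis unfolding e[symmetric] minus_divide_left[symmetric] .
      qed
      then show ?thesis using C(1) by (simp add: Y_def powr_mult powr_powr)
    qed
    also have "C powr (p / (p - 1)) * T powr (- p / (p - 1) - \<alpha> / (2 * (p - 1))) * (T * (unit_ball_vol (real CARD('n)) * (R ^ CARD('n) * T powr (real CARD('n) / 2))))
      = ?C1 * (T powr (- p / (p - 1) - \<alpha> / (2 * (p - 1))) * (T powr 1 * T powr (real CARD('n) / 2)))"
      using T by (simp add: mult_ac)
    also have "T powr (- p / (p - 1) - \<alpha> / (2 * (p - 1))) * (T powr 1 * T powr (real CARD('n) / 2))
      = T powr (real CARD('n) / 2 + 1 - p / (p - 1) - \<alpha> / (2 * (p - 1)))"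
      unfolding powr_add[symmetric] by (simp add: algebra_simps)
    finally show "(LINT (t, x)|lborel. zeta \<sigma> m t * w x * \<phi> ((t - T) / T) (x /\<^sub>R sqrt T))
     \<le> ?C1 * T powr (real CARD('n) / 2 + 1 - p / (p - 1) - \<alpha> / (2 * (p - 1)))"
      by (simp add: \<psi>_def)
  qed
qed

text \<open>Substituting \<open>t = T * (1 + s)\<close> extracts \<open>T powr (m + 1)\<close>. In
  what is left, \<open>\<phi> s (x / sqrt T)\<close> converges to \<open>\<phi> s 0\<close> under
  the dominating function \<open>B * \<bar>w x\<bar>\<close>, so space and time separate in the
  limit.\<close>

lemma forcing_asymptotics:
  fixes w :: "real ^ 'n \<Rightarrow> real"
  assumes \<phi>: "test_function 0 1 \<phi> \<phi>t L" and w: "integrable lborel w"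
    and i: "\<And>n. integrable lborel (\<lambda>(t, x). zeta \<sigma> m t * w x * \<phi> ((t - real (Suc n)) / real (Suc n)) (x /\<^sub>R sqrt (real (Suc n))))"
  shows "(\<lambda>n. (LINT (t, x)|lborel. zeta \<sigma> m t * w x * \<phi> ((t - real (Suc n)) / real (Suc n)) (x /\<^sub>R sqrt (real (Suc n)))) / real (Suc n) powr (m + 1))
    \<longlonglongrightarrow> (LINT s|lborel. indicator {0..1} s * (1 + s) powr m * \<phi> s 0) * (LINT x|lborel. w x)"
proof -
  have C: "C12_on UNIV \<phi> \<phi>t L" using \<phi> by (simp add: test_function_def)
  have c: "continuous_on UNIV (\<lambda>(t, x). \<phi> t x)" using C12_onD(1)[OF C] by simp
  have cs: "continuous_on UNIV (\<phi> t)" for t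
    using continuous_on_slice[of UNIV \<phi> t] c by simp
  have [measurable]: "\<phi> t \<in> borel_measurable borel" for t
    using cs by (rule borel_measurable_continuous_onI)
  have \<phi>m: "(\<lambda>(t, x). \<phi> t x) \<in> borel_measurable (borel \<Otimes>\<^sub>M borel)"
    using borel_measurable_continuous_onI[OF c] by (simp add: borel_prod)
  have [measurable]: "(\<lambda>z. \<phi> (f z) (g z)) \<in> borel_measurable M"
    if [measurable]: "f \<in> borel_measurable M" "g \<in> borel_measurable M" for f g and M :: "'z measure"
    using measurable_compose[OF measurable_Pair[OF that] \<phi>m] by simp
  have [measurable]: "w \<in> borel_measurable borel" using w by auto
  obtain B where B: "B \<ge> 0" "\<And>t x. \<bar>\<phi> t x\<bar> \<le> B"
    using test_function_bounded[OF \<phi>] by metis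
  obtain R where "\<forall>t x. t < 0 \<or> t > 1 \<or> norm x > R \<longrightarrow> \<phi> t x = 0 \<and> \<phi>t t x = 0 \<and> L t x = 0"
    using \<phi> unfolding test_function_def by (elim conjE exE)
  then have z: "\<phi> t x = 0" if "t < 0 \<or> t > 1" for t x using that by blast
  define \<theta> where "\<theta> n = real (Suc n)" for n
  have \<theta>: "\<theta> n \<ge> 1" for n by (simp add: \<theta>_def)
  define G where "G n s = (LINT x|lborel. w x * \<phi> s (x /\<^sub>R sqrt (\<theta> n)))" for n s
  have Gm[measurable]: "G n \<in> borel_measurable borel" for n
    unfolding G_def[abs_def] by measurable
  have iw: "integrable lborel (\<lambda>x. B * \<bar>w x\<bar>)" using w by simp
  have wb: "norm (w x * \<phi> s y) \<le> B * \<bar>w x\<bar>" for s x y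
    using B(2)[of s y] by (simp add: abs_mult mult.commute[of B] mult_left_mono)
  have Gb: "\<bar>G n s\<bar> \<le> (LINT x|lborel. B * \<bar>w x\<bar>)" for n s
  proof -
    have "\<bar>G n s\<bar> \<le> (LINT x|lborel. \<bar>w x * \<phi> s (x /\<^sub>R sqrt (\<theta> n))\<bar>)"
      unfolding G_def by (rule integral_abs_bound)
    also have "\<dots> \<le> (LINT x|lborel. B * \<bar>w x\<bar>)"
      by (rule integral_mono'[OF iw]) (use wb B(1) in auto)
    finally show ?thesis .
  qed
  have \<theta>l: "(\<lambda>n. inverse (sqrt (\<theta> n))) \<longlonglongrightarrow> 0"
  proof -
    have "(\<lambda>n. sqrt (inverse (real (Suc n)))) \<longlonglongrightarrow> sqrt 0"
      by (intro tendsto_intros LIMSEQ_inverse_real_of_nat)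
    then show ?thesis by (simp add: \<theta>_def real_sqrt_inverse)
  qed
  have Gl: "(\<lambda>n. G n s) \<longlonglongrightarrow> \<phi> s 0 * (LINT x|lborel. w x)" for s
  proof -
    have "(\<lambda>n. LINT x|lborel. w x * \<phi> s (x /\<^sub>R sqrt (\<theta> n))) \<longlonglongrightarrow> (LINT x|lborel. w x * \<phi> s 0)"
    proof (rule integral_dominated_convergence[OF _ _ iw])
      show "AE x in lborel. (\<lambda>n. w x * \<phi> s (x /\<^sub>R sqrt (\<theta> n))) \<longlonglongrightarrow> w x * \<phi> s 0"
      proof (rule AE_I2)
        fix x :: "real ^ 'n"
        have "isCont (\<phi> s) 0" using cs by (simp add: continuous_on_eq_continuous_at)
        moreover have "(\<lambda>n. x /\<^sub>R sqrt (\<theta> n)) \<longlonglongrightarrow> 0"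
          using tendsto_scaleR[OF \<theta>l tendsto_const[of x]] by simp
        ultimately show "(\<lambda>n. w x * \<phi> s (x /\<^sub>R sqrt (\<theta> n))) \<longlonglongrightarrow> w x * \<phi> s 0"
          by (intro tendsto_mult tendsto_const isCont_tendsto_compose[of 0 "\<phi> s"])
      qed
      show "AE x in lborel. norm (w x * \<phi> s (x /\<^sub>R sqrt (\<theta> n))) \<le> B * \<bar>w x\<bar>" for n
        using wb by simp
    qed measurable
    then show ?thesis by (simp add: G_def mult.commute)
  qed
  have m1: "(1 + s) powr m \<le> max 1 (2 powr m)" if "0 \<le> s" "s \<le> 1" for s
  proof (cases "m \<le> 0")
    case True
    then have "(1 + s) powr m \<le> (1 + s) powr 0" using that by (intro powr_mono) auto
    then show ?thesis using that by simp
  next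
    case False
    then have "(1 + s) powr m \<le> 2 powr m" using that by (intro powr_mono2) auto
    then show ?thesis by simp
  qed
  have lim: "(\<lambda>n. LINT s|lborel. indicator {0..1} s * (1 + s) powr m * G n s) \<longlonglongrightarrow>
    (LINT s|lborel. indicator {0..1} s * (1 + s) powr m * (\<phi> s 0 * (LINT x|lborel. w x)))"
  proof (rule integral_dominated_convergence[where w = "\<lambda>s. indicator {0..1} s * (max 1 (2 powr m) * (LINT x|lborel. B * \<bar>w x\<bar>))"])
    show "integrable lborel (\<lambda>s :: real. indicator {0..1} s * (max 1 (2 powr m) * (LINT x|lborel. B * \<bar>w x\<bar>)) :: real)"
      by (intro integrable_mult_left integrable_real_indicator) auto
    show "AE s in lborel. (\<lambda>n. indicator {0..1} s * (1 + s) powr m * G n s) \<longlonglongrightarrow> indicator {0..1} s * (1 + s) powr m * (\<phi> s 0 * (LINT x|lborel. w x))"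
      by (intro AE_I2 tendsto_mult tendsto_const Gl[unfolded tendsto_mult])
    show "AE s in lborel. norm (indicator {0..1} s * (1 + s) powr m * G n s) \<le> indicator {0..1} s * (max 1 (2 powr m) * (LINT x|lborel. B * \<bar>w x\<bar>))" for n
      using m1 Gb by (intro AE_I2) (auto simp: indicator_def abs_mult intro!: mult_mono)
  qed measurable
  have eq: "(LINT (t, x)|lborel. zeta \<sigma> m t * w x * \<phi> ((t - \<theta> n) / \<theta> n) (x /\<^sub>R sqrt (\<theta> n))) / \<theta> n powr (m + 1)
    = (LINT s|lborel. indicator {0..1} s * (1 + s) powr m * G n s)" for n
  proof -
    have "(LINT (t, x)|lborel. zeta \<sigma> m t * w x * \<phi> ((t - \<theta> n) / \<theta> n) (x /\<^sub>R sqrt (\<theta> n)))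
      = (LINT t|lborel. LINT x|lborel. zeta \<sigma> m t * w x * \<phi> ((t - \<theta> n) / \<theta> n) (x /\<^sub>R sqrt (\<theta> n)))"
      using lborel_pair.integral_fst[of "\<lambda>t x. zeta \<sigma> m t * w x * \<phi> ((t - \<theta> n) / \<theta> n) (x /\<^sub>R sqrt (\<theta> n))"] i[of n]
      by (simp add: lborel_prod \<theta>_def)
    also have "\<dots> = (LINT t|lborel. zeta \<sigma> m t * G n ((t - \<theta> n) / \<theta> n))"
      by (simp add: G_def mult.assoc)
    also have "\<dots> = \<theta> n * (LINT s|lborel. zeta \<sigma> m (\<theta> n + \<theta> n * s) * G n ((\<theta> n + \<theta> n * s - \<theta> n) / \<theta> n))"
      using \<theta>[of n] by (subst lborel_integral_real_affine[of "\<theta> n" _ "\<theta> n"]) auto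
    also have "(LINT s|lborel. zeta \<sigma> m (\<theta> n + \<theta> n * s) * G n ((\<theta> n + \<theta> n * s - \<theta> n) / \<theta> n))
       = (LINT s|lborel. \<theta> n powr m * (indicator {0..1} s * (1 + s) powr m * G n s))"
    proof (rule Bochner_Integration.integral_cong[OF refl])
      fix s
      have s: "(\<theta> n + \<theta> n * s - \<theta> n) / \<theta> n = s" using \<theta>[of n] by simp
      show "zeta \<sigma> m (\<theta> n + \<theta> n * s) * G n ((\<theta> n + \<theta> n * s - \<theta> n) / \<theta> n) = \<theta> n powr m * (indicator {0..1} s * (1 + s) powr m * G n s)"
        unfolding s
      proof (cases "s \<in> {0..1}")
        case True
        \<comment> \<open>The scale \<open>\<theta> n \<ge> 1\<close> keeps the time
          \<open>\<theta> n * (1 + s)\<close> at or above 1, including the end point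
          \<open>s = 0\<close>, so \<open>zeta\<close> is given by its second branch.\<close>
        then have "1 * 1 \<le> \<theta> n * (1 + s)" using \<theta>[of n] by (intro mult_mono) auto
        then have "zeta \<sigma> m (\<theta> n + \<theta> n * s) = (\<theta> n * (1 + s)) powr m"
          by (simp add: zeta_def distrib_left)
        also have "\<dots> = \<theta> n powr m * (1 + s) powr m" by (rule powr_mult)
        finally show "zeta \<sigma> m (\<theta> n + \<theta> n * s) * G n s = \<theta> n powr m * (indicator {0..1} s * (1 + s) powr m * G n s)"
          using True by simp
      next
        case False
        then have "G n s = 0" using z[of s] by (auto simp: G_def not_le)
        then show "zeta \<sigma> m (\<theta> n + \<theta> n * s) * G n s = \<theta> n powr m * (indicator {0..1} s * (1 + s) powr m * G n s)" by simp
      qed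
    qed
    also have "\<theta> n * \<dots> = \<theta> n powr (m + 1) * (LINT s|lborel. indicator {0..1} s * (1 + s) powr m * G n s)"
      using \<theta>[of n] by (simp add: powr_add)
    finally show ?thesis using \<theta>[of n] by simp
  qed
  show ?thesis
    using lim unfolding eq[symmetric] by (simp add: \<theta>_def mult.assoc[symmetric])
qed

theorem theorem1p3:
  fixes \<alpha> \<sigma> m p :: real and w :: "real ^ 'n \<Rightarrow> real"
  assumes "CARD('n) \<ge> 3"
    and "\<alpha> > -2" and "\<sigma> > -1" and "m \<le> 0"
    and "1 < p" and "p < (real CARD('n) - 2 * m + \<alpha>) / (real CARD('n) - 2 * m - 2)"
    and "w \<in> C0" and "integrable lborel w" and "(LINT x|lborel. w x) > 0"
  shows "\<not> (\<exists>u\<^sub>0 u. global_solution \<alpha> p \<sigma> m w u\<^sub>0 u)"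
proof
  assume "\<exists>u\<^sub>0 u. global_solution \<alpha> p \<sigma> m w u\<^sub>0 u"
  then obtain u\<^sub>0 u where u: "global_solution \<alpha> p \<sigma> m w u\<^sub>0 u" by blast
  let ?N = "real CARD('n)"
  have \<alpha>: "- ?N < \<alpha>" using assms(1,2) by linarith
  obtain \<phi> \<phi>t L :: "real \<Rightarrow> real ^ 'n \<Rightarrow> real" and C where \<phi>: "test_function 0 1 \<phi> \<phi>t L" and C: "0 \<le> C"
    and \<phi>0: "\<And>t x. 0 \<le> \<phi> t x" and \<phi>pos: "\<And>t. 0 < t \<Longrightarrow> t < 1 \<Longrightarrow> 0 < \<phi> t 0"
    and \<phi>C: "\<And>t x. x \<noteq> 0 \<Longrightarrow> \<bar>\<phi>t t x + L t x\<bar> \<le> C * norm x powr (\<alpha> / p) * \<phi> t x powr (1 / p)"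
    by (rule base_test_function[OF assms(5)]) (rule that)
  let ?I = "\<lambda>T. LINT (t, x)|lborel. zeta \<sigma> m t * w x * \<phi> ((t - T) / T) (x /\<^sub>R sqrt T)"
  let ?\<kappa> = "?N / 2 + 1 - p / (p - 1) - \<alpha> / (2 * (p - 1))"
  obtain C1 where C1: "\<And>T. T > 0 \<Longrightarrow> ?I T \<le> C1 * T powr ?\<kappa>"
    using forcing_upper_bound[OF \<phi> \<phi>0 C \<phi>C \<alpha> assms(5,3,4,7,8) u] by blast
  have i: "integrable lborel (\<lambda>(t, x). zeta \<sigma> m t * w x * \<phi> ((t - real (Suc n)) / real (Suc n)) (x /\<^sub>R sqrt (real (Suc n))))" for n
    by (rule global_solution_weak(4)[OF test_function_parabolic_scale[OF \<phi>] _ _ \<alpha> assms(5,3,4,7,8) u]) auto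
  let ?c = "LINT s|lborel. indicator {0..1} s * (1 + s) powr m * \<phi> s 0"
  have lim: "(\<lambda>n. ?I (real (Suc n)) / real (Suc n) powr (m + 1)) \<longlonglongrightarrow> ?c * (LINT x|lborel. w x)"
    by (rule forcing_asymptotics[OF \<phi> assms(8) i])
  \<comment> \<open>Here the upper bound on \<open>p\<close> enters. As \<open>N \<ge> 3\<close> and
    \<open>m \<le> 0\<close> make the denominator positive, it is equivalent to
    \<open>(N - 2 * m) * (p - 1) < 2 * p + \<alpha>\<close>, and division by
    \<open>2 * (p - 1)\<close> compares the two exponents.\<close>
  have "?\<kappa> - (m + 1) < 0"
  proof -
    have d: "0 < ?N - 2 * m - 2" using assms(1,4) by linarith
    then have "p * (?N - 2 * m - 2) < ?N - 2 * m + \<alpha>"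
      using assms(6) by (simp add: pos_less_divide_eq)
    then have "(?N - 2 * m) * (p - 1) < 2 * p + \<alpha>" by (simp add: algebra_simps)
    then have "?N - 2 * m < (2 * p + \<alpha>) / (p - 1)" using assms(5) by (simp add: pos_less_divide_eq)
    then have "?N - 2 * m < 2 * (p / (p - 1)) + \<alpha> / (p - 1)"
      by (simp add: add_divide_distrib)
    \<comment> \<open>With \<open>X\<close> and \<open>Y\<close> in place of the two quotients the
      inequality becomes linear.\<close>
    moreover have "?N / 2 + 1 - X - Y / 2 - (m + 1) < 0" if "?N - 2 * m < 2 * X + Y" for X Y
      using that by argo
    ultimately have "?N / 2 + 1 - p / (p - 1) - \<alpha> / (p - 1) / 2 - (m + 1) < 0" by blast
    then show ?thesis by (simp only: divide_divide_eq_left mult.commute)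
  qed
  then have "((\<lambda>T. T powr (?\<kappa> - (m + 1))) \<longlongrightarrow> 0) at_top"
    by (intro tendsto_neg_powr filterlim_ident)
  moreover have "filterlim (\<lambda>n. real (Suc n)) at_top sequentially"
    by (rule filterlim_compose[OF filterlim_real_sequentially filterlim_Suc])
  ultimately have "(\<lambda>n. real (Suc n) powr (?\<kappa> - (m + 1))) \<longlonglongrightarrow> 0"
    by (rule filterlim_compose)
  then have "(\<lambda>n. C1 * real (Suc n) powr (?\<kappa> - (m + 1))) \<longlonglongrightarrow> C1 * 0"
    by (intro tendsto_mult tendsto_const)
  moreover have "?I (real (Suc n)) / real (Suc n) powr (m + 1) \<le> C1 * real (Suc n) powr (?\<kappa> - (m + 1))" for n
  proof -
    have "?I (real (Suc n)) / real (Suc n) powr (m + 1) \<le> C1 * real (Suc n) powr ?\<kappa> / real (Suc n) powr (m + 1)"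
      by (intro divide_right_mono C1) auto
    also have "\<dots> = C1 * real (Suc n) powr (?\<kappa> - (m + 1))"
      by (simp only: powr_diff[of "real (Suc n)" ?\<kappa> "m + 1"] times_divide_eq_right)
    finally show ?thesis .
  qed
  \<comment> \<open>After division by \<open>T powr (m + 1)\<close> the upper bound tends to 0 and
    the forcing term to \<open>?c\<close> times the positive integral of \<open>w\<close>, so
    \<open>?c\<close> cannot be positive.\<close>
  ultimately have "?c * (LINT x|lborel. w x) \<le> C1 * 0"
    by (intro LIMSEQ_le[OF lim]) auto
  then have c0: "?c \<le> 0" using assms(9) by (simp add: mult_le_0_iff)
  have ci: "integrable lborel (\<lambda>s. indicator {0..1} s * (1 + s) powr m * \<phi> s 0)"
  proof -
    have "C12_on UNIV \<phi> \<phi>t L" using \<phi> by (simp add: test_function_def)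
    from continuous_on_slice_time[OF C12_onD(1)[OF this], of 0]
    have "continuous_on {0..1} (\<lambda>s. (1 + s) powr m * \<phi> s 0)"
      by (intro continuous_on_mult continuous_intros) (auto intro: continuous_on_subset)
    from borel_integrable_compact[OF compact_Icc this] show ?thesis by (simp add: mult.assoc)
  qed
  have cn: "0 \<le> indicator {0..1} s * (1 + s) powr m * \<phi> s 0" for s
    using \<phi>0 by simp
  have "0 \<le> ?c" by (rule Bochner_Integration.integral_nonneg) (rule cn)
  then have "?c = 0" using c0 by simp
  \<comment> \<open>A nonnegative integrand with vanishing integral is zero almost everywhere;
    positivity of \<open>\<phi> s 0\<close> on the open unit interval would then make that interval
    a null set.\<close>
  then have "AE s in lborel. indicator {0..1} s * (1 + s) powr m * \<phi> s 0 = 0"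
    using integral_nonneg_eq_0_iff_AE[OF ci] cn by simp
  then have "AE s in lborel. s \<notin> {0<..<1 :: real}"
  proof eventually_elim
    case (elim s)
    then show ?case using \<phi>pos[of s] by (cases "0 < s \<and> s < 1") auto
  qed
  then have "{0<..<1 :: real} \<in> null_sets lborel"
    by (subst AE_iff_null_sets) auto
  then show False by (simp add: null_sets_def)
qed

end
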